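(* Let $p>1$ be an integer and let $\{c_n\}_{n\ge 0}$ be a sequence of integers with $p$-adic collision exponent $\Gamma_p(\{c_n\})<2$. Then any $p$-invariant ergodic Borel probability measure $\mu$ on $\mathbb{T}=\mathbb{R}/\mathbb{Z}$ with positive entropy $h(\mu,\sigma_p)>0$ is $\{c_n\}$-generic, i.e. $$\frac1N\sum_{n=0}^{N-1}\sigma_{c_n}\mu \longrightarrow \lambda \quad\text{in the weak* topology as } N\to\infty,$$ where $\lambda$ is Lebesgue measure on $\mathbb{T}$.
   Context: For an integer $c$, $\sigma_c(x)=cx\pmod 1$ on $\mathbb{T}$ and $(\sigma_c\mu)(A)=\mu(\sigma_c^{-1}A)$. $\mu$ is $p$-invariant if $\sigma_p\mu=\mu$; ergodicity and the Kolmogorov–Sinai entropy $h(\mu,\sigma_p)$ are with respect to $\sigma_p$. The $p$-adic collision exponent of an integer sequence $\{c_n\}$ is $$\Gamma_p(\{c_n\})=\limsup_{n\to\infty}\frac{\log\left|\{(k,\ell): 0\le k,\ell<p^n,\ c_k\equiv c_\ell \pmod{p^n}\}\right|}{n\log p}.$$ *)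

theory Defs
  imports "HOL-Probability.Probability" "HOL-Number_Theory.Cong"
begin

quotient_type circle = real / "\<lambda>x y :: real. x - y \<in> \<int>"
  morphisms rep_circle to_circle
proof (rule equivpI)
  show "reflp (\<lambda>x y :: real. x - y \<in> \<int>)"
    by (simp add: reflp_def)
  show "symp (\<lambda>x y :: real. x - y \<in> \<int>)"
    by (rule sympI) (use Ints_minus in fastforce)
  show "transp (\<lambda>x y :: real. x - y \<in> \<int>)"
  proof (rule transpI)
    fix x y z :: real
    assume "x - y \<in> \<int>" "y - z \<in> \<int>"
    then have "(x - y) + (y - z) \<in> \<int>"
      by (rule Ints_add)
    then show "x - z \<in> \<int>"
      by simp
  qed
qed

instantiation circle :: topological_space
begin

definition open_circle :: "circle set \<Rightarrow> bool" where
  "open_circle U \<longleftrightarrow> open (to_circle -` U)"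

instance
proof
  show "open (UNIV :: circle set)"
    by (simp add: open_circle_def)
next
  fix S T :: "circle set"
  assume "open S" "open T"
  then show "open (S \<inter> T)"
    by (simp add: open_circle_def open_Int)
next
  fix K :: "circle set set"
  assume "\<forall>S\<in>K. open S"
  then show "open (\<Union>K)"
    by (auto simp: open_circle_def vimage_Union)
qed

end

lemma continuous_on_to_circle: "continuous_on UNIV to_circle"
  by (simp add: continuous_on_open_vimage open_circle_def)

lemma measurable_to_circle [measurable]: "to_circle \<in> borel_measurable borel"
  by (intro borel_measurable_continuous_onI continuous_on_to_circle)

lift_definition times_map :: "int \<Rightarrow> circle \<Rightarrow> circle" is "\<lambda>c x. of_int c * x"
proof -
  fix c :: int and x y :: real
  assume "x - y \<in> \<int>"
  then have "of_int c * (x - y) \<in> \<int>"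
    by (intro Ints_mult Ints_of_int)
  then show "of_int c * x - of_int c * y \<in> \<int>"
    by (simp add: algebra_simps)
qed

lemma continuous_on_times_map: "continuous_on UNIV (times_map c)"
proof -
  have "open (times_map c -` U)" if "open U" for U
  proof -
    have "open ((\<lambda>x. of_int c * x) -` (to_circle -` U))"
      using that continuous_on_to_circle by (intro open_vimage continuous_intros)
    also have "(\<lambda>x. of_int c * x) -` (to_circle -` U) = to_circle -` (times_map c -` U)"
      by (auto simp: times_map.abs_eq)
    finally show ?thesis
      by (simp add: open_circle_def)
  qed
  then show ?thesis
    by (simp add: continuous_on_open_vimage)
qed

lemma measurable_times_map [measurable]: "times_map c \<in> borel_measurable borel"
  by (intro borel_measurable_continuous_onI continuous_on_times_map)

definition circle_lebesgue :: "circle measure" where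
  "circle_lebesgue = distr (restrict_space lborel {0..<1}) borel to_circle"

lemma prob_space_circle_lebesgue: "prob_space circle_lebesgue"
proof -
  interpret prob_space "restrict_space lborel {0..<1::real}"
    by (rule prob_spaceI) (simp add: emeasure_restrict_space space_restrict_space)
  have "to_circle \<in> measurable (restrict_space lborel {0..<1}) borel"
    by (intro measurable_restrict_space1) simp
  then show ?thesis
    unfolding circle_lebesgue_def by (rule prob_space_distr)
qed

definition invariant_measure :: "'a measure \<Rightarrow> ('a \<Rightarrow> 'a) \<Rightarrow> bool" where
  "invariant_measure M T \<longleftrightarrow> T \<in> measurable M M \<and> distr M M T = M"

definition ergodic :: "'a measure \<Rightarrow> ('a \<Rightarrow> 'a) \<Rightarrow> bool" where
  "ergodic M T \<longleftrightarrow>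
    (\<forall>A\<in>sets M. T -` A \<inter> space M = A \<longrightarrow> measure M A = 0 \<or> measure M A = 1)"

definition finite_measurable_partition :: "'a measure \<Rightarrow> 'a set set \<Rightarrow> bool" where
  "finite_measurable_partition M P \<longleftrightarrow>
    partition_on (space M) P \<and> finite P \<and> P \<subseteq> sets M"

text \<open>
  The summand at a null set is \<open>0\<close>, in accordance with the convention \<open>0 log 0 = 0\<close>.
\<close>

definition partition_entropy :: "'a measure \<Rightarrow> 'a set set \<Rightarrow> real" where
  "partition_entropy M P = - (\<Sum>A\<in>P. measure M A * ln (measure M A))"

text \<open>
  The join of the partitions \<open>T\<^sup>-\<^sup>i P\<close> for \<open>i < n\<close>. It may contain the empty set as an additional
  member; this does not affect the entropy.
\<close>

definition iterated_join :: "'a measure \<Rightarrow> ('a \<Rightarrow> 'a) \<Rightarrow> 'a set set \<Rightarrow> nat \<Rightarrow> 'a set set" where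
  "iterated_join M T P n =
    (\<lambda>A. space M \<inter> (\<Inter>i<n. (T ^^ i) -` A i)) ` ({..<n} \<rightarrow>\<^sub>E P)"

text \<open>
  For an invariant probability measure the sequence below converges by subadditivity, so that
  the upper limit is the usual limit.
\<close>

definition entropy_of_partition :: "'a measure \<Rightarrow> ('a \<Rightarrow> 'a) \<Rightarrow> 'a set set \<Rightarrow> ereal" where
  "entropy_of_partition M T P =
    limsup (\<lambda>n. ereal (partition_entropy M (iterated_join M T P n) / real n))"

definition ks_entropy :: "'a measure \<Rightarrow> ('a \<Rightarrow> 'a) \<Rightarrow> ereal" where
  "ks_entropy M T = (SUP P\<in>{P. finite_measurable_partition M P}. entropy_of_partition M T P)"

definition collisions :: "nat \<Rightarrow> (nat \<Rightarrow> int) \<Rightarrow> nat \<Rightarrow> (nat \<times> nat) set" where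
  "collisions p c n = {(k, l). k < p ^ n \<and> l < p ^ n \<and> [c k = c l] (mod int p ^ n)}"

definition collision_exponent :: "nat \<Rightarrow> (nat \<Rightarrow> int) \<Rightarrow> ereal" where
  "collision_exponent p c =
    limsup (\<lambda>n. ereal (ln (real (card (collisions p c n))) / (real n * ln (real p))))"

definition averaged_measure :: "(nat \<Rightarrow> int) \<Rightarrow> circle measure \<Rightarrow> nat \<Rightarrow> circle measure" where
  "averaged_measure c M N =
    measure_of UNIV (sets borel)
      (\<lambda>A. (\<Sum>n<N. emeasure (distr M borel (times_map (c n))) A) / of_nat N)"

lemma sets_averaged_measure [simp]: "sets (averaged_measure c M N) = sets borel"
  unfolding averaged_measure_def
  using sets.sets_measure_of_eq[of borel] by simp

lemma emeasure_averaged_measure: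
  assumes "A \<in> sets borel"
  shows "emeasure (averaged_measure c M N) A =
    (\<Sum>n<N. emeasure (distr M borel (times_map (c n))) A) / of_nat N"
proof (rule emeasure_measure_of[OF averaged_measure_def])
  show "sets (borel :: circle measure) \<subseteq> Pow UNIV"
    by simp
  show "A \<in> sets (averaged_measure c M N)"
    using assms by simp
  show "positive (sets (averaged_measure c M N))
      (\<lambda>A. (\<Sum>n<N. emeasure (distr M borel (times_map (c n))) A) / of_nat N)"
    by (simp add: positive_def)
  show "countably_additive (sets (averaged_measure c M N))
      (\<lambda>A. (\<Sum>n<N. emeasure (distr M borel (times_map (c n))) A) / of_nat N)"
  proof (rule countably_additiveI)
    fix B :: "nat \<Rightarrow> circle set"
    assume B: "range B \<subseteq> sets (averaged_measure c M N)" "disjoint_family B"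
    have "(\<Sum>i. (\<Sum>n<N. emeasure (distr M borel (times_map (c n))) (B i)) / of_nat N) =
        (\<Sum>n<N. \<Sum>i. emeasure (distr M borel (times_map (c n))) (B i)) / of_nat N"
      by (simp add: suminf_sum)
    also have "\<dots> = (\<Sum>n<N. emeasure (distr M borel (times_map (c n))) (\<Union>i. B i)) / of_nat N"
      using B by (simp add: suminf_emeasure)
    finally show "(\<Sum>i. (\<Sum>n<N. emeasure (distr M borel (times_map (c n))) (B i)) / of_nat N) =
        (\<Sum>n<N. emeasure (distr M borel (times_map (c n))) (\<Union>i. B i)) / of_nat N" .
  qed
qed

text \<open>
  The circle is compact, so continuous test functions are automatically bounded.
\<close>

definition weak_star_conv :: "(nat \<Rightarrow> circle measure) \<Rightarrow> circle measure \<Rightarrow> bool" where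
  "weak_star_conv Ms M \<longleftrightarrow>
    (\<forall>f :: circle \<Rightarrow> real. continuous_on UNIV f \<longrightarrow>
      (\<lambda>N. integral\<^sup>L (Ms N) f) \<longlonglongrightarrow> integral\<^sup>L M f)"

definition generic :: "(nat \<Rightarrow> int) \<Rightarrow> circle measure \<Rightarrow> bool" where
  "generic c M \<longleftrightarrow> weak_star_conv (averaged_measure c M) circle_lebesgue"

end

theory Submission
  imports Defs "HOL-Real_Asymp.Real_Asymp"
begin

text \<open>
  By Weyl's criterion it suffices that the Fourier coefficients of \<open>\<mu>\<close> at \<open>a c\<^sub>n\<close> tend to \<open>0\<close> in density.
  Since \<open>\<Gamma>\<^sub>p < 2\<close>, Cauchy-Schwarz shows that few of the \<open>c\<^sub>n\<close>, \<open>n < p\<^sup>J\<close>, fall into any set of \<open>p\<^sup>o\<^sup>(\<^sup>J\<^sup>)\<close> residues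
  modulo \<open>p\<^sup>J\<close>, so the point is that the residues of the frequencies with coefficient larger than \<open>\<epsilon>\<close>
  are that few.

  Group the base \<open>p\<close> digits into blocks of length \<open>g\<close>, put \<open>b = p\<^sup>g\<close>, and expand the character
  \<open>x \<mapsto> e(m x)\<close> through the transfer operator of \<open>x \<mapsto> b x\<close>. At a point whose conditional law on the \<open>b\<close>
  inverse branches has atoms with differences generating a subgroup of small index in \<open>\<int>/b\<close>, only few
  of the \<open>b\<close> possible new digits of \<open>m\<close> avoid cancellation; for a large exponent \<open>2 s\<close> this bounds the
  \<open>\<ell>\<^sup>2\<^sup>s\<close> norm over all residues. Branches that meet too many of the remaining points are discarded at a
  small cost.

  It remains to see that for large \<open>g\<close> most points are of this kind, i.e. that for each prime \<open>q\<close>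
  dividing \<open>p\<close> the future does not determine the past digits modulo all powers of \<open>q\<close>. By ergodicity it
  would otherwise do so almost surely. Then the residue of the past \<open>k\<close>-block modulo \<open>q\<^sup>k\<close> would have entropy
  at most the mutual information \<open>o(k)\<close> between that block and the future. But a block of \<open>k\<close> digits is
  recovered from the residues of two longer blocks, as \<open>p\<^sup>k \<le> q\<^sup>p\<^sup>k\<close>, so the entropy would be zero.
\<close>

subsection \<open>Norms of averages of twisted functions\<close>

text \<open>The order of quantifiers shapes the proof. Each block of \<open>g\<close> digits costs a
  factor \<open>2 * p ^ k\<close>, at most \<open>p ^ (k + 1)\<close>, out of \<open>p ^ g\<close>
  residues, and this is an arbitrarily small power only if \<open>k\<close> is fixed before
  \<open>g\<close>. Hence the non-degeneracy modulo \<open>q ^ k\<close> for each prime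
  \<open>q\<close> dividing \<open>p\<close>: two heavy atoms that differ modulo each
  \<open>q ^ k\<close> leave at most \<open>p ^ k\<close> annihilating digits, whatever
  \<open>g \<ge> k\<close> is. Only afterwards come the mass threshold \<open>\<kappa>\<close> and
  the exponent \<open>2 * s\<close>; they may be extreme, since \<open>s\<close> enters the final
  count through a constant factor only. A second moment would not do: by Parseval it gains no more
  than the largest atom, a constant factor per block when that atom is not small. A high moment
  isolates the frequencies without any cancellation, and those are controlled algebraically by the
  positions of the atoms instead of their sizes.\<close>

lemma cis_int_div_eq_1_iff:
  fixes b :: nat and c :: int
  assumes "b > 0"
  shows "cis (2 * pi * of_int c / of_nat b) = 1 \<longleftrightarrow> int b dvd c"
proof
  assume "cis (2 * pi * of_int c / of_nat b) = 1"
  then have "cos (2 * pi * of_int c / of_nat b) = 1"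
    by (simp add: complex_eq_iff)
  then obtain i :: int where i: "2 * pi * of_int c / of_nat b = of_int i * 2 * pi"
    unfolding cos_one_2pi_int by blast
  then have "real_of_int c = of_int i * of_nat b"
    using assms by (simp add: field_simps)
  then have "c = i * int b"
    by (metis of_int_eq_iff of_int_mult of_int_of_nat_eq)
  then show "int b dvd c" by simp
next
  assume "int b dvd c"
  then obtain i where "c = int b * i" by auto
  then have "2 * pi * of_int c / of_nat b = 2 * pi * of_int i"
    using assms by simp
  then show "cis (2 * pi * of_int c / of_nat b) = 1"
    by (metis cis_multiple_2pi Ints_of_int)
qed

text \<open>The root of unity depends only on \<open>c mod int b\<close>, so finitely many values
  other than 1 occur and their distances to 1 have a positive minimum.\<close>

lemma cis_int_div_separated:
  fixes b :: nat
  assumes "b > 0"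
  obtains d where "d > 0"
    "\<And>c :: int. norm (cis (2 * pi * of_int c / of_nat b) - 1) < d \<Longrightarrow> int b dvd c"
proof -
  define w where "w c = cis (2 * pi * of_int c / of_nat b)" for c :: int
  have per: "w c = w (c mod int b)" for c
  proof -
    have "w c = w (int b * (c div int b) + c mod int b)" by simp
    also have "2 * pi * of_int (int b * k + j) / of_nat b
        = 2 * pi * of_int k + 2 * pi * of_int j / of_nat b" for k j :: int
      using assms by (simp add: field_simps)
    then have "w (int b * (c div int b) + c mod int b) = w (c mod int b)"
      unfolding w_def by (simp only: cis_mult [symmetric] cis_multiple_2pi Ints_of_int) simp
    finally show ?thesis .
  qed
  \<comment> \<open>Inserting 1 keeps the set nonempty when \<open>b = 1\<close>, where there is no
    nonzero residue.\<close>
  define S where "S = insert 1 ((\<lambda>c. norm (w c - 1)) ` {1..<int b})"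
  have fin: "finite S" "S \<noteq> {}" by (auto simp: S_def)
  have pos: "x > 0" if "x \<in> S" for x
    using that cis_int_div_eq_1_iff[OF assms] zdvd_not_zless
    by (auto simp: S_def w_def dest!: zdvd_imp_le)
  show ?thesis
  proof
    show "Min S > 0" using fin pos by simp
    fix c :: int assume "norm (cis (2 * pi * of_int c / of_nat b) - 1) < Min S"
    then have lt: "norm (w (c mod int b) - 1) < Min S"
      using per by (simp add: w_def)
    show "int b dvd c"
    proof (rule ccontr)
      assume "\<not> int b dvd c"
      then have "c mod int b \<noteq> 0" by (simp add: dvd_eq_mod_eq_0)
      moreover have "0 \<le> c mod int b" "c mod int b < int b" using assms by auto
      ultimately have "c mod int b \<in> {1..<int b}" by auto
      then have "norm (w (c mod int b) - 1) \<in> S" by (auto simp: S_def)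
      then have "Min S \<le> norm (w (c mod int b) - 1)" using fin by simp
      with lt show False by simp
    qed
  qed
qed

lemma variance_identity:
  fixes P :: "'a \<Rightarrow> real" and u :: "'a \<Rightarrow> complex"
  assumes "(\<Sum>a\<in>A. P a) = 1" and w: "w = (\<Sum>a\<in>A. of_real (P a) * u a)"
  shows "(\<Sum>a\<in>A. P a * (norm (u a - w))\<^sup>2) = (\<Sum>a\<in>A. P a * (norm (u a))\<^sup>2) - (norm w)\<^sup>2"
proof -
  have sq: "(norm (u a - w))\<^sup>2 = (norm (u a))\<^sup>2 - 2 * (u a \<bullet> w) + (norm w)\<^sup>2" for a
    by (simp add: power2_norm_eq_inner inner_diff inner_commute)
  have "(\<Sum>a\<in>A. P a * (u a \<bullet> w)) = (\<Sum>a\<in>A. P a *\<^sub>R u a) \<bullet> w"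
    by (simp add: inner_sum_left)
  also have "(\<Sum>a\<in>A. P a *\<^sub>R u a) = w"
    by (simp add: w scaleR_conv_of_real)
  finally have "(\<Sum>a\<in>A. P a * (u a \<bullet> w)) = (norm w)\<^sup>2"
    by (simp add: power2_norm_eq_inner)
  moreover have "(\<Sum>a\<in>A. P a * (norm (u a - w))\<^sup>2) =
     (\<Sum>a\<in>A. P a * (norm (u a))\<^sup>2) - 2 * (\<Sum>a\<in>A. P a * (u a \<bullet> w)) + (\<Sum>a\<in>A. P a) * (norm w)\<^sup>2"
    unfolding sq sum_distrib_left sum_distrib_right sum_subtractf [symmetric] sum.distrib [symmetric]
    by (rule sum.cong) (simp_all add: algebra_simps)
  ultimately show ?thesis using assms(1) by simp
qed

text \<open>Bernoulli's inequality is the tangent bound \<open>x ^ s \<ge> 1 + s * (x - 1)\<close>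
  for \<open>x\<close> the squared norm of \<open>u a\<close>; averaging it against \<open>P\<close>
  compares the two moments.\<close>

lemma weighted_square_le_1:
  fixes P :: "'a \<Rightarrow> real" and u :: "'a \<Rightarrow> complex"
  assumes "\<And>a. a \<in> A \<Longrightarrow> P a \<ge> 0" "(\<Sum>a\<in>A. P a) = 1" "s > 0"
    and "(\<Sum>a\<in>A. P a * norm (u a) ^ (2 * s)) = 1"
  shows "(\<Sum>a\<in>A. P a * (norm (u a))\<^sup>2) \<le> 1"
proof -
  have "(\<Sum>a\<in>A. P a * (1 + real s * ((norm (u a))\<^sup>2 - 1))) \<le> (\<Sum>a\<in>A. P a * norm (u a) ^ (2 * s))"
  proof (intro sum_mono mult_left_mono assms)
    fix a
    have "1 + real s * ((norm (u a))\<^sup>2 - 1) \<le> (1 + ((norm (u a))\<^sup>2 - 1)) ^ s"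
      by (rule Bernoulli_inequality) simp
    then show "1 + real s * ((norm (u a))\<^sup>2 - 1) \<le> norm (u a) ^ (2 * s)"
      by (simp add: power_mult)
  qed
  also have "(\<Sum>a\<in>A. P a * (1 + real s * ((norm (u a))\<^sup>2 - 1)))
     = (\<Sum>a\<in>A. P a) * (1 - real s) + real s * (\<Sum>a\<in>A. P a * (norm (u a))\<^sup>2)"
    unfolding sum_distrib_left sum_distrib_right sum.distrib [symmetric]
    by (rule sum.cong) (simp_all add: algebra_simps)
  finally have "1 - real s + real s * (\<Sum>a\<in>A. P a * (norm (u a))\<^sup>2) \<le> 1"
    using assms by simp
  then have "real s * (\<Sum>a\<in>A. P a * (norm (u a))\<^sup>2) \<le> real s * 1" by simp
  then show ?thesis using \<open>s > 0\<close> by simp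
qed

text \<open>The frequencies whose character on \<open>\<int>/b\<close> is constant on
  \<open>K\<close>, that is, the annihilator of the subgroup generated by the differences of
  elements of \<open>K\<close>.\<close>

definition annihilator :: "nat \<Rightarrow> nat set \<Rightarrow> nat set" where
  "annihilator b K = {\<tau>. \<tau> < b \<and> (\<forall>a\<in>K. \<forall>a'\<in>K. int b dvd (int a - int a') * int \<tau>)}"

text \<open>Both sides are homogeneous of degree \<open>s\<close> in \<open>v\<close>, so division
  by the \<open>s\<close>-th root of \<open>E\<close> reduces to \<open>E = 1\<close>. If
  \<open>E = 0\<close>, every product \<open>P a * v a\<close> vanishes.\<close>

lemma normalise_power_mean:
  fixes v :: "nat \<Rightarrow> complex"
  assumes P: "\<And>a. a < b \<Longrightarrow> P a \<ge> 0" and s: "s > 0"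
    and E: "(\<Sum>a<b. P a * norm (v a) ^ s) = E" 
    and norm: "\<And>u :: nat \<Rightarrow> complex. (\<Sum>a<b. P a * norm (u a) ^ s) = 1 \<Longrightarrow>
      (\<Sum>t\<in>I. norm (\<Sum>a<b. of_real (P a) * u a * \<omega> t a) ^ s) \<le> C"
  shows "(\<Sum>t\<in>I. norm (\<Sum>a<b. of_real (P a) * v a * \<omega> t a) ^ s) \<le> C * E"
proof (cases "E = 0")
  case True
  have "P a * norm (v a) ^ s = 0" if "a < b" for a
    using E True that P sum_nonneg_eq_0_iff[of "{..<b}" "\<lambda>a. P a * norm (v a) ^ s"] by auto
  then have "P a = 0 \<or> v a = 0" if "a < b" for a
    using that s by fastforce
  then have "(\<Sum>a<b. of_real (P a) * v a * \<omega> t a) = 0" for t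
    by (intro sum.neutral) auto
  then show ?thesis using True s by (simp add: zero_power)
next
  case False
  have "E \<ge> 0" unfolding E [symmetric] by (intro sum_nonneg mult_nonneg_nonneg P) auto
  with False have "E > 0" by simp
  define R where "R = root s E"
  have R: "R > 0" "R ^ s = E" using \<open>E > 0\<close> s by (auto simp: R_def)
  have "(\<Sum>a<b. P a * norm (v a / of_real R) ^ s) = (\<Sum>a<b. P a * norm (v a) ^ s) / E"
    using R by (simp add: norm_divide power_divide sum_divide_distrib)
  also have "\<dots> = 1" using E \<open>E > 0\<close> by simp
  finally have le: "(\<Sum>t\<in>I. norm (\<Sum>a<b. of_real (P a) * (v a / of_real R) * \<omega> t a) ^ s) \<le> C"
    by (rule norm)
  have "norm (\<Sum>a<b. of_real (P a) * (v a / of_real R) * \<omega> t a) ^ s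
      = norm (\<Sum>a<b. of_real (P a) * v a * \<omega> t a) ^ s / E" for t
  proof -
    have "(\<Sum>a<b. of_real (P a) * (v a / of_real R) * \<omega> t a)
        = (\<Sum>a<b. of_real (P a) * v a * \<omega> t a) / of_real R"
      by (simp add: sum_divide_distrib)
    then show ?thesis using R by (simp add: norm_divide power_divide)
  qed
  with le have "(\<Sum>t\<in>I. norm (\<Sum>a<b. of_real (P a) * v a * \<omega> t a) ^ s) / E \<le> C"
    by (simp add: sum_divide_distrib)
  then show ?thesis using \<open>E > 0\<close> by (simp add: divide_le_eq)
qed

text \<open>A mean of modulus close to 1 leaves no room for variance around it; that the variance is
  nonnegative gives the second claim.\<close>

lemma weighted_norm_le_1:
  fixes u :: "nat \<Rightarrow> complex"
  assumes "\<And>a. a < b \<Longrightarrow> P a \<ge> 0" "(\<Sum>a<b. P a) = 1" "s > 0"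
    and "(\<Sum>a<b. P a * norm (u a) ^ (2 * s)) = 1" and \<omega>: "\<And>a. norm (\<omega> a) = 1"
  shows "(\<Sum>a<b. P a * (norm (u a * \<omega> a - (\<Sum>a<b. of_real (P a) * u a * \<omega> a)))\<^sup>2)
     \<le> 1 - (norm (\<Sum>a<b. of_real (P a) * u a * \<omega> a))\<^sup>2"
    and "norm (\<Sum>a<b. of_real (P a) * u a * \<omega> a) \<le> 1"
proof -
  let ?w = "\<Sum>a<b. of_real (P a) * u a * \<omega> a"
  have "(\<Sum>a<b. P a * (norm (u a * \<omega> a - ?w))\<^sup>2)
     = (\<Sum>a<b. P a * (norm (u a * \<omega> a))\<^sup>2) - (norm ?w)\<^sup>2"
    by (rule variance_identity) (use assms in \<open>simp_all add: mult.assoc\<close>)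
  also have "(\<Sum>a<b. P a * (norm (u a * \<omega> a))\<^sup>2) \<le> 1"
    using weighted_square_le_1[of "{..<b}" P s u] assms by (simp add: norm_mult)
  finally show 1: "(\<Sum>a<b. P a * (norm (u a * \<omega> a - ?w))\<^sup>2) \<le> 1 - (norm ?w)\<^sup>2" by simp
  have "0 \<le> (\<Sum>a<b. P a * (norm (u a * \<omega> a - ?w))\<^sup>2)"
    using assms by (intro sum_nonneg) auto
  with 1 have "(norm ?w)\<^sup>2 \<le> 1\<^sup>2" by simp
  then show "norm ?w \<le> 1" by (rule power2_le_imp_le) simp
qed

text \<open>The bound without any cancellation, for points of the exceptional set, where nothing is
  known about the weights.\<close>

lemma power_mean_trivial:
  fixes v :: "nat \<Rightarrow> complex"
  assumes "\<And>a. a < b \<Longrightarrow> P a \<ge> 0" "(\<Sum>a<b. P a) = 1" "s > 0" and \<omega>: "\<And>t a. norm (\<omega> t a) = 1"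
  shows "(\<Sum>t\<in>I. norm (\<Sum>a<b. of_real (P a) * v a * \<omega> t a) ^ (2 * s))
     \<le> real (card I) * (\<Sum>a<b. P a * norm (v a) ^ (2 * s))"
proof (rule normalise_power_mean)
  fix u :: "nat \<Rightarrow> complex"
  assume "(\<Sum>a<b. P a * norm (u a) ^ (2 * s)) = 1"
  then have "norm (\<Sum>a<b. of_real (P a) * u a * \<omega> t a) ^ (2 * s) \<le> 1" for t
    by (intro power_le_one weighted_norm_le_1(2)[where s = s] assms) auto
  then show "(\<Sum>t\<in>I. norm (\<Sum>a<b. of_real (P a) * u a * \<omega> t a) ^ (2 * s)) \<le> real (card I)"
    using sum_bounded_above[of I _ "1::real"] by simp
qed (use assms in auto)

text \<open>Near equality in the power mean inequality forces a small variance, so the twisted values at all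
  atoms of mass at least \<open>\<kappa>\<close> nearly agree. Comparing two such frequencies, their difference
  annihilates the differences of these atoms.\<close>

lemma card_nearly_extremal_le:
  fixes u :: "nat \<Rightarrow> complex"
  assumes P: "\<And>a. a < b \<Longrightarrow> P a \<ge> 0" "(\<Sum>a<b. P a) = 1" and s: "s > 0"
    and one: "(\<Sum>a<b. P a * norm (u a) ^ (2 * s)) = 1"
    and d: "\<And>c :: int. norm (cis (2 * pi * of_int c / of_nat b) - 1) < d \<Longrightarrow> int b dvd c"
    and \<kappa>: "\<kappa> > 0" and \<rho>: "\<rho> > 0" "8 * \<rho> < d"
    and \<eta>: "0 < \<eta>" "\<eta> \<le> 1 / 2" "2 * \<eta> \<le> \<kappa> * \<rho>\<^sup>2"
  shows "card {t. t < b \<and> norm (\<Sum>a<b. of_real (P a) * u a * cis (2 * pi * (real a * real t / real b))) > 1 - \<eta>}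
    \<le> card (annihilator b {a. a < b \<and> \<kappa> \<le> P a})" (is "card ?Al \<le> card (annihilator b ?K)")
proof (cases "?Al = {}")
  case False
  define \<omega> where "\<omega> t a = cis (2 * pi * (real a * real t / real b))" for t a
  define w where "w t = (\<Sum>a<b. of_real (P a) * u a * \<omega> t a)" for t
  have Al: "?Al = {t. t < b \<and> norm (w t) > 1 - \<eta>}" by (simp add: w_def \<omega>_def)
  have close: "norm (u a * \<omega> t a - w t) \<le> \<rho>" if "a \<in> ?K" "t \<in> ?Al" for a t
  proof -
    have wt: "norm (w t) > 1 - \<eta>" using that(2) unfolding Al by simp
    have "\<kappa> * (norm (u a * \<omega> t a - w t))\<^sup>2 \<le> P a * (norm (u a * \<omega> t a - w t))\<^sup>2"
      using that by (intro mult_right_mono) auto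
    also have "\<dots> \<le> (\<Sum>a<b. P a * (norm (u a * \<omega> t a - w t))\<^sup>2)"
      using that P by (intro member_le_sum[of a "{..<b}"]) auto
    also have "\<dots> \<le> 1 - (norm (w t))\<^sup>2"
      unfolding w_def by (rule weighted_norm_le_1) (use P s one in \<open>auto simp: \<omega>_def\<close>)
    also have "\<dots> \<le> 1 - (1 - \<eta>)\<^sup>2"
      using wt \<eta> by (simp add: power_mono)
    also have "\<dots> \<le> 2 * \<eta>" by (simp add: power2_eq_square algebra_simps)
    also have "\<dots> \<le> \<kappa> * \<rho>\<^sup>2" by (rule \<eta>)
    finally have "(norm (u a * \<omega> t a - w t))\<^sup>2 \<le> \<rho>\<^sup>2" using \<kappa> by simp
    then show ?thesis by (rule power2_le_imp_le) (use \<rho> in simp)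
  qed
  from False obtain t0 where t0: "t0 \<in> ?Al" by blast
  then have "t0 < b" by auto
  \<comment> \<open>The difference \<open>t - t0\<close> modulo \<open>b\<close>, shifted by
    \<open>b\<close> because \<open>t < t0\<close> is possible.\<close>
  define \<tau> where "\<tau> t = (t + (b - t0)) mod b" for t
  \<comment> \<open>On the heavy atoms the twisted values for \<open>t\<close> and for
    \<open>t0\<close> are both nearly constant, hence so is their quotient \<open>z a\<close>. The
    ratio \<open>z a / z a'\<close> is a root of unity closer to 1 than the separation
    \<open>d\<close>, so it equals 1.\<close>
  have key: "int b dvd (int a - int a') * (int t - int t0)" if a: "a \<in> ?K" "a' \<in> ?K" and t: "t \<in> ?Al" for a a' t
  proof (rule d)
    define z where "z a = cis (2 * pi * (real a * (real t - real t0) / real b))" for a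
    have z: "\<omega> t a = \<omega> t0 a * z a" for a
    proof -
      have "2 * pi * (real a * real t / real b)
          = 2 * pi * (real a * real t0 / real b) + 2 * pi * (real a * (real t - real t0) / real b)"
        by (simp add: field_split_simps)
      then show ?thesis by (simp add: \<omega>_def z_def cis_mult)
    qed
    have c: "norm (w t0 * z a - w t) \<le> 2 * \<rho>" if "a \<in> ?K" for a
    proof -
      have "w t0 * z a - w t = (u a * \<omega> t a - w t) - (u a * \<omega> t0 a - w t0) * z a"
        by (simp add: z algebra_simps)
      also have "norm \<dots> \<le> norm (u a * \<omega> t a - w t) + norm ((u a * \<omega> t0 a - w t0) * z a)"
        by (rule norm_triangle_ineq4)
      also have "\<dots> \<le> \<rho> + \<rho>"
        using close[OF that t] close[OF that t0] by (intro add_mono) (auto simp: norm_mult z_def)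
      finally show ?thesis by simp
    qed
    have "t0 \<in> {t. t < b \<and> norm (w t) > 1 - \<eta>}" using t0 unfolding Al .
    then have "norm (w t0) > 1 / 2" using \<eta> by auto
    then have "1 / 2 * norm (z a - z a') \<le> norm (w t0) * norm (z a - z a')"
      by (intro mult_right_mono) auto
    also have "\<dots> = norm ((w t0 * z a - w t) - (w t0 * z a' - w t))"
      by (simp add: norm_mult [symmetric] algebra_simps)
    also have "\<dots> \<le> 2 * \<rho> + 2 * \<rho>"
      using norm_triangle_ineq4 c[OF a(1)] c[OF a(2)] by (meson add_mono order_trans)
    finally have "norm (z a - z a') \<le> 8 * \<rho>" by simp
    moreover have "norm (z a - z a') = norm (z a / z a' - 1)"
    proof -
      have "z a - z a' = z a' * (z a / z a' - 1)" by (simp add: z_def field_simps)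
      then show ?thesis by (simp add: norm_mult z_def)
    qed
    moreover have "z a / z a' = cis (2 * pi * of_int ((int a - int a') * (int t - int t0)) / of_nat b)"
    proof -
      have "2 * pi * (real a * (real t - real t0) / real b) - 2 * pi * (real a' * (real t - real t0) / real b)
          = 2 * pi * of_int ((int a - int a') * (int t - int t0)) / of_nat b"
        by (simp only: right_diff_distrib [symmetric] diff_divide_distrib [symmetric] left_diff_distrib [symmetric]
          of_int_mult of_int_diff of_int_of_nat_eq times_divide_eq_right mult.assoc)
      then show ?thesis by (simp add: z_def cis_divide)
    qed
    ultimately show "norm (cis (2 * pi * of_int ((int a - int a') * (int t - int t0)) / of_nat b) - 1) < d"
      using \<rho> by simp
  qed
  have "inj_on \<tau> ?Al"
  proof
    fix t t' assume "t \<in> ?Al" "t' \<in> ?Al" and eq: "\<tau> t = \<tau> t'"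
    then have "t < b" "t' < b" by auto
    have "[t + (b - t0) = t' + (b - t0)] (mod b)" using eq by (simp add: \<tau>_def cong_def)
    then have "[t = t'] (mod b)" by (simp add: cong_add_rcancel_nat)
    then show "t = t'" using \<open>t < b\<close> \<open>t' < b\<close> by (simp add: cong_def)
  qed
  moreover have "\<tau> ` ?Al \<subseteq> annihilator b ?K"
  proof clarify
    fix t assume t: "t < b" "norm (\<Sum>a<b. of_real (P a) * u a * cis (2 * pi * (real a * real t / real b))) > 1 - \<eta>"
    show "\<tau> t \<in> annihilator b ?K"
      unfolding annihilator_def
    proof (intro CollectI conjI ballI)
      show "\<tau> t < b" using \<open>t0 < b\<close> by (simp add: \<tau>_def)
      fix a a' assume a: "a \<in> ?K" "a' \<in> ?K"
      have "[int (\<tau> t) = int t - int t0] (mod int b)"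
      proof -
        have "int (\<tau> t) = (int t + (int b - int t0)) mod int b"
          using \<open>t0 < b\<close> by (simp add: \<tau>_def zmod_int of_nat_diff add_diff_eq)
        also have "\<dots> = ((int t - int t0) + int b) mod int b" by (simp add: algebra_simps)
        also have "\<dots> = (int t - int t0) mod int b" by (rule mod_add_self2)
        finally show ?thesis by (simp add: cong_def)
      qed
      then have "[(int a - int a') * int (\<tau> t) = (int a - int a') * (int t - int t0)] (mod int b)"
        by (rule cong_scalar_left)
      then show "int b dvd (int a - int a') * int (\<tau> t)"
        using key[OF a, of t] t by (simp add: cong_dvd_iff)
    qed
  qed
  moreover have "finite (annihilator b ?K)"
    by (rule finite_subset[of _ "{..<b}"]) (auto simp: annihilator_def)
  ultimately show ?thesis by (rule card_inj_on_le)
qed (metis card.empty le0)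

lemma zero_in_annihilator: "b > 0 \<Longrightarrow> card (annihilator b K) \<ge> 1"
proof -
  assume "b > 0"
  then have "0 \<in> annihilator b K" by (auto simp: annihilator_def)
  moreover have "finite (annihilator b K)"
    by (rule finite_subset[of _ "{..<b}"]) (auto simp: annihilator_def)
  ultimately show ?thesis by (metis One_nat_def Suc_leI card_gt_0_iff empty_iff)
qed

definition flattens :: "nat \<Rightarrow> nat \<Rightarrow> real \<Rightarrow> (nat \<Rightarrow> real) \<Rightarrow> bool" where
  "flattens b s L P \<longleftrightarrow> (\<forall>v :: nat \<Rightarrow> complex.
    (\<Sum>t<b. norm (\<Sum>a<b. of_real (P a) * v a * cis (2 * pi * (real a * real t / real b))) ^ (2 * s))
      \<le> L * (\<Sum>a<b. P a * norm (v a) ^ (2 * s)))"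

lemma flattens_mono:
  assumes flat: "flattens b s L P" and L: "L \<le> L'" and P: "\<And>a. P a \<ge> 0"
  shows "flattens b s L' P"
proof -
  have "L * (\<Sum>a<b. P a * norm (v a) ^ (2 * s)) \<le> L' * (\<Sum>a<b. P a * norm (v a) ^ (2 * s))" for v :: "nat \<Rightarrow> complex"
    using P by (intro mult_right_mono L sum_nonneg mult_nonneg_nonneg) auto
  then show ?thesis using flat unfolding flattens_def by (meson order_trans)
qed

text \<open>Frequencies with mean of modulus at most \<open>1 - \<eta>\<close> contribute together
  at most \<open>b * (1 - \<eta>) ^ (2 * s) \<le> 1\<close> for large \<open>s\<close>; the
  annihilator bounds the number of the others. The exponent depends on \<open>b\<close> and
  \<open>\<kappa>\<close> but not on \<open>P\<close>, so one \<open>s\<close> serves all base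
  points.\<close>

lemma flattening:
  fixes b :: nat and \<kappa> :: real
  assumes b: "b > 0" and \<kappa>: "\<kappa> > 0"
  obtains s :: nat where "s > 0"
    "\<And>P. (\<And>a. a < b \<Longrightarrow> P a \<ge> 0) \<Longrightarrow> (\<Sum>a<b. P a) = 1 \<Longrightarrow>
      flattens b s (2 * real (card (annihilator b {a. a < b \<and> \<kappa> \<le> P a}))) P"
proof -
  obtain d where d: "d > 0" "\<And>c :: int. norm (cis (2 * pi * of_int c / of_nat b) - 1) < d \<Longrightarrow> int b dvd c"
    using cis_int_div_separated[OF b] by metis
  \<comment> \<open>The factor 8 in \<open>8 * \<rho> < d\<close>: an error
    \<open>2 * \<rho>\<close> for each of two atoms, doubled on division by a modulus above
    1/2.\<close>
  define \<rho> where "\<rho> = d / 16"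
  have \<rho>: "\<rho> > 0" "8 * \<rho> < d" using d(1) by (auto simp: \<rho>_def)
  \<comment> \<open>The variance is at most \<open>1 - (1 - \<eta>)^2 \<le> 2 * \<eta> \<le>
    \<kappa> * \<rho>^2\<close>, which gives closeness \<open>\<rho>\<close> at every atom of mass
    at least \<open>\<kappa>\<close>.\<close>
  define \<eta> where "\<eta> = min (1 / 2) (\<kappa> * \<rho>\<^sup>2 / 2)"
  have \<eta>: "0 < \<eta>" "\<eta> \<le> 1 / 2" "2 * \<eta> \<le> \<kappa> * \<rho>\<^sup>2"
    using \<kappa> \<rho> by (auto simp: \<eta>_def min_def)
  have "(\<lambda>n. (1 - \<eta>) ^ n) \<longlonglongrightarrow> 0" using \<eta> by (intro LIMSEQ_realpow_zero) auto
  then have "\<forall>\<^sub>F n in sequentially. (1 - \<eta>) ^ n < 1 / real b"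
    using b by (intro order_tendstoD(2)) auto
  then obtain s0 where s0: "\<And>n. n \<ge> s0 \<Longrightarrow> (1 - \<eta>) ^ n < 1 / real b"
    by (auto simp: eventually_sequentially)
  define s where "s = Suc s0"
  have s: "s > 0" "real b * (1 - \<eta>) ^ (2 * s) \<le> 1"
    using s0[of "2 * s"] b by (auto simp: s_def field_simps)
  show ?thesis
  proof (rule that[OF s(1)])
    fix P :: "nat \<Rightarrow> real"
    assume P: "\<And>a. a < b \<Longrightarrow> P a \<ge> 0" "(\<Sum>a<b. P a) = 1"
    let ?A = "card (annihilator b {a. a < b \<and> \<kappa> \<le> P a})"
    show "flattens b s (2 * real ?A) P"
      unfolding flattens_def
    proof (intro allI, rule normalise_power_mean[where \<omega> = "\<lambda>t a. cis (2 * pi * (real a * real t / real b))"])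
      fix u :: "nat \<Rightarrow> complex"
      assume one: "(\<Sum>a<b. P a * norm (u a) ^ (2 * s)) = 1"
      define w where "w t = (\<Sum>a<b. of_real (P a) * u a * cis (2 * pi * (real a * real t / real b)))" for t
      have w1: "norm (w t) \<le> 1" for t
        unfolding w_def by (rule weighted_norm_le_1(2)[OF P s(1) one]) auto
      define Al where "Al = {t. t < b \<and> norm (w t) > 1 - \<eta>}"
      have "norm (w t) ^ (2 * s) \<le> of_bool (t \<in> Al) + (1 - \<eta>) ^ (2 * s)" if "t < b" for t
      proof (cases "t \<in> Al")
        case True
        then show ?thesis using power_le_one[OF norm_ge_zero w1, of t "2 * s"] \<eta>
          by (simp add: add_increasing2)
      next
        case False
        then have "norm (w t) \<le> 1 - \<eta>" using that by (auto simp: Al_def)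
        then show ?thesis using False by (simp add: power_mono)
      qed
      then have "(\<Sum>t<b. norm (w t) ^ (2 * s)) \<le> (\<Sum>t<b. of_bool (t \<in> Al) + (1 - \<eta>) ^ (2 * s))"
        by (intro sum_mono) auto
      also have "\<dots> = real (card Al) + real b * (1 - \<eta>) ^ (2 * s)"
      proof -
        have "{..<b} \<inter> Al = Al" by (auto simp: Al_def)
        then show ?thesis by (simp add: sum.distrib of_bool_def sum.If_cases)
      qed
      also have "\<dots> \<le> real ?A + 1"
        using card_nearly_extremal_le[OF P s(1) one d(2) \<kappa> \<rho> \<eta>] s(2)
        by (intro add_mono) (auto simp: Al_def w_def)
      \<comment> \<open>The frequency 0 always annihilates, so the extra 1 is absorbed.\<close>
      also have "\<dots> \<le> 2 * real ?A"
        using zero_in_annihilator[OF b, of "{a. a < b \<and> \<kappa> \<le> P a}"] by simp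
      finally show "(\<Sum>t<b. norm (\<Sum>a<b. of_real (P a) * u a * cis (2 * pi * (real a * real t / real b))) ^ (2 * s))
          \<le> 2 * real ?A"
        by (simp add: w_def)
    qed (use P s in auto)
  qed
qed

subsection \<open>The large spectrum of a measure with weighted inverse branches\<close>

text \<open>With \<open>B = b ^ n\<close>, a frequency below \<open>b ^ Suc n\<close> is split into
  its lower part \<open>m\<close> and its leading digit \<open>t\<close>.\<close>

lemma sum_lessThan_mult:
  fixes f :: "nat \<Rightarrow> 'a::comm_monoid_add"
  shows "(\<Sum>r<B * b. f r) = (\<Sum>m<B. \<Sum>t<b. f (m + B * t))"
proof -
  have "(\<Sum>r<B * b. f r) = (\<Sum>t<b. sum f {t * B..<t * B + B})"
    by (simp add: sum.nat_group mult.commute)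
  also have "\<dots> = (\<Sum>t<b. \<Sum>m<B. f (m + B * t))"
  proof (rule sum.cong)
    fix t
    have "sum f {t * B..<t * B + B} = sum f {0 + t * B..<B + t * B}" by (simp add: add.commute)
    also have "\<dots> = (\<Sum>m\<in>{0..<B}. f (m + t * B))" by (rule sum.shift_bounds_nat_ivl)
    finally show "sum f {t * B..<t * B + B} = (\<Sum>m<B. f (m + B * t))"
      by (simp add: atLeast0LessThan mult.commute)
  qed simp
  also have "\<dots> = (\<Sum>m<B. \<Sum>t<b. f (m + B * t))" by (rule sum.swap)
  finally show ?thesis .
qed

text \<open>\<open>P a z\<close> plays the role of the conditional probability of the inverse branch
  \<open>(a + z) / b\<close> at \<open>z\<close>. The weights sum to 1 at every point, not just
  almost everywhere, because the iterates below evaluate them pointwise.\<close>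

locale branch_kernel = prob_space M for M :: "real measure" +
  fixes b :: nat and P :: "nat \<Rightarrow> real \<Rightarrow> real"
  assumes b_pos: "b > 0"
    and sets_M [measurable_cong]: "sets M = sets borel"
    and P_measurable [measurable]: "\<And>a. P a \<in> borel_measurable borel"
    and P_nonneg: "\<And>a z. P a z \<ge> 0"
    and P_sum: "\<And>z. (\<Sum>a<b. P a z) = 1"
    and transfer: "\<And>f :: real \<Rightarrow> complex. f \<in> borel_measurable borel \<Longrightarrow> (\<And>x. norm (f x) \<le> 1) \<Longrightarrow>
      (\<integral>x. f x \<partial>M) = (\<integral>z. (\<Sum>a<b. of_real (P a z) * f ((real a + z) / real b)) \<partial>M)"
begin

lemma space_M [simp]: "space M = UNIV"
  using sets_eq_imp_space_eq[OF sets_M] by simp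

lemma integrable_bounded:
  fixes f :: "real \<Rightarrow> 'b::{banach,second_countable_topology}"
  assumes "f \<in> borel_measurable borel" "\<And>x. norm (f x) \<le> C"
  shows "integrable M f"
  by (rule integrable_const_bound[where B = C]) (use assms in \<open>auto simp: measurable_cong_sets[OF sets_M refl]\<close>)

text \<open>The iterated transfer operator applied to the character of frequency \<open>m\<close>, where branches that
  visit \<open>N\<close> more than \<open>k\<close> times are discarded.\<close>

primrec twisted :: "real set \<Rightarrow> int \<Rightarrow> nat \<Rightarrow> nat \<Rightarrow> real \<Rightarrow> complex" where
  "twisted N m 0 k z = cis (2 * pi * (of_int m * z))"
| "twisted N m (Suc n) k z =
    (if z \<notin> N then \<Sum>a<b. of_real (P a z) * twisted N m n k ((real a + z) / real b)
     else if k = 0 then 0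
     else \<Sum>a<b. of_real (P a z) * twisted N m n (k - 1) ((real a + z) / real b))"

text \<open>Counts the visits of the random backward orbit at its first \<open>n\<close> points,
  including \<open>z\<close> and excluding the endpoint; these are exactly the points at which
  \<open>twisted\<close> tests membership in \<open>N\<close>.\<close>

primrec expected_visits :: "real set \<Rightarrow> nat \<Rightarrow> real \<Rightarrow> real" where
  "expected_visits N 0 z = 0"
| "expected_visits N (Suc n) z =
    indicator N z + (\<Sum>a<b. P a z * expected_visits N n ((real a + z) / real b))"

lemma average_norm_le:
  assumes "\<And>a. norm (f a :: complex) \<le> C"
  shows "norm (\<Sum>a<b. of_real (P a z) * f a) \<le> C"
proof -
  have "norm (\<Sum>a<b. of_real (P a z) * f a) \<le> (\<Sum>a<b. P a z * C)"
    by (rule sum_norm_le) (use assms in \<open>auto simp: norm_mult P_nonneg intro!: mult_left_mono\<close>)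
  then show ?thesis by (simp add: sum_distrib_right [symmetric] P_sum)
qed

lemma norm_twisted_le: "norm (twisted N m n k z) \<le> 1"
  by (induction n arbitrary: k z) (auto simp: average_norm_le)

lemma twisted_measurable [measurable]:
  assumes [measurable]: "N \<in> sets borel"
  shows "twisted N m n k \<in> borel_measurable borel"
proof (induction n arbitrary: k)
  case 0
  have "continuous_on UNIV (\<lambda>z. cis (2 * pi * (of_int m * z)))"
    by (intro continuous_intros)
  then show ?case
    by (auto intro: borel_measurable_continuous_onI)
next
  case (Suc n)
  note Suc [measurable]
  show ?case unfolding twisted.simps by measurable
qed

lemma expected_visits_bounds: "0 \<le> expected_visits N n z \<and> expected_visits N n z \<le> real n"
proof (induction n arbitrary: z)
  case (Suc n)
  have "(\<Sum>a<b. P a z * expected_visits N n ((real a + z) / real b)) \<le> (\<Sum>a<b. P a z * real n)"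
    by (intro sum_mono mult_left_mono) (use Suc P_nonneg in auto)
  then have "(\<Sum>a<b. P a z * expected_visits N n ((real a + z) / real b)) \<le> real n"
    by (simp add: sum_distrib_right [symmetric] P_sum)
  moreover have "0 \<le> (\<Sum>a<b. P a z * expected_visits N n ((real a + z) / real b))"
    using Suc by (intro sum_nonneg mult_nonneg_nonneg P_nonneg) auto
  ultimately show ?case by (auto simp: indicator_def)
qed simp

lemma expected_visits_measurable [measurable]:
  assumes [measurable]: "N \<in> sets borel"
  shows "expected_visits N n \<in> borel_measurable borel"
proof (induction n)
  case (Suc n)
  note Suc [measurable]
  show ?case unfolding expected_visits.simps by measurable
qed simp

lemma transfer_real:
  fixes f :: "real \<Rightarrow> real"
  assumes f [measurable]: "f \<in> borel_measurable borel" and C: "\<And>x. \<bar>f x\<bar> \<le> C"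
  shows "(\<integral>x. f x \<partial>M) = (\<integral>z. (\<Sum>a<b. P a z * f ((real a + z) / real b)) \<partial>M)"
proof -
  \<comment> \<open>The transfer law is stated for functions bounded by 1; the added 1 makes the
    divisor positive.\<close>
  define K where "K = C + 1"
  have K: "K > 0" "\<And>x. \<bar>f x\<bar> \<le> K" using C order_trans[OF abs_ge_zero[of "f 0"] C[of 0]] by (auto simp: K_def add_increasing2 add_nonneg_pos)
  have "(\<integral>x. complex_of_real (f x / K) \<partial>M)
     = (\<integral>z. (\<Sum>a<b. complex_of_real (P a z) * complex_of_real (f ((real a + z) / real b) / K)) \<partial>M)"
    by (rule transfer) (use K in \<open>auto simp: norm_divide\<close>)
  also have "\<dots> = (\<integral>z. complex_of_real ((\<Sum>a<b. P a z * f ((real a + z) / real b)) / K) \<partial>M)"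
    by (simp add: sum_divide_distrib)
  finally have "(\<integral>x. f x / K \<partial>M) = (\<integral>z. (\<Sum>a<b. P a z * f ((real a + z) / real b)) / K \<partial>M)"
    by (simp only: integral_complex_of_real of_real_eq_iff)
  then show ?thesis using K by simp
qed

text \<open>The transfer law says that a random backward step preserves \<open>M\<close>, so each of
  the \<open>n\<close> points lies in \<open>N\<close> with probability
  \<open>measure M N\<close>.\<close>

lemma integral_expected_visits:
  assumes N [measurable]: "N \<in> sets borel"
  shows "(\<integral>z. expected_visits N n z \<partial>M) = real n * measure M N"
proof (induction n)
  case (Suc n)
  let ?S = "\<lambda>z. \<Sum>a<b. P a z * expected_visits N n ((real a + z) / real b)"
  have "integrable M ?S"
  proof (rule integrable_bounded)
    fix z
    have "expected_visits N (Suc n) z \<le> real (Suc n)" using expected_visits_bounds by blast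
    moreover have "0 \<le> ?S z"
      using expected_visits_bounds by (intro sum_nonneg mult_nonneg_nonneg P_nonneg) auto
    ultimately show "norm (?S z) \<le> real (Suc n)" by (cases "z \<in> N") auto
  qed measurable
  moreover have "integrable M (indicator N :: real \<Rightarrow> real)"
    by (rule integrable_bounded[where C = 1]) (auto simp: indicator_def)
  ultimately have "(\<integral>z. expected_visits N (Suc n) z \<partial>M) = measure M N + (\<integral>z. ?S z \<partial>M)"
    using N by (simp add: sets_M)
  also have "(\<integral>z. ?S z \<partial>M) = (\<integral>z. expected_visits N n z \<partial>M)"
    using expected_visits_bounds[of N n] by (intro transfer_real[symmetric, where C = "real n"]) auto
  finally show ?case using Suc by (simp add: algebra_simps)
qed simp

text \<open>When nothing is discarded, iterating the transfer law leaves the Fourier coefficient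
  unchanged.\<close>

lemma integral_twisted_empty:
  "(\<integral>z. twisted {} m n k z \<partial>M) = (\<integral>x. cis (2 * pi * (of_int m * x)) \<partial>M)"
proof (induction n)
  case (Suc n)
  have "(\<integral>z. twisted {} m (Suc n) k z \<partial>M) = (\<integral>z. twisted {} m n k z \<partial>M)"
    unfolding twisted.simps using norm_twisted_le
    by (subst transfer[of "twisted {} m n k"]) auto
  then show ?case using Suc by simp
qed simp

lemma twisted_empty_budget: "twisted {} m n k z = twisted {} m n k' z"
  by (induction n arbitrary: z) auto

text \<open>Markov's inequality: the discarded branches make at least \<open>k + 1\<close> visits,
  so their weight is at most the expected number of visits divided by \<open>k + 1\<close>. The
  induction needs both bounds together.\<close>

lemma twisted_diff_le:
  "norm (twisted {} m n k z - twisted N m n k z) \<le> 1"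
  "(real k + 1) * norm (twisted {} m n k z - twisted N m n k z) \<le> expected_visits N n z"
proof -
  have "norm (twisted {} m n k z - twisted N m n k z) \<le> 1 \<and>
     (real k + 1) * norm (twisted {} m n k z - twisted N m n k z) \<le> expected_visits N n z"
  proof (induction n arbitrary: k z)
    case (Suc n)
    define y where "y a = (real a + z) / real b" for a
    let ?d = "\<lambda>k a. twisted {} m n k (y a) - twisted N m n k (y a)"
    have avg: "(\<Sum>a<b. of_real (P a z) * twisted {} m n k (y a)) - (\<Sum>a<b. of_real (P a z) * twisted N m n k (y a))
        = (\<Sum>a<b. of_real (P a z) * ?d k a)" for k
      by (simp add: sum_subtractf right_diff_distrib)
    have le1: "norm (\<Sum>a<b. of_real (P a z) * ?d k a) \<le> 1" for k
      using Suc by (intro average_norm_le) auto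
    have lev: "(real k + 1) * norm (\<Sum>a<b. of_real (P a z) * ?d k a)
        \<le> (\<Sum>a<b. P a z * expected_visits N n (y a))" for k
    proof -
      have "(real k + 1) * norm (\<Sum>a<b. of_real (P a z) * ?d k a)
          \<le> (real k + 1) * (\<Sum>a<b. P a z * norm (?d k a))"
        by (intro mult_left_mono sum_norm_le) (auto simp: norm_mult P_nonneg)
      also have "\<dots> = (\<Sum>a<b. P a z * ((real k + 1) * norm (?d k a)))"
        by (simp add: sum_distrib_left mult.left_commute)
      also have "\<dots> \<le> (\<Sum>a<b. P a z * expected_visits N n (y a))"
        using Suc by (intro sum_mono mult_left_mono P_nonneg) auto
      finally show ?thesis .
    qed
    have empty: "twisted {} m (Suc n) k z = (\<Sum>a<b. of_real (P a z) * twisted {} m n k' (y a))" for k k'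
      using twisted_empty_budget[of m n k _ k'] by (simp add: y_def)
    have vis: "expected_visits N (Suc n) z = indicator N z + (\<Sum>a<b. P a z * expected_visits N n (y a))"
      by (simp add: y_def)
    have visn: "0 \<le> (\<Sum>a<b. P a z * expected_visits N n (y a))"
      using expected_visits_bounds by (intro sum_nonneg mult_nonneg_nonneg P_nonneg) auto
    consider "z \<notin> N" | "z \<in> N" "k = 0" | k' where "z \<in> N" "k = Suc k'"
      by (cases k) auto
    then show ?case
    proof cases
      case 1
      then have "twisted {} m (Suc n) k z - twisted N m (Suc n) k z = (\<Sum>a<b. of_real (P a z) * ?d k a)"
        unfolding empty[of k k] avg [symmetric] by (simp add: y_def)
      then show ?thesis using 1 le1[of k] lev[of k] by (simp only: vis) simp
    next
      case 2
      then have "twisted N m (Suc n) k z = 0" by simp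
      then show ?thesis using 2 visn norm_twisted_le[of "{}" m "Suc n" k z]
        by (simp only: vis) simp
    next
      \<comment> \<open>A visit uses one unit of the budget:
        \<open>(k' + 2) * x = (k' + 1) * x + x\<close>, and the last term \<open>x \<le> 1\<close>
        is paid for by the visit itself.\<close>
      case 3
      then have "twisted {} m (Suc n) k z - twisted N m (Suc n) k z = (\<Sum>a<b. of_real (P a z) * ?d k' a)"
        unfolding empty[of k k'] avg [symmetric] by (simp add: y_def)
      then show ?thesis using 3 le1[of k'] lev[of k']
        by (simp only: vis) (simp add: algebra_simps)
    qed
  qed simp
  then show "norm (twisted {} m n k z - twisted N m n k z) \<le> 1"
    "(real k + 1) * norm (twisted {} m n k z - twisted N m n k z) \<le> expected_visits N n z"
    by auto
qed

text \<open>At each backward step one factor \<open>b\<close> of the extra frequency cancels and the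
  branch digit contributes an integer, so after \<open>n\<close> steps only a phase at
  \<open>z\<close> remains, the same for all branches.\<close>

lemma twisted_shift:
  "twisted N (m + int (b ^ n) * t) n k z = cis (2 * pi * (of_int t * z)) * twisted N m n k z"
proof (induction n arbitrary: t k z)
  case 0
  show ?case by (simp add: cis_mult) (simp add: algebra_simps)
next
  case (Suc n)
  have "twisted N (m + int (b ^ Suc n) * t) n k ((real a + z) / real b)
      = cis (2 * pi * (of_int t * z)) * twisted N m n k ((real a + z) / real b)" for a k
  proof -
    have "int (b ^ Suc n) * t = int (b ^ n) * (int b * t)" by simp
    then have "twisted N (m + int (b ^ Suc n) * t) n k ((real a + z) / real b)
       = cis (2 * pi * (of_int (int b * t) * ((real a + z) / real b))) * twisted N m n k ((real a + z) / real b)"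
      using Suc by metis
    also have "2 * pi * (of_int (int b * t) * ((real a + z) / real b))
        = 2 * pi * of_int (t * int a) + 2 * pi * (of_int t * z)"
      using b_pos by (simp add: field_simps)
    also have "cis \<dots> = cis (2 * pi * (of_int t * z))"
      by (simp only: cis_mult [symmetric] cis_multiple_2pi Ints_of_int mult_1_left)
    finally show ?thesis .
  qed
  then show ?case by (simp add: sum_distrib_left mult.left_commute del: power_Suc)
qed

lemma norm_twisted_cong:
  assumes "[m = m'] (mod int (b ^ n))"
  shows "norm (twisted N m n k z) = norm (twisted N m' n k z)"
proof -
  obtain t where "m = m' + int (b ^ n) * t"
    using assms by (metis cong_iff_lin cong_sym)
  then show ?thesis by (simp only: twisted_shift norm_mult norm_cis)
qed

text \<open>Summing over the leading digit of \<open>r\<close> loses \<open>L\<close> outside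
  \<open>N\<close>, by flattening, and the trivial factor \<open>b\<close> inside \<open>N\<close>;
  the latter happens at most \<open>k\<close> times along a branch that is kept.\<close>

lemma power_sum_twisted_le:
  assumes flat: "\<And>z. z \<notin> N \<Longrightarrow> flattens b s L (\<lambda>a. P a z)"
    and s: "s > 0" and L: "L \<ge> 1"
  shows "(\<Sum>r<b ^ n. norm (twisted N (int r) n k z) ^ (2 * s)) \<le> L ^ n * real b ^ k"
proof (induction n arbitrary: k z)
  case 0
  then show ?case using b_pos by (simp add: one_le_power)
next
  case (Suc n)
  define y where "y a = (real a + z) / real b" for a
  define v where "v r k a = twisted N (int r) n k (y a)" for r k a
  let ?W = "\<lambda>r k t. \<Sum>a<b. of_real (P a z) * v r k a * cis (2 * pi * (real a * real t / real b))"
  \<comment> \<open>The phase of the new digit splits into a part independent of \<open>a\<close>,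
    invisible to the norm, and the character \<open>a * t / b\<close> that flattening
    treats.\<close>
  have W: "norm (\<Sum>a<b. of_real (P a z) * twisted N (int (r + b ^ n * t)) n j (y a)) = norm (?W r j t)" for r j t
  proof -
    have "twisted N (int (r + b ^ n * t)) n j (y a) = cis (2 * pi * (real t * y a)) * v r j a" for a
      using twisted_shift[of N "int r" n "int t" j "y a"] by (simp add: v_def)
    moreover have "cis (2 * pi * (real t * y a)) = cis (2 * pi * (real t * z / real b)) * cis (2 * pi * (real a * real t / real b))" for a
      unfolding cis_mult by (simp add: y_def add_divide_distrib algebra_simps)
    ultimately have "(\<Sum>a<b. of_real (P a z) * twisted N (int (r + b ^ n * t)) n j (y a))
        = cis (2 * pi * (real t * z / real b)) * ?W r j t"
      by (simp add: sum_distrib_left mult_ac)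
    then show ?thesis by (simp add: norm_mult)
  qed
  have IH: "(\<Sum>r<b ^ n. \<Sum>a<b. P a z * norm (v r k a) ^ (2 * s)) \<le> L ^ n * real b ^ k" for k
  proof -
    have "(\<Sum>r<b ^ n. \<Sum>a<b. P a z * norm (v r k a) ^ (2 * s))
       = (\<Sum>a<b. P a z * (\<Sum>r<b ^ n. norm (v r k a) ^ (2 * s)))"
      by (subst sum.swap) (simp add: sum_distrib_left)
    also have "\<dots> \<le> (\<Sum>a<b. P a z * (L ^ n * real b ^ k))"
      unfolding v_def by (intro sum_mono mult_left_mono Suc P_nonneg)
    finally show ?thesis by (simp add: sum_distrib_right [symmetric] P_sum)
  qed
  have split: "(\<Sum>r<b ^ Suc n. norm (twisted N (int r) (Suc n) k z) ^ (2 * s))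
     = (\<Sum>r<b ^ n. \<Sum>t<b. norm (twisted N (int (r + b ^ n * t)) (Suc n) k z) ^ (2 * s))"
    using sum_lessThan_mult[of "\<lambda>r. norm (twisted N (int r) (Suc n) k z) ^ (2 * s)" "b ^ n" b]
    by (simp only: power_Suc2)
  consider "z \<notin> N" | "z \<in> N" "k = 0" | k' where "z \<in> N" "k = Suc k'"
    by (cases k) auto
  then show ?case
  proof cases
    case 1
    have "(\<Sum>r<b ^ Suc n. norm (twisted N (int r) (Suc n) k z) ^ (2 * s))
       = (\<Sum>r<b ^ n. \<Sum>t<b. norm (?W r k t) ^ (2 * s))"
      unfolding split using 1 W[of _ _ k] by (simp add: y_def del: of_nat_add of_nat_mult of_nat_power)
    also have "\<dots> \<le> (\<Sum>r<b ^ n. L * (\<Sum>a<b. P a z * norm (v r k a) ^ (2 * s)))"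
      using flat[OF 1] unfolding flattens_def by (intro sum_mono) blast
    also have "\<dots> = L * (\<Sum>r<b ^ n. \<Sum>a<b. P a z * norm (v r k a) ^ (2 * s))"
      by (simp add: sum_distrib_left)
    also have "\<dots> \<le> L * (L ^ n * real b ^ k)"
      using L by (intro mult_left_mono IH) auto
    finally show ?thesis by simp
  next
    case 2
    then show ?thesis unfolding split using L s by (simp add: power_0_left)
  next
    case 3
    have "(\<Sum>r<b ^ Suc n. norm (twisted N (int r) (Suc n) k z) ^ (2 * s))
       = (\<Sum>r<b ^ n. \<Sum>t<b. norm (?W r k' t) ^ (2 * s))"
      unfolding split using 3 W[of _ _ k'] by (simp add: y_def del: of_nat_add of_nat_mult of_nat_power)
    also have "\<dots> \<le> (\<Sum>r<b ^ n. real (card {..<b}) * (\<Sum>a<b. P a z * norm (v r k' a) ^ (2 * s)))"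
      by (intro sum_mono power_mean_trivial) (use P_nonneg P_sum s in auto)
    also have "\<dots> = real b * (\<Sum>r<b ^ n. \<Sum>a<b. P a z * norm (v r k' a) ^ (2 * s))"
      by (simp add: sum_distrib_left)
    also have "\<dots> \<le> real b * (L ^ n * real b ^ k')"
      by (intro mult_left_mono IH) auto
    also have "\<dots> \<le> L * (real b * (L ^ n * real b ^ k'))"
      using mult_right_mono[OF L, of "real b * (L ^ n * real b ^ k')"] L by simp
    finally show ?thesis using 3 by (simp add: mult_ac)
  qed
qed

text \<open>Discarding changes a coefficient by at most
  \<open>n * measure M N / (k + 1) \<le> \<epsilon> / 2\<close>, so a large coefficient forces mean
  norm at least \<open>\<epsilon> / 2\<close> on the truncated iterate. Jensen's inequality turns
  this into a \<open>2 * s\<close>-th moment, and the power sum bounds the number of such residues.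
  A residue may be counted once any frequency in its class is large, since the truncated norm
  depends on the class only.\<close>

lemma card_large_spectrum_le:
  assumes N [measurable]: "N \<in> sets borel"
    and flat: "\<And>z. z \<notin> N \<Longrightarrow> flattens b s L (\<lambda>a. P a z)"
    and s: "s > 0" and L: "L \<ge> 1" and \<epsilon>: "\<epsilon> > 0"
    and visits: "real n * measure M N \<le> \<epsilon> / 2 * (real k + 1)"
  shows "real (card {r. r < b ^ n \<and> (\<exists>m. [m = int r] (mod int (b ^ n)) \<and>
        norm (\<integral>x. cis (2 * pi * (of_int m * x)) \<partial>M) > \<epsilon>)}) * (\<epsilon> / 2) ^ (2 * s) \<le> L ^ n * real b ^ k"
    (is "real (card ?A) * _ \<le> _")
proof -
  have int: "integrable M (\<lambda>z. norm (twisted N m n k z))" "integrable M (\<lambda>z. norm (twisted N m n k z) ^ (2 * s))"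
    "integrable M (\<lambda>z. norm (twisted {} m n k z))" "integrable M (expected_visits N n)" for m
  proof -
    show "integrable M (\<lambda>z. norm (twisted N m n k z))" "integrable M (\<lambda>z. norm (twisted N m n k z) ^ (2 * s))"
      "integrable M (\<lambda>z. norm (twisted {} m n k z))"
      using norm_twisted_le by (auto intro!: integrable_bounded[where C = 1] power_le_one)
    show "integrable M (expected_visits N n)"
      using expected_visits_bounds[of N n] by (intro integrable_bounded[where C = "real n"]) auto
  qed
  have each: "(\<epsilon> / 2) ^ (2 * s) \<le> (\<integral>z. norm (twisted N (int r) n k z) ^ (2 * s) \<partial>M)" if r: "r \<in> ?A" for r
  proof -
    obtain m where m: "[m = int r] (mod int (b ^ n))" "norm (\<integral>x. cis (2 * pi * (of_int m * x)) \<partial>M) > \<epsilon>"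
      using r by blast
    have "\<epsilon> < norm (\<integral>z. twisted {} m n k z \<partial>M)"
      using m(2) by (simp only: integral_twisted_empty)
    also have "\<dots> \<le> (\<integral>z. norm (twisted {} m n k z) \<partial>M)" by (rule integral_norm_bound)
    also have "\<dots> \<le> (\<integral>z. norm (twisted N m n k z) + expected_visits N n z / (real k + 1) \<partial>M)"
    proof (intro integral_mono Bochner_Integration.integrable_add int integrable_divide)
      fix z
      have "norm (twisted {} m n k z) \<le> norm (twisted N m n k z) + norm (twisted {} m n k z - twisted N m n k z)"
        by (rule norm_triangle_sub)
      also have "norm (twisted {} m n k z - twisted N m n k z) \<le> expected_visits N n z / (real k + 1)"
        using twisted_diff_le(2)[of k m n z N] by (simp add: field_simps)
      finally show "norm (twisted {} m n k z) \<le> norm (twisted N m n k z) + expected_visits N n z / (real k + 1)"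
        by simp
    qed
    also have "\<dots> = (\<integral>z. norm (twisted N m n k z) \<partial>M) + real n * measure M N / (real k + 1)"
      using int integral_expected_visits[OF N, of n] by simp
    also have "real n * measure M N / (real k + 1) \<le> \<epsilon> / 2"
      using visits by (simp add: field_simps)
    finally have big: "\<epsilon> / 2 \<le> (\<integral>z. norm (twisted N (int r) n k z) \<partial>M)"
      using norm_twisted_cong[OF m(1)] by simp
    define c where "c = \<epsilon> / 2"
    have c: "c > 0" using \<epsilon> by (simp add: c_def)
    \<comment> \<open>Jensen's inequality in tangent form: the tangent of \<open>x ^ (2 * s)\<close>
      at \<open>c\<close> lies below the power and can be integrated.\<close>
    have bern: "c ^ (2 * s) * (1 + real (2 * s) * (x / c - 1)) \<le> x ^ (2 * s)" if "x \<ge> 0" for x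
    proof -
      have "1 + real (2 * s) * (x / c - 1) \<le> (1 + (x / c - 1)) ^ (2 * s)"
        by (rule Bernoulli_inequality) (use that c in simp)
      also have "\<dots> = x ^ (2 * s) / c ^ (2 * s)" by (simp add: power_divide)
      finally show ?thesis using c by (simp add: field_simps)
    qed
    have "c ^ (2 * s) * 1 \<le> c ^ (2 * s) * (1 + real (2 * s) * ((\<integral>z. norm (twisted N (int r) n k z) \<partial>M) / c - 1))"
      using big c by (intro mult_left_mono) (auto simp: c_def)
    also have "\<dots> = (\<integral>z. c ^ (2 * s) * (1 + real (2 * s) * (norm (twisted N (int r) n k z) / c - 1)) \<partial>M)"
      using int prob_space by simp
    also have "\<dots> \<le> (\<integral>z. norm (twisted N (int r) n k z) ^ (2 * s) \<partial>M)"
      using int by (intro integral_mono bern) auto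
    finally show ?thesis by (simp add: c_def)
  qed
  have "?A \<subseteq> {..<b ^ n}" by auto
  have "real (card ?A) * (\<epsilon> / 2) ^ (2 * s) \<le> (\<Sum>r\<in>?A. \<integral>z. norm (twisted N (int r) n k z) ^ (2 * s) \<partial>M)"
    using sum_bounded_below[of ?A, OF each] by simp
  also have "\<dots> \<le> (\<Sum>r<b ^ n. \<integral>z. norm (twisted N (int r) n k z) ^ (2 * s) \<partial>M)"
    using \<open>?A \<subseteq> {..<b ^ n}\<close> by (intro sum_mono2) auto
  also have "\<dots> = (\<integral>z. (\<Sum>r<b ^ n. norm (twisted N (int r) n k z) ^ (2 * s)) \<partial>M)"
    using int by simp
  also have "\<dots> \<le> (\<integral>z. L ^ n * real b ^ k \<partial>M)"
    using int by (intro integral_mono power_sum_twisted_le flat s L) auto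
  also have "\<dots> = L ^ n * real b ^ k" using prob_space by simp
  finally show ?thesis .
qed

end

subsection \<open>Entropy of finite-valued random variables\<close>

text \<open>Entropy is attached to functions instead of partitions, so that joins are tuples and
  coarsenings are compositions.\<close>

definition rv_entropy :: "'a measure \<Rightarrow> ('a \<Rightarrow> 'b) \<Rightarrow> real" where
  "rv_entropy M f = - (\<Sum>v\<in>f ` space M. measure M (f -` {v} \<inter> space M) * ln (measure M (f -` {v} \<inter> space M)))"

context prob_space
begin

lemma rv_entropy_superset:
  assumes "finite V" "f ` space M \<subseteq> V"
  shows "rv_entropy M f = - (\<Sum>v\<in>V. prob (f -` {v} \<inter> space M) * ln (prob (f -` {v} \<inter> space M)))"
  unfolding rv_entropy_def
proof (subst sum.mono_neutral_left[OF assms], safe)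
  fix v assume "v \<notin> f ` space M"
  then have "f -` {v} \<inter> space M = {}" by auto
  then have "prob (f -` {v} \<inter> space M) = 0" by simp
  then show "prob (f -` {v} \<inter> space M) * ln (prob (f -` {v} \<inter> space M)) = 0" by simp
qed

lemma prob_fibre_compose:
  assumes f: "simple_function M f" and U: "finite U" "f ` space M \<subseteq> U"
  shows "prob ((\<lambda>x. F (f x)) -` {v} \<inter> space M) = (\<Sum>u\<in>{u\<in>U. F u = v}. prob (f -` {u} \<inter> space M))"
proof -
  have "(\<lambda>x. F (f x)) -` {v} \<inter> space M = (\<Union>u\<in>{u\<in>U. F u = v}. f -` {u} \<inter> space M)"
    using U by auto
  also have "prob \<dots> = (\<Sum>u\<in>{u\<in>U. F u = v}. prob (f -` {u} \<inter> space M))"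
    using U simple_functionD(2)[OF f]
    by (intro finite_measure_finite_Union) (auto simp: disjoint_family_on_def)
  finally show ?thesis .
qed

text \<open>A fibre of \<open>f\<close> lies in a fibre of \<open>F \<circ> f\<close> of at least
  the same mass, and \<open>ln\<close> is monotone.\<close>

lemma rv_entropy_compose_le:
  assumes f: "simple_function M f"
  shows "rv_entropy M (\<lambda>x. F (f x)) \<le> rv_entropy M f"
proof -
  define U where "U = f ` space M"
  have U: "finite U" "f ` space M \<subseteq> U" using simple_functionD(1)[OF f] by (auto simp: U_def)
  define p where "p u = prob (f -` {u} \<inter> space M)" for u
  define p' where "p' v = prob ((\<lambda>x. F (f x)) -` {v} \<inter> space M)" for v
  have p': "p' v = (\<Sum>u\<in>{u\<in>U. F u = v}. p u)" for v
    unfolding p'_def p_def using f U by (rule prob_fibre_compose)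
  have pp: "p u \<le> p' (F u)" if "u \<in> U" for u
    unfolding p' using U that by (intro member_le_sum) (auto simp: p_def)
  have "(\<Sum>u\<in>U. p u * ln (p u)) \<le> (\<Sum>u\<in>U. p u * ln (p' (F u)))"
  proof (intro sum_mono)
    fix u assume "u \<in> U"
    show "p u * ln (p u) \<le> p u * ln (p' (F u))"
    proof (cases "p u = 0")
      case False
      then have "p u > 0" by (simp add: p_def zero_less_measure_iff)
      then show ?thesis using pp[OF \<open>u \<in> U\<close>] by (intro mult_left_mono) auto
    qed simp
  qed
  also have "\<dots> = (\<Sum>v\<in>F ` U. \<Sum>u\<in>{u\<in>U. F u = v}. p u * ln (p' (F u)))"
    by (rule sum.image_gen[OF U(1)])
  also have "\<dots> = (\<Sum>v\<in>F ` U. p' v * ln (p' v))"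
    unfolding p' sum_distrib_right by (intro sum.cong) auto
  finally have "- (\<Sum>v\<in>F ` U. p' v * ln (p' v)) \<le> - (\<Sum>u\<in>U. p u * ln (p u))" by simp
  then show ?thesis
    using rv_entropy_superset[OF U] rv_entropy_superset[of "F ` U" "\<lambda>x. F (f x)"] U
    by (simp add: p_def p'_def image_subset_iff)
qed

lemma rv_entropy_const: "rv_entropy M (\<lambda>x. c) = 0"
proof -
  have "(\<lambda>x. c) ` space M = {c}" using not_empty by auto
  then show ?thesis by (simp add: rv_entropy_def prob_space)
qed

lemma rv_entropy_nonneg: "simple_function M f \<Longrightarrow> rv_entropy M f \<ge> 0"
  using rv_entropy_compose_le[of f "\<lambda>_. ()"] rv_entropy_const[of "()"] by simp

text \<open>The conditional mutual information of \<open>f\<close> and \<open>g\<close> given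
  \<open>h\<close> is nonnegative. This follows from \<open>ln t \<le> t - 1\<close> for the ratio
  \<open>t\<close> of the conditionally independent joint mass to the actual one.\<close>

lemma rv_entropy_submodular:
  assumes f: "simple_function M f" and g: "simple_function M g" and h: "simple_function M h"
  shows "rv_entropy M (\<lambda>x. (f x, g x, h x)) + rv_entropy M h
    \<le> rv_entropy M (\<lambda>x. (f x, h x)) + rv_entropy M (\<lambda>x. (g x, h x))"
proof -
  define A B C where "A = f ` space M" and "B = g ` space M" and "C = h ` space M"
  have fin: "finite A" "finite B" "finite C"
    using simple_functionD(1)[OF f] simple_functionD(1)[OF g] simple_functionD(1)[OF h]
    by (auto simp: A_def B_def C_def)
  define p where "p x y z = prob ((\<lambda>\<omega>. (f \<omega>, g \<omega>, h \<omega>)) -` {(x, y, z)} \<inter> space M)" for x y z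
  define pxz where "pxz x z = prob ((\<lambda>\<omega>. (f \<omega>, h \<omega>)) -` {(x, z)} \<inter> space M)" for x z
  define pyz where "pyz y z = prob ((\<lambda>\<omega>. (g \<omega>, h \<omega>)) -` {(y, z)} \<inter> space M)" for y z
  define pz where "pz z = prob (h -` {z} \<inter> space M)" for z
  have fgh: "simple_function M (\<lambda>\<omega>. (f \<omega>, g \<omega>, h \<omega>))" using f g h by simp
  have ABC: "finite (A \<times> B \<times> C)" "(\<lambda>\<omega>. (f \<omega>, g \<omega>, h \<omega>)) ` space M \<subseteq> A \<times> B \<times> C"
    using fin by (auto simp: A_def B_def C_def)
  have marg_xz: "pxz x z = (\<Sum>y\<in>B. p x y z)" if "x \<in> A" "z \<in> C" for x z
  proof -
    have "pxz x z = (\<Sum>u\<in>{u\<in>A \<times> B \<times> C. (\<lambda>(x, y, z). (x, z)) u = (x, z)}. prob ((\<lambda>\<omega>. (f \<omega>, g \<omega>, h \<omega>)) -` {u} \<inter> space M))"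
      using prob_fibre_compose[OF fgh ABC, of "\<lambda>(x, y, z). (x, z)" "(x, z)"] by (simp add: pxz_def)
    also have "{u\<in>A \<times> B \<times> C. (\<lambda>(x, y, z). (x, z)) u = (x, z)} = (\<lambda>y. (x, y, z)) ` B"
      using that by auto
    finally show ?thesis by (simp add: sum.reindex inj_on_def p_def)
  qed
  have marg_yz: "pyz y z = (\<Sum>x\<in>A. p x y z)" if "y \<in> B" "z \<in> C" for y z
  proof -
    have "pyz y z = (\<Sum>u\<in>{u\<in>A \<times> B \<times> C. (\<lambda>(x, y, z). (y, z)) u = (y, z)}. prob ((\<lambda>\<omega>. (f \<omega>, g \<omega>, h \<omega>)) -` {u} \<inter> space M))"
      using prob_fibre_compose[OF fgh ABC, of "\<lambda>(x, y, z). (y, z)" "(y, z)"] by (simp add: pyz_def)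
    also have "{u\<in>A \<times> B \<times> C. (\<lambda>(x, y, z). (y, z)) u = (y, z)} = (\<lambda>x. (x, y, z)) ` A"
      using that by auto
    finally show ?thesis by (simp add: sum.reindex inj_on_def p_def)
  qed
  have marg_z: "pz z = (\<Sum>x\<in>A. pxz x z)" if "z \<in> C" for z
  proof -
    have "pz z = (\<Sum>u\<in>{u\<in>A \<times> C. snd u = z}. prob ((\<lambda>\<omega>. (f \<omega>, h \<omega>)) -` {u} \<inter> space M))"
      using prob_fibre_compose[of "\<lambda>\<omega>. (f \<omega>, h \<omega>)" "A \<times> C" snd z] f h fin
      by (simp add: pz_def image_subset_iff A_def C_def)
    also have "{u\<in>A \<times> C. snd u = z} = (\<lambda>x. (x, z)) ` A" using that by auto
    finally show ?thesis by (simp add: sum.reindex inj_on_def pxz_def)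
  qed
  have marg_z': "pz z = (\<Sum>y\<in>B. pyz y z)" if "z \<in> C" for z
  proof -
    have "(\<Sum>y\<in>B. pyz y z) = (\<Sum>y\<in>B. \<Sum>x\<in>A. p x y z)" using marg_yz that by simp
    also have "\<dots> = (\<Sum>x\<in>A. \<Sum>y\<in>B. p x y z)" by (rule sum.swap)
    also have "\<dots> = (\<Sum>x\<in>A. pxz x z)" using marg_xz that by simp
    finally show ?thesis using marg_z that by simp
  qed
  have nn: "p x y z \<ge> 0" "pxz x z \<ge> 0" "pyz y z \<ge> 0" "pz z \<ge> 0" for x y z
    by (auto simp: p_def pxz_def pyz_def pz_def)
  have point: "p x y z * ln (pxz x z) + p x y z * ln (pyz y z) - p x y z * ln (p x y z) - p x y z * ln (pz z)
      \<le> pxz x z * pyz y z / pz z - p x y z" if "x \<in> A" "y \<in> B" "z \<in> C" for x y z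
  proof (cases "p x y z = 0")
    case False
    then have pos: "p x y z > 0" using nn(1)[of x y z] by simp
    have le: "p x y z \<le> pxz x z" "p x y z \<le> pyz y z"
      unfolding marg_xz[OF that(1,3)] marg_yz[OF that(2,3)]
      using fin that nn by (auto intro!: member_le_sum)
    have "pxz x z \<le> pz z"
      unfolding marg_z[OF that(3)] using fin that nn by (auto intro!: member_le_sum)
    note le = le this
    then have pos': "pxz x z > 0" "pyz y z > 0" "pz z > 0" using pos by linarith+
    define t where "t = pxz x z * pyz y z / (p x y z * pz z)"
    have "ln t \<le> t - 1" using pos pos' by (intro ln_le_minus_one) (simp add: t_def)
    then have "p x y z * ln t \<le> p x y z * (t - 1)" using pos by simp
    moreover have "ln t = ln (pxz x z) + ln (pyz y z) - ln (p x y z) - ln (pz z)"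
      using pos pos' by (simp add: t_def ln_div ln_mult)
    moreover have "p x y z * (t - 1) = pxz x z * pyz y z / pz z - p x y z"
      using pos pos' by (simp add: t_def field_simps)
    ultimately show ?thesis by (simp add: algebra_simps)
  qed (use nn in \<open>simp add: divide_nonneg_nonneg\<close>)
  have slice: "(\<Sum>x\<in>A. pxz x z * ln (pxz x z)) + (\<Sum>y\<in>B. pyz y z * ln (pyz y z))
      \<le> (\<Sum>x\<in>A. \<Sum>y\<in>B. p x y z * ln (p x y z)) + pz z * ln (pz z)" if z: "z \<in> C" for z
  proof -
    have "(\<Sum>x\<in>A. \<Sum>y\<in>B. p x y z * ln (pxz x z) + p x y z * ln (pyz y z) - p x y z * ln (p x y z) - p x y z * ln (pz z))
       \<le> (\<Sum>x\<in>A. \<Sum>y\<in>B. pxz x z * pyz y z / pz z - p x y z)"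
      by (intro sum_mono point z)
    also have "\<dots> = (\<Sum>x\<in>A. pxz x z) * (\<Sum>y\<in>B. pyz y z) / pz z - (\<Sum>x\<in>A. \<Sum>y\<in>B. p x y z)"
      by (simp add: sum_subtractf sum_product sum_divide_distrib)
    also have "(\<Sum>x\<in>A. \<Sum>y\<in>B. p x y z) = pz z"
      using marg_xz marg_z z by simp
    \<comment> \<open>Also true for \<open>pz z = 0\<close>, where both sides are 0 by the
      convention for division.\<close>
    also have "(\<Sum>x\<in>A. pxz x z) * (\<Sum>y\<in>B. pyz y z) / pz z = pz z"
      using marg_z marg_z' z by simp
    finally have "(\<Sum>x\<in>A. \<Sum>y\<in>B. p x y z * ln (pxz x z)) + (\<Sum>x\<in>A. \<Sum>y\<in>B. p x y z * ln (pyz y z))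
       - (\<Sum>x\<in>A. \<Sum>y\<in>B. p x y z * ln (p x y z)) - (\<Sum>x\<in>A. \<Sum>y\<in>B. p x y z * ln (pz z)) \<le> 0"
      by (simp add: sum_subtractf sum.distrib)
    moreover have "(\<Sum>x\<in>A. \<Sum>y\<in>B. p x y z * ln (pxz x z)) = (\<Sum>x\<in>A. pxz x z * ln (pxz x z))"
      using marg_xz z by (simp add: sum_distrib_right)
    moreover have "(\<Sum>x\<in>A. \<Sum>y\<in>B. p x y z * ln (pyz y z)) = (\<Sum>y\<in>B. pyz y z * ln (pyz y z))"
      using marg_yz z by (subst sum.swap) (simp add: sum_distrib_right)
    moreover have "(\<Sum>x\<in>A. \<Sum>y\<in>B. p x y z * ln (pz z)) = pz z * ln (pz z)"
      using marg_xz marg_z z by (simp add: sum_distrib_right [symmetric])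
    ultimately show ?thesis by linarith
  qed
  have "(\<Sum>z\<in>C. (\<Sum>x\<in>A. pxz x z * ln (pxz x z)) + (\<Sum>y\<in>B. pyz y z * ln (pyz y z)))
      \<le> (\<Sum>z\<in>C. (\<Sum>x\<in>A. \<Sum>y\<in>B. p x y z * ln (p x y z)) + pz z * ln (pz z))"
    by (intro sum_mono slice)
  moreover have "rv_entropy M (\<lambda>\<omega>. (f \<omega>, g \<omega>, h \<omega>)) = - (\<Sum>z\<in>C. \<Sum>x\<in>A. \<Sum>y\<in>B. p x y z * ln (p x y z))"
  proof -
    have "rv_entropy M (\<lambda>\<omega>. (f \<omega>, g \<omega>, h \<omega>)) = - (\<Sum>(x, y, z)\<in>A \<times> B \<times> C. p x y z * ln (p x y z))"
      unfolding p_def using rv_entropy_superset[OF ABC] by (simp add: case_prod_unfold)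
    also have "(\<Sum>(x, y, z)\<in>A \<times> B \<times> C. p x y z * ln (p x y z)) = (\<Sum>x\<in>A. \<Sum>y\<in>B. \<Sum>z\<in>C. p x y z * ln (p x y z))"
      by (simp add: sum.cartesian_product [symmetric])
    also have "\<dots> = (\<Sum>x\<in>A. \<Sum>z\<in>C. \<Sum>y\<in>B. p x y z * ln (p x y z))"
      by (intro sum.cong refl sum.swap)
    also have "\<dots> = (\<Sum>z\<in>C. \<Sum>x\<in>A. \<Sum>y\<in>B. p x y z * ln (p x y z))"
      by (rule sum.swap)
    finally show ?thesis .
  qed
  moreover have "rv_entropy M (\<lambda>\<omega>. (f \<omega>, h \<omega>)) = - (\<Sum>z\<in>C. \<Sum>x\<in>A. pxz x z * ln (pxz x z))"
  proof -
    have "rv_entropy M (\<lambda>\<omega>. (f \<omega>, h \<omega>)) = - (\<Sum>(x, z)\<in>A \<times> C. pxz x z * ln (pxz x z))"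
      unfolding pxz_def using fin by (subst rv_entropy_superset[of "A \<times> C"]) (auto simp: A_def C_def case_prod_unfold)
    also have "(\<Sum>(x, z)\<in>A \<times> C. pxz x z * ln (pxz x z)) = (\<Sum>z\<in>C. \<Sum>x\<in>A. pxz x z * ln (pxz x z))"
      by (subst sum.swap) (simp add: sum.cartesian_product)
    finally show ?thesis .
  qed
  moreover have "rv_entropy M (\<lambda>\<omega>. (g \<omega>, h \<omega>)) = - (\<Sum>z\<in>C. \<Sum>y\<in>B. pyz y z * ln (pyz y z))"
  proof -
    have "rv_entropy M (\<lambda>\<omega>. (g \<omega>, h \<omega>)) = - (\<Sum>(y, z)\<in>B \<times> C. pyz y z * ln (pyz y z))"
      unfolding pyz_def using fin by (subst rv_entropy_superset[of "B \<times> C"]) (auto simp: B_def C_def case_prod_unfold)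
    also have "(\<Sum>(y, z)\<in>B \<times> C. pyz y z * ln (pyz y z)) = (\<Sum>z\<in>C. \<Sum>y\<in>B. pyz y z * ln (pyz y z))"
      by (subst sum.swap) (simp add: sum.cartesian_product)
    finally show ?thesis .
  qed
  moreover have "rv_entropy M h = - (\<Sum>z\<in>C. pz z * ln (pz z))"
    by (simp add: rv_entropy_def pz_def C_def)
  ultimately show ?thesis by (simp add: sum.distrib)
qed

text \<open>Submodularity conditioned on a constant.\<close>

lemma rv_entropy_subadditive:
  assumes "simple_function M f" "simple_function M g"
  shows "rv_entropy M (\<lambda>x. (f x, g x)) \<le> rv_entropy M f + rv_entropy M g"
proof -
  have "rv_entropy M (\<lambda>x. (f x, g x)) \<le> rv_entropy M (\<lambda>x. (f x, g x, ()))"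
    using rv_entropy_compose_le[of "\<lambda>x. (f x, g x, ())" "\<lambda>(a, b, c). (a, b)"] assms by simp
  moreover have "rv_entropy M (\<lambda>x. (f x, ())) \<le> rv_entropy M f"
    using rv_entropy_compose_le[of f "\<lambda>a. (a, ())"] assms by simp
  moreover have "rv_entropy M (\<lambda>x. (g x, ())) \<le> rv_entropy M g"
    using rv_entropy_compose_le[of g "\<lambda>a. (a, ())"] assms by simp
  moreover have "rv_entropy M (\<lambda>x. (f x, g x, ())) + rv_entropy M (\<lambda>x. ())
      \<le> rv_entropy M (\<lambda>x. (f x, ())) + rv_entropy M (\<lambda>x. (g x, ()))"
    by (rule rv_entropy_submodular) (use assms in auto)
  ultimately show ?thesis using rv_entropy_const[of "()"] by linarith
qed

lemma rv_entropy_AE_cong: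
  assumes f: "simple_function M f" and g: "simple_function M g" and ae: "AE x in M. f x = g x"
  shows "rv_entropy M f = rv_entropy M g"
proof -
  let ?V = "f ` space M \<union> g ` space M"
  have "prob (f -` {v} \<inter> space M) = prob (g -` {v} \<inter> space M)" for v
    using ae f g by (intro finite_measure_eq_AE) (auto simp: simple_functionD(2))
  moreover have "finite ?V" using f g by (simp add: simple_functionD(1))
  ultimately show ?thesis
    using rv_entropy_superset[of ?V f] rv_entropy_superset[of ?V g] by simp
qed

lemma rv_entropy_distr:
  assumes T: "T \<in> measurable M N" and f: "simple_function N f"
  shows "rv_entropy (distr M N T) f = rv_entropy M (\<lambda>x. f (T x))"
proof -
  have "(\<lambda>x. f (T x)) ` space M \<subseteq> f ` space N"
    using measurable_space[OF T] by auto
  moreover have "measure (distr M N T) (f -` {v} \<inter> space N) = prob ((\<lambda>x. f (T x)) -` {v} \<inter> space M)" for v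
  proof -
    have "measure (distr M N T) (f -` {v} \<inter> space N) = prob (T -` (f -` {v} \<inter> space N) \<inter> space M)"
      using simple_functionD(2)[OF f] by (intro measure_distr T)
    also have "T -` (f -` {v} \<inter> space N) \<inter> space M = (\<lambda>x. f (T x)) -` {v} \<inter> space M"
      using measurable_space[OF T] by auto
    finally show ?thesis .
  qed
  ultimately show ?thesis
    using rv_entropy_superset[of "f ` space N" "\<lambda>x. f (T x)"] simple_functionD(1)[OF f]
    by (simp add: rv_entropy_def)
qed

text \<open>If \<open>f\<close> and \<open>g\<close> mostly agree, their joint law is close to the
  law of \<open>g\<close> placed on the diagonal of \<open>V \<times> V\<close>, and
  \<open>t * ln t\<close> is uniformly continuous on the unit interval. As \<open>\<delta>\<close>
  depends only on \<open>V\<close> and \<open>\<tau>\<close> (and \<open>M\<close>), the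
  approximation \<open>g\<close> may be chosen after it.\<close>

lemma rv_entropy_joint_close:
  assumes V: "finite V" and \<tau>: "\<tau> > 0"
  obtains \<delta> where "\<delta> > 0"
    "\<And>f g. simple_function M f \<Longrightarrow> simple_function M g \<Longrightarrow> f ` space M \<subseteq> V \<Longrightarrow> g ` space M \<subseteq> V \<Longrightarrow>
      prob {x\<in>space M. f x \<noteq> g x} \<le> \<delta> \<Longrightarrow> rv_entropy M (\<lambda>x. (f x, g x)) \<le> rv_entropy M g + \<tau>"
proof -
  define \<phi> where "\<phi> t = t * ln t" for t :: real
  have "continuous_on {0..1} \<phi>"
  proof (rule continuous_on_IccI)
    have "((\<lambda>t. t * ln t) \<longlongrightarrow> 0) (at_right (0::real))" by real_asymp
    then show "(\<phi> \<longlongrightarrow> \<phi> 0) (at_right 0)" by (simp add: \<phi>_def [abs_def])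
    show "(\<phi> \<longlongrightarrow> \<phi> 1) (at_left 1)"
      unfolding \<phi>_def [abs_def] by (auto intro!: tendsto_eq_intros)
    show "\<And>x. 0 < x \<Longrightarrow> x < 1 \<Longrightarrow> \<phi> \<midarrow>x\<rightarrow> \<phi> x"
      unfolding \<phi>_def [abs_def] by (auto intro!: tendsto_eq_intros)
  qed simp
  then have "uniformly_continuous_on {0..1} \<phi>"
    by (intro compact_uniformly_continuous) auto
  moreover define \<tau>' where "\<tau>' = \<tau> / (real (card (V \<times> V)) + 1)"
  have "\<tau>' > 0" using \<tau> by (simp add: \<tau>'_def add_nonneg_pos)
  ultimately obtain d where d: "d > 0" "\<And>s t. s \<in> {0..1} \<Longrightarrow> t \<in> {0..1} \<Longrightarrow> dist t s < d \<Longrightarrow> dist (\<phi> t) (\<phi> s) < \<tau>'"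
    unfolding uniformly_continuous_on_def by metis
  show ?thesis
  proof (rule that)
    show "d / 2 > 0" using d by simp
    fix f g :: "'a \<Rightarrow> 'b"
    assume f: "simple_function M f" and g: "simple_function M g"
      and fV: "f ` space M \<subseteq> V" and gV: "g ` space M \<subseteq> V"
      and close: "prob {x\<in>space M. f x \<noteq> g x} \<le> d / 2"
    have fg: "simple_function M (\<lambda>x. (f x, g x))" using f g by simp
    define p where "p v w = prob ((\<lambda>x. (f x, g x)) -` {(v, w)} \<inter> space M)" for v w
    define q where "q w = prob (g -` {w} \<inter> space M)" for w
    have bad: "{x\<in>space M. f x \<noteq> g x} \<in> sets M"
    proof -
      have "{x\<in>space M. f x \<noteq> g x} = (\<lambda>x. (f x, g x)) -` {u. fst u \<noteq> snd u} \<inter> space M" by auto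
      then show ?thesis by (simp only: simple_functionD(2)[OF fg])
    qed
    have ms: "(\<lambda>x. (f x, g x)) -` X \<inter> space M \<in> sets M" "g -` Y \<inter> space M \<in> sets M" for X Y
      using simple_functionD(2)[OF fg] simple_functionD(2)[OF g] by auto
    have off: "p v w \<le> d / 2" if "v \<noteq> w" for v w
    proof -
      have "p v w \<le> prob {x\<in>space M. f x \<noteq> g x}"
        unfolding p_def using that bad by (intro finite_measure_mono) auto
      then show ?thesis using close by simp
    qed
    have diag: "p v v \<le> q v" "q v \<le> p v v + d / 2" for v
    proof -
      show "p v v \<le> q v" unfolding p_def q_def using ms by (intro finite_measure_mono) auto
      have "q v \<le> prob (((\<lambda>x. (f x, g x)) -` {(v, v)} \<inter> space M) \<union> {x\<in>space M. f x \<noteq> g x})"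
        unfolding q_def using ms bad by (intro finite_measure_mono) auto
      also have "\<dots> \<le> p v v + prob {x\<in>space M. f x \<noteq> g x}"
        unfolding p_def using ms bad by (intro measure_Un_le) auto
      finally show "q v \<le> p v v + d / 2" using close by simp
    qed
    have range: "p v w \<in> {0..1}" "q w \<in> {0..1}" for v w by (auto simp: p_def q_def)
    have entry: "(if v = w then \<phi> (q w) else 0) - \<phi> (p v w) \<le> \<tau>'" for v w
    proof (cases "v = w")
      case True
      have "dist (q w) (p w w) < d" using diag[of w] d by (simp add: dist_real_def)
      then have "dist (\<phi> (q w)) (\<phi> (p w w)) < \<tau>'" by (intro d range)
      then show ?thesis using True by (simp add: dist_real_def)
    next
      case False
      have "dist 0 (p v w) < d" using off[OF False] d range(1)[of v w] by (simp add: dist_real_def)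
      then have "dist (\<phi> 0) (\<phi> (p v w)) < \<tau>'" by (intro d range) auto
      then show ?thesis using False by (simp add: dist_real_def \<phi>_def)
    qed
    have "rv_entropy M (\<lambda>x. (f x, g x)) = - (\<Sum>(v, w)\<in>V \<times> V. \<phi> (p v w))"
      unfolding p_def \<phi>_def using V fV gV
      by (subst rv_entropy_superset[of "V \<times> V"]) (auto simp: case_prod_unfold)
    moreover have "rv_entropy M g = - (\<Sum>(v, w)\<in>V \<times> V. if v = w then \<phi> (q w) else 0)"
      unfolding q_def \<phi>_def using V gV
      by (subst rv_entropy_superset[of V]) (auto simp: sum.cartesian_product [symmetric] sum.delta)
    moreover have "(\<Sum>(v, w)\<in>V \<times> V. if v = w then \<phi> (q w) else 0) - (\<Sum>(v, w)\<in>V \<times> V. \<phi> (p v w))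
        \<le> of_nat (card (V \<times> V)) * \<tau>'"
      unfolding sum_subtractf [symmetric] case_prod_unfold
      by (rule sum_bounded_above) (use entry in \<open>simp only: mem_Times_iff\<close>)
    moreover have "real (card (V \<times> V)) * \<tau>' \<le> \<tau>"
      using \<tau> by (simp add: \<tau>'_def field_simps)
    ultimately show "rv_entropy M (\<lambda>x. (f x, g x)) \<le> rv_entropy M g + \<tau>" by linarith
  qed
qed

text \<open>Conditioning on more lowers the entropy of \<open>f\<close>: the conditional entropy
  given \<open>h\<close> is at most the one given \<open>F \<circ> h\<close>, written without
  subtraction.\<close>

lemma rv_entropy_cond_mono:
  assumes f: "simple_function M f" and h: "simple_function M h"
  shows "rv_entropy M (\<lambda>x. (f x, h x)) + rv_entropy M (\<lambda>x. F (h x))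
    \<le> rv_entropy M (\<lambda>x. (f x, F (h x))) + rv_entropy M h"
proof -
  have "rv_entropy M (\<lambda>x. (f x, h x)) \<le> rv_entropy M (\<lambda>x. (f x, h x, F (h x)))"
    using rv_entropy_compose_le[of "\<lambda>x. (f x, h x, F (h x))" "\<lambda>(a, b, c). (a, b)"] f h
    by (simp add: simple_function_compose1)
  moreover have "rv_entropy M (\<lambda>x. (h x, F (h x))) \<le> rv_entropy M h"
    using rv_entropy_compose_le[of h "\<lambda>b. (b, F b)"] h by simp
  moreover have "rv_entropy M (\<lambda>x. (f x, h x, F (h x))) + rv_entropy M (\<lambda>x. F (h x))
    \<le> rv_entropy M (\<lambda>x. (f x, F (h x))) + rv_entropy M (\<lambda>x. (h x, F (h x)))"
    by (rule rv_entropy_submodular) (use f h in \<open>auto simp: simple_function_compose1\<close>)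
  ultimately show ?thesis by linarith
qed

end

subsection \<open>Invariant measures on the unit interval\<close>

lemma nat_decimal_split:
  fixes p :: nat
  assumes "p > 0"
  shows "nat \<lfloor>real p ^ (m + n) * frac x\<rfloor>
    = p ^ m * nat \<lfloor>real p ^ n * frac x\<rfloor> + nat \<lfloor>real p ^ m * frac (frac (real p ^ n * x))\<rfloor>"
proof -
  define y where "y = frac x"
  have y: "0 \<le> y" by (simp add: y_def)
  have "real p ^ n * x = real p ^ n * y + of_int (int p ^ n * \<lfloor>x\<rfloor>)"
    by (simp add: y_def frac_def algebra_simps)
  then have fr: "frac (real p ^ n * x) = frac (real p ^ n * y)" by (simp only: frac_add_of_int_right)
  define d where "d = \<lfloor>real p ^ n * y\<rfloor>"
  have d: "d \<ge> 0" using y by (simp add: d_def)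
  have "real p ^ (m + n) * y = real p ^ m * (real_of_int d + frac (real p ^ n * y))"
    by (simp add: d_def frac_def power_add)
  also have "\<dots> = of_int (int p ^ m * d) + real p ^ m * frac (real p ^ n * y)"
    by (simp add: algebra_simps)
  finally have "\<lfloor>real p ^ (m + n) * y\<rfloor> = int p ^ m * d + \<lfloor>real p ^ m * frac (real p ^ n * y)\<rfloor>"
    by (simp only: int_add_floor)
  moreover have "\<lfloor>real p ^ m * frac (real p ^ n * y)\<rfloor> \<ge> 0" by simp
  ultimately show ?thesis
    using d by (simp add: fr y_def [symmetric] d_def [symmetric] nat_add_distrib nat_mult_distrib nat_power_eq)
qed

text \<open>Concentration on the unit interval is not assumed: the measure is an image under
  \<open>frac\<close>, which gives \<open>AE_frac\<close>.\<close>

locale times_invariant = prob_space M for M :: "real measure" +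
  fixes p :: nat
  assumes p_gt_1: "p > 1"
    and sets_M [measurable_cong]: "sets M = sets borel"
    and invariant: "distr M borel (\<lambda>x. frac (real p * x)) = M"
begin

lemma space_M [simp]: "space M = UNIV"
  using sets_eq_imp_space_eq[OF sets_M] by simp

definition shift :: "nat \<Rightarrow> real \<Rightarrow> real" where
  "shift n x = frac (real p ^ n * x)"

text \<open>The first \<open>n\<close> base \<open>p\<close> digits as one integer, the first digit
  leading. Modulo \<open>q ^ k\<close> with \<open>q dvd p\<close>, only the last \<open>k\<close>
  of them matter.\<close>

definition digits :: "nat \<Rightarrow> real \<Rightarrow> nat" where
  "digits n x = nat \<lfloor>real p ^ n * frac x\<rfloor>"

lemma shift_measurable [measurable]: "shift n \<in> borel_measurable borel"
  unfolding shift_def frac_def by measurable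

lemma digits_measurable [measurable]: "digits n \<in> measurable borel (count_space UNIV)"
  unfolding digits_def frac_def by measurable

lemma digits_less: "digits n x < p ^ n"
proof -
  have "real p ^ n * frac x < real p ^ n * 1"
    using p_gt_1 frac_lt_1[of x] by (intro mult_strict_left_mono) auto
  then have "\<lfloor>real p ^ n * frac x\<rfloor> < int (p ^ n)" by (simp add: floor_less_iff)
  then show ?thesis unfolding digits_def by (subst nat_less_iff) auto
qed

lemma digits_add: "digits (m + n) x = p ^ m * digits n x + digits m (shift n x)"
  using nat_decimal_split[of p m n x] p_gt_1 by (simp add: digits_def shift_def)

lemma frac_shift [simp]: "frac (shift n x) = shift n x"
  by (simp add: shift_def)

lemma shift_shift: "shift m (shift n x) = shift (m + n) x"
proof -
  have "real p ^ m * frac (real p ^ n * x) = real p ^ (m + n) * x + of_int (- (int p ^ m * \<lfloor>real p ^ n * x\<rfloor>))"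
    by (simp add: frac_def power_add algebra_simps)
  then show ?thesis unfolding shift_def by (simp only: frac_add_of_int_right)
qed

lemma digits_div: "digits m x = digits (n + m) x div p ^ n"
proof -
  have "digits n (shift m x) div p ^ n = 0" using digits_less by simp
  then show ?thesis using p_gt_1 by (simp add: digits_add div_mult_self3 div_add1_eq)
qed

lemma distr_shift: "distr M borel (shift n) = M"
proof (induction n)
  \<comment> \<open>\<open>shift 0\<close> is \<open>frac\<close>, not the identity; the two agree
    almost everywhere because the measure is an image under \<open>frac\<close>.\<close>
  case 0
  have "AE x in distr M borel (\<lambda>x. frac (real p * x)). frac x = x"
    by (subst AE_distr_iff) (auto simp: frac_def)
  then have "AE x in M. frac x = x" by (simp only: invariant)
  then have "distr M borel (shift 0) = distr M borel (\<lambda>x. x)"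
    by (intro distr_cong_AE) (auto simp: shift_def)
  also have "\<dots> = M" by (rule distr_id2) (simp add: sets_M)
  finally show ?case .
next
  case (Suc n)
  have "distr M borel (shift (Suc n)) = distr (distr M borel (shift n)) borel (shift 1)"
    by (subst distr_distr) (auto simp: comp_def shift_shift)
  also have "\<dots> = distr M borel (\<lambda>x. frac (real p * x))"
    unfolding Suc by (simp add: shift_def [abs_def])
  finally show ?case by (simp only: invariant)
qed

lemma AE_shift_iff:
  assumes "{x. Q x} \<in> sets borel"
  shows "(AE x in M. Q (shift n x)) \<longleftrightarrow> (AE x in M. Q x)"
proof -
  have "(AE x in distr M borel (shift n). Q x) \<longleftrightarrow> (AE x in M. Q (shift n x))"
    using assms by (intro AE_distr_iff) auto
  then show ?thesis by (simp only: distr_shift)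
qed

lemma AE_shift: "AE x in M. Q x \<Longrightarrow> AE x in M. Q (shift n x)"
proof -
  assume "AE x in M. Q x"
  then have "AE x in distr M borel (shift n). Q x" by (simp only: distr_shift)
  then show ?thesis by (rule AE_distrD[rotated]) simp
qed

lemma AE_frac: "AE x in M. frac x = x"
proof -
  have "AE x in M. frac (shift 0 x) = shift 0 x" by simp
  then show ?thesis by (subst (asm) AE_shift_iff) (auto simp: frac_def)
qed

lemma simple_digits [simp]: "simple_function M (digits n)"
proof -
  have "digits n ` space M \<subseteq> {..<p ^ n}" using digits_less by auto
  then show ?thesis
    unfolding simple_function_eq_measurable using finite_subset by (auto cong: measurable_cong_sets)
qed

lemma simple_shift [simp]: "simple_function M f \<Longrightarrow> simple_function M (\<lambda>x. f (shift n x))"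
proof -
  assume f: "simple_function M f"
  then have "f \<in> measurable M (count_space UNIV)" by (simp add: simple_function_eq_measurable)
  then have "f \<in> measurable borel (count_space UNIV)" by (simp cong: measurable_cong_sets add: measurable_cong_sets[OF sets_M refl])
  then have "(\<lambda>x. f (shift n x)) \<in> measurable borel (count_space UNIV)" by measurable
  then have "(\<lambda>x. f (shift n x)) \<in> measurable M (count_space UNIV)" by (simp add: measurable_cong_sets[OF sets_M refl])
  moreover have "finite (range (\<lambda>x. f (shift n x)))"
    using simple_functionD(1)[OF f] by (rule finite_subset[rotated]) auto
  ultimately show ?thesis by (simp add: simple_function_eq_measurable)
qed

lemma rv_entropy_shift:
  assumes f: "simple_function M f"
  shows "rv_entropy M (\<lambda>x. f (shift n x)) = rv_entropy M f"
proof -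
  have "simple_function borel f"
    using f sets_M by (simp add: simple_function_def)
  then have "rv_entropy (distr M borel (shift n)) f = rv_entropy M (\<lambda>x. f (shift n x))"
    by (intro rv_entropy_distr) auto
  then show ?thesis by (simp only: distr_shift)
qed

abbreviation H :: "nat \<Rightarrow> real" where
  "H n \<equiv> rv_entropy M (digits n)"

lemma H_nonneg: "H n \<ge> 0"
  by (rule rv_entropy_nonneg) simp

lemma H_add: "H (m + n) \<le> H m + H n"
proof -
  have "rv_entropy M (\<lambda>x. (\<lambda>(a, b). p ^ m * a + b) (digits n x, digits m (shift n x)))
      \<le> rv_entropy M (\<lambda>x. (digits n x, digits m (shift n x)))"
    by (rule rv_entropy_compose_le) simp
  also have "\<dots> \<le> H n + rv_entropy M (\<lambda>x. digits m (shift n x))"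
    by (intro rv_entropy_subadditive) auto
  also have "rv_entropy M (\<lambda>x. digits m (shift n x)) = H m" by (rule rv_entropy_shift) simp
  finally show ?thesis by (simp add: digits_add [abs_def])
qed

lemma H_0: "H 0 = 0"
proof -
  have "digits 0 = (\<lambda>x. 0)" using digits_less[of 0] by auto
  then show ?thesis by (simp add: rv_entropy_const)
qed

lemma H_mult: "H (c * n) \<le> real c * H n"
proof (induction c)
  case (Suc c)
  have "H (Suc c * n) \<le> H n + H (c * n)" using H_add[of n "c * n"] by simp
  then show ?case using Suc by (simp add: algebra_simps)
qed (simp add: H_0)

text \<open>The union of the cylinders of length \<open>m\<close> that meet the part of
  \<open>K\<close> in the unit interval. Points of \<open>K\<close> outside it are excluded, as
  their digits are those of another point.\<close>

definition cylinders :: "nat \<Rightarrow> real set \<Rightarrow> real set" where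
  "cylinders m K = {x. \<exists>y\<in>K. frac y = y \<and> digits m y = digits m x}"

lemma cylinders_sets [measurable]: "cylinders m K \<in> sets M"
proof -
  have "cylinders m K = digits m -` {d. \<exists>y\<in>K. frac y = y \<and> digits m y = d} \<inter> space borel"
    by (simp add: cylinders_def vimage_def)
  also have "\<dots> \<in> sets borel" by (rule measurable_sets[OF digits_measurable]) simp
  finally show ?thesis by (simp add: sets_M)
qed

lemma digits_dist:
  assumes "frac x = x" "frac y = y" "digits m x = digits m y"
  shows "\<bar>x - y\<bar> \<le> 1 / real p ^ m"
proof -
  have xy: "0 \<le> x" "0 \<le> y" using assms(1,2) frac_ge_0[of x] frac_ge_0[of y] by auto
  have "\<lfloor>real p ^ m * x\<rfloor> = \<lfloor>real p ^ m * y\<rfloor>"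
    using assms xy by (simp add: digits_def eq_nat_nat_iff)
  then have "\<bar>real p ^ m * x - real p ^ m * y\<bar> \<le> 1" by linarith
  then have "real p ^ m * \<bar>x - y\<bar> \<le> 1"
    by (simp add: abs_mult right_diff_distrib [symmetric])
  then show ?thesis using p_gt_1 by (simp add: field_simps)
qed

text \<open>Points of \<open>K\<close> sharing more and more digits with \<open>x\<close> converge
  to \<open>x\<close>, and \<open>K\<close> is closed; so the cylinders decrease to \<open>K\<close>
  up to a null set.\<close>

lemma prob_cylinders_compact:
  assumes K: "compact K"
  shows "(\<lambda>m. prob (cylinders m K)) \<longlonglongrightarrow> prob K"
proof -
  have dec: "decseq (\<lambda>m. cylinders m K)"
    unfolding decseq_Suc_iff
  proof
    fix m
    have "digits m x = digits m y" if "digits (Suc m) x = digits (Suc m) y" for x y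
      using that by (simp add: digits_div[of m x 1] digits_div[of m y 1])
    then show "cylinders (Suc m) K \<subseteq> cylinders m K" unfolding cylinders_def by blast
  qed
  have "(\<lambda>m. prob (cylinders m K)) \<longlonglongrightarrow> prob (\<Inter>m. cylinders m K)"
    by (rule finite_Lim_measure_decseq) (use dec in auto)
  also have "prob (\<Inter>m. cylinders m K) = prob K"
  proof (rule finite_measure_eq_AE)
    show "AE x in M. x \<in> (\<Inter>m. cylinders m K) \<longleftrightarrow> x \<in> K"
      using AE_frac
    proof eventually_elim
      case (elim x)
      show ?case
      proof
        assume "x \<in> (\<Inter>m. cylinders m K)"
        then have "\<forall>m. \<exists>y\<in>K. frac y = y \<and> digits m y = digits m x" by (auto simp: cylinders_def)
        then obtain y where y: "\<And>m. y m \<in> K" "\<And>m. frac (y m) = y m" "\<And>m. digits m (y m) = digits m x"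
          by metis
        have "(\<lambda>m. y m - x) \<longlonglongrightarrow> 0"
        proof (rule Lim_null_comparison)
          show "\<forall>\<^sub>F m in sequentially. norm (y m - x) \<le> (1 / real p) ^ m"
            using digits_dist[OF y(2) elim y(3)] by (simp add: power_divide)
          show "(\<lambda>m. (1 / real p) ^ m) \<longlonglongrightarrow> 0" using p_gt_1 by (intro LIMSEQ_realpow_zero) auto
        qed
        then have "y \<longlonglongrightarrow> x" by (simp add: LIM_zero_iff)
        then show "x \<in> K"
          using closed_sequentially[OF compact_imp_closed[OF K]] y(1) by blast
      next
        assume "x \<in> K"
        then show "x \<in> (\<Inter>m. cylinders m K)" using elim by (auto simp: cylinders_def)
      qed
    qed
    show "(\<Inter>m. cylinders m K) \<in> sets M" by (rule sets.countable_INT) auto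
    show "K \<in> sets M" using K by (simp add: sets_M compact_imp_closed borel_closed)
  qed
  finally show ?thesis .
qed

lemma compact_inner_approximation:
  assumes A: "A \<in> sets M" and \<delta>: "\<delta> > 0"
  obtains K where "K \<subseteq> A" "compact K" "prob (A - K) < \<delta>"
proof (cases "prob A < \<delta>")
  case True
  then show ?thesis using that[of "{}"] by simp
next
  case False
  have "ennreal (prob A - \<delta>) < ennreal (prob A)"
    using False \<delta> by (simp add: ennreal_less_iff)
  also have "\<dots> = (SUP K\<in>{K. K \<subseteq> A \<and> compact K}. emeasure M K)"
    unfolding emeasure_eq_measure [symmetric] by (rule inner_regular) (use A sets_M in auto)
  finally obtain K where K: "K \<subseteq> A" "compact K" "ennreal (prob A - \<delta>) < emeasure M K"
    unfolding less_SUP_iff by auto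
  have KM: "K \<in> sets M" using K by (simp add: sets_M compact_imp_closed borel_closed)
  have "prob A - \<delta> < prob K"
    using K(3) False by (simp add: emeasure_eq_measure ennreal_less_iff)
  moreover have "prob (A - K) = prob A - prob K"
    using A KM K by (intro finite_measure_Diff) auto
  ultimately show ?thesis using that[of K] K by simp
qed

text \<open>Each fibre contains a compact \<open>K v\<close> of nearly the same mass, and for large
  \<open>m\<close> the cylinders meeting \<open>K v\<close> are hardly larger than
  \<open>K v\<close>. Outside a small set, the cylinder of \<open>x\<close> then meets
  \<open>K v\<close> for \<open>v = f x\<close> and for no other \<open>v\<close>.\<close>

lemma simple_function_approx_digits:
  assumes f: "simple_function M f" and \<delta>: "\<delta> > 0"
  obtains m F where "\<And>d. F d \<in> range f" "prob {x\<in>space M. f x \<noteq> F (digits m x)} \<le> \<delta>"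
proof -
  define V where "V = range f"
  have V: "finite V" "V \<noteq> {}" using simple_functionD(1)[OF f] by (auto simp: V_def)
  \<comment> \<open>Two unions of \<open>card V\<close> sets of mass at most \<open>\<eta>\<close>
    make up the exceptional set.\<close>
  define \<eta> where "\<eta> = \<delta> / (2 * real (card V))"
  have cV: "real (card V) > 0" using V by (simp add: card_gt_0_iff)
  then have \<eta>: "\<eta> > 0" using \<delta> by (simp add: \<eta>_def)
  define A where "A v = f -` {v} \<inter> space M" for v
  have A: "A v \<in> sets M" for v unfolding A_def by (rule simple_functionD(2)[OF f])
  have "\<exists>K. K \<subseteq> A v \<and> compact K \<and> prob (A v - K) < \<eta>" for v
    using compact_inner_approximation[OF A \<eta>] by metis
  then obtain K where K: "\<And>v. K v \<subseteq> A v" "\<And>v. compact (K v)" "\<And>v. prob (A v - K v) < \<eta>"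
    by metis
  have Ks: "K v \<in> sets M" for v using K(2) by (simp add: sets_M compact_imp_closed borel_closed)
  have "\<forall>\<^sub>F m in sequentially. \<forall>v\<in>V. prob (cylinders m (K v)) < prob (K v) + \<eta>"
    using V(1) by (intro eventually_ball_finite ballI order_tendstoD(2)[OF prob_cylinders_compact[OF K(2)]])
      (use \<eta> in auto)
  from eventually_happens'[OF sequentially_bot this]
  obtain m where m: "\<And>v. v \<in> V \<Longrightarrow> prob (cylinders m (K v)) < prob (K v) + \<eta>"
    by blast
  have "\<exists>v0. v0 \<in> V" using V by auto
  then obtain v0 where v0: "v0 \<in> V" by auto
  define hit where "hit d v \<longleftrightarrow> v \<in> V \<and> (\<exists>y\<in>K v. frac y = y \<and> digits m y = d)" for d v
  \<comment> \<open>Any value hit by the cylinder will do, being almost surely unique outside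
    \<open>Bad\<close>; \<open>v0\<close> is the default for cylinders that hit none.\<close>
  define F where "F d = (if \<exists>v. hit d v then SOME v. hit d v else v0)" for d
  have F: "F d \<in> V" for d
  proof (cases "\<exists>v. hit d v")
    case True
    then have "hit d (F d)" using someI_ex[of "hit d"] by (simp add: F_def)
    then show ?thesis by (simp add: hit_def)
  qed (use v0 in \<open>simp add: F_def\<close>)
  define Bad where "Bad = (\<Union>v\<in>V. A v - K v) \<union> (\<Union>v\<in>V. cylinders m (K v) - K v)"
  have BadM: "Bad \<in> sets M" unfolding Bad_def
    by (intro sets.Un sets.finite_UN sets.Diff V A Ks cylinders_sets)
  have fM: "{x\<in>space M. f x \<noteq> F (digits m x)} \<in> sets M"
  proof -
    have "{x\<in>space M. f x \<noteq> F (digits m x)} = (\<lambda>x. (f x, digits m x)) -` {u. fst u \<noteq> F (snd u)} \<inter> space M"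
      by auto
    also have "\<dots> \<in> sets M" by (rule simple_functionD(2)) (use f in simp)
    finally show ?thesis .
  qed
  have sub: "prob {x\<in>space M. f x \<noteq> F (digits m x)} \<le> prob Bad"
  proof (rule finite_measure_mono_AE)
    show "AE x in M. x \<in> {x\<in>space M. f x \<noteq> F (digits m x)} \<longrightarrow> x \<in> Bad"
      using AE_frac
    proof eventually_elim
      case (elim x)
      show ?case
      proof (intro impI, rule ccontr)
        assume x: "x \<in> {x\<in>space M. f x \<noteq> F (digits m x)}" "x \<notin> Bad"
        have "f x \<in> V" "x \<in> A (f x)" by (auto simp: V_def A_def)
        then have "x \<in> K (f x)" using x(2) by (auto simp: Bad_def)
        then have "hit (digits m x) (f x)" using elim \<open>f x \<in> V\<close> by (auto simp: hit_def)
        then have "hit (digits m x) (F (digits m x))"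
          using someI[of "hit (digits m x)"] by (auto simp: F_def)
        then have w: "F (digits m x) \<in> V" "x \<in> cylinders m (K (F (digits m x)))"
          by (auto simp: hit_def cylinders_def)
        then have "x \<in> K (F (digits m x))" using x(2) by (auto simp: Bad_def)
        then have "f x = F (digits m x)" using K(1) by (auto simp: A_def)
        then show False using x(1) by simp
      qed
    qed
  qed (rule BadM)
  have "prob Bad \<le> prob (\<Union>v\<in>V. A v - K v) + prob (\<Union>v\<in>V. cylinders m (K v) - K v)"
    unfolding Bad_def by (intro measure_Un_le sets.finite_UN sets.Diff V A Ks cylinders_sets)
  also have "prob (\<Union>v\<in>V. A v - K v) \<le> (\<Sum>v\<in>V. prob (A v - K v))"
    by (intro measure_UNION_le sets.Diff V A Ks cylinders_sets)
  also have "\<dots> \<le> real (card V) * \<eta>"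
    using K(3) by (intro sum_bounded_above less_imp_le)
  also have "prob (\<Union>v\<in>V. cylinders m (K v) - K v) \<le> (\<Sum>v\<in>V. prob (cylinders m (K v) - K v))"
    by (intro measure_UNION_le sets.Diff V A Ks cylinders_sets)
  also have "\<dots> \<le> real (card V) * \<eta>"
  proof (rule sum_bounded_above)
    fix v assume v: "v \<in> V"
    have "prob (K v - cylinders m (K v)) = prob {}"
    proof (rule finite_measure_eq_AE)
      show "AE x in M. x \<in> K v - cylinders m (K v) \<longleftrightarrow> x \<in> {}"
        using AE_frac by eventually_elim (auto simp: cylinders_def)
    qed (use Ks in auto)
    then have "prob (K v \<inter> cylinders m (K v)) = prob (K v)"
      using finite_measure_Diff'[OF Ks cylinders_sets, of v m "K v"] by simp
    then have "prob (cylinders m (K v) - K v) = prob (cylinders m (K v)) - prob (K v)"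
      using finite_measure_Diff'[OF cylinders_sets Ks, of m "K v" v] by (simp add: Int_commute)
    then show "prob (cylinders m (K v) - K v) \<le> \<eta>" using m[OF v] by simp
  qed
  finally have "prob Bad \<le> \<delta>" using cV by (simp add: \<eta>_def)
  then show ?thesis using that[of F m] F sub by (auto simp: V_def)
qed

text \<open>The conditional entropy of \<open>f\<close> given \<open>m\<close> digits tends to 0.
  One good \<open>m0\<close> suffices: the first \<open>m0\<close> digits are a function of the
  first \<open>m\<close>, and conditioning on more only helps.\<close>

lemma cond_entropy_digits_small:
  assumes f: "simple_function M f" and \<tau>: "\<tau> > 0"
  obtains m0 where "\<And>m. m \<ge> m0 \<Longrightarrow> rv_entropy M (\<lambda>x. (f x, digits m x)) \<le> H m + \<tau>"
proof -
  have fin: "finite (range f)" using simple_functionD(1)[OF f] by simp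
  obtain \<delta> where \<delta>: "\<delta> > 0"
    "\<And>f' g. simple_function M f' \<Longrightarrow> simple_function M g \<Longrightarrow> f' ` space M \<subseteq> range f \<Longrightarrow> g ` space M \<subseteq> range f \<Longrightarrow>
      prob {x\<in>space M. f' x \<noteq> g x} \<le> \<delta> \<Longrightarrow> rv_entropy M (\<lambda>x. (f' x, g x)) \<le> rv_entropy M g + \<tau>"
    by (rule rv_entropy_joint_close[OF fin \<tau>]) (rule that)
  obtain m0 F where F: "\<And>d. F d \<in> range f" "prob {x\<in>space M. f x \<noteq> F (digits m0 x)} \<le> \<delta>"
    by (rule simple_function_approx_digits[OF f \<delta>(1)]) (rule that)
  have close: "rv_entropy M (\<lambda>x. (f x, F (digits m0 x))) \<le> rv_entropy M (\<lambda>x. F (digits m0 x)) + \<tau>"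
    using F by (intro \<delta>(2) f) (auto simp: simple_function_compose1)
  show ?thesis
  proof (rule that)
    fix m assume "m \<ge> m0"
    then obtain k where m: "m = k + m0" by (metis le_add_diff_inverse2)
    have "rv_entropy M (\<lambda>x. (f x, digits m x)) + rv_entropy M (\<lambda>x. F (digits m x div p ^ k))
        \<le> rv_entropy M (\<lambda>x. (f x, F (digits m x div p ^ k))) + H m"
      using rv_entropy_cond_mono[OF f simple_digits, of m "\<lambda>d. F (d div p ^ k)"] .
    then show "rv_entropy M (\<lambda>x. (f x, digits m x)) \<le> H m + \<tau>"
      using close by (simp add: m digits_div [symmetric])
  qed
qed

subsection \<open>Residues of the past determined by the future\<close>

text \<open>\<open>shift k x\<close> is the future and the \<open>k\<close> digits before it the
  past. A fixed set \<open>C\<close> and a fixed value \<open>y\<close> make the notion independent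
  of any version of the conditional laws.\<close>

definition determined :: "nat \<Rightarrow> nat \<Rightarrow> nat \<Rightarrow> real set \<Rightarrow> bool" where
  "determined q k y C \<longleftrightarrow> (AE x in M. shift k x \<in> C \<longrightarrow> digits k x mod q ^ k = y)"

text \<open>Along \<open>m0 + i * k\<close> each step adds at most \<open>g - e\<close> to the
  entropy, whereas growth at rate \<open>h\<close> asks for \<open>k * h\<close> per step on
  average.\<close>

lemma entropy_rate_bound:
  assumes rate: "\<And>n. n > 0 \<Longrightarrow> H n \<ge> real n * h"
    and step: "\<And>m. m \<ge> m0 \<Longrightarrow> H (m + k) + e \<le> H m + g"
  shows "e \<le> g - real k * h"
proof (rule ccontr)
  assume neg: "\<not> e \<le> g - real k * h"
  define \<delta> where "\<delta> = e + real k * h - g"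
  have \<delta>: "\<delta> > 0" using neg by (simp add: \<delta>_def)
  have iter: "H (m0 + i * k) \<le> H m0 + real i * (g - e)" for i
  proof (induction i)
    case (Suc i)
    have "H (m0 + i * k + k) + e \<le> H (m0 + i * k) + g" by (rule step) simp
    then show ?case using Suc by (simp add: algebra_simps)
  qed simp
  obtain i :: nat where i: "real i * \<delta> > H m0 + \<bar>real m0 * h\<bar>"
    using reals_Archimedean3[OF \<delta>] by blast
  have "i > 0" 
  proof (rule ccontr)
    assume "\<not> i > 0"
    then have "H m0 + \<bar>real m0 * h\<bar> < 0" using i by simp
    then show False using H_nonneg[of m0] by linarith
  qed
  show False
  proof (cases "m0 + i * k = 0")
    case True
    then have "k = 0" "m0 = 0" using \<open>i > 0\<close> by auto
    then show False using step[of 0] neg by simp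
  next
    case False
    then have "real (m0 + i * k) * h \<le> H (m0 + i * k)" by (intro rate) simp
    also have "\<dots> \<le> H m0 + real i * (g - e)" by (rule iter)
    also have "\<dots> = H m0 - real i * \<delta> + real i * (real k * h)"
      by (simp add: \<delta>_def algebra_simps)
    finally have "real m0 * h + real i * \<delta> \<le> H m0" by (simp add: algebra_simps)
    then show False using i by linarith
  qed
qed

text \<open>A function of the first \<open>k\<close> digits that is also a function of the tail carries at most the mutual
  information of past and future, which is \<open>H k - k h\<close>.\<close>

lemma determined_entropy_le:
  assumes rate: "\<And>n. n > 0 \<Longrightarrow> H n \<ge> real n * h"
    and Y: "simple_function M Y" and ae: "AE x in M. R (digits k x) = Y (shift k x)"
  shows "rv_entropy M (\<lambda>x. R (digits k x)) \<le> H k - real k * h"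
proof (rule field_le_epsilon)
  fix \<tau> :: real assume \<tau>: "\<tau> > 0"
  obtain m0 where m0: "\<And>m. m \<ge> m0 \<Longrightarrow> rv_entropy M (\<lambda>x. (Y x, digits m x)) \<le> H m + \<tau>"
    by (rule cond_entropy_digits_small[OF Y \<tau>]) (rule that)
  let ?R = "\<lambda>x. R (digits k x)"
  have sR: "simple_function M ?R" by (simp add: simple_function_compose1)
  have "rv_entropy M ?R \<le> (H k + \<tau>) - real k * h"
  proof (rule entropy_rate_bound[OF rate])
    fix m assume "m \<ge> m0"
    let ?F = "\<lambda>x. digits m (shift k x)"
    \<comment> \<open>Given the residue, the past block adds at most
      \<open>H k - rv_entropy M ?R\<close>. The residue itself is a function of the future, so
      beyond \<open>m\<close> digits of the future it costs at most \<open>\<tau>\<close>.\<close>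
    have "rv_entropy M (\<lambda>x. (?F x, digits k x)) + rv_entropy M ?R
        \<le> rv_entropy M (\<lambda>x. (?F x, ?R x)) + H k"
      by (rule rv_entropy_cond_mono[where F = R]) auto
    also have "rv_entropy M (\<lambda>x. (?F x, ?R x)) \<le> rv_entropy M (\<lambda>x. (?R x, ?F x))"
      using rv_entropy_compose_le[of "\<lambda>x. (?R x, ?F x)" "\<lambda>(a, b). (b, a)"] sR by simp
    also have "\<dots> = rv_entropy M (\<lambda>x. (Y (shift k x), ?F x))"
      by (rule rv_entropy_AE_cong) (use sR Y ae in auto)
    also have "\<dots> = rv_entropy M (\<lambda>x. (Y x, digits m x))"
      using rv_entropy_shift[of "\<lambda>x. (Y x, digits m x)" k] Y by simp
    also have "\<dots> \<le> H m + \<tau>" by (rule m0) fact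
    also have "H (m + k) \<le> rv_entropy M (\<lambda>x. (?F x, digits k x))"
      using rv_entropy_compose_le[of "\<lambda>x. (?F x, digits k x)" "\<lambda>(b, a). p ^ m * a + b"]
      by (simp add: digits_add [abs_def])
    ultimately show "H (m + k) + rv_entropy M ?R \<le> H m + (H k + \<tau>)" by linarith
  qed auto
  then show "rv_entropy M ?R \<le> H k - real k * h + \<tau>" by simp
qed

text \<open>Since \<open>q ^ k\<close> divides \<open>p ^ k\<close>, knowing the leading part modulo
  \<open>q ^ ((p - 1) * k)\<close> determines its contribution modulo \<open>q ^ (p * k)\<close>.
  Subtraction leaves the last block modulo \<open>q ^ (p * k)\<close>, hence exactly, because
  \<open>p \<le> 2 ^ p \<le> q ^ p\<close>. This inequality is the origin of the multiple
  \<open>p\<close>.\<close>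

lemma digits_from_residues:
  assumes q: "q \<ge> 2" "q dvd p"
  shows "int (digits k (shift ((p - 1) * k) x))
    = (int (digits (p * k) x mod q ^ (p * k)) - int p ^ k * int (digits ((p - 1) * k) x mod q ^ ((p - 1) * k)))
        mod int q ^ (p * k)"
proof -
  define a where "a = digits ((p - 1) * k) x"
  define d where "d = digits k (shift ((p - 1) * k) x)"
  have pk: "p * k = k + (p - 1) * k" using p_gt_1 by (cases p) auto
  have D: "digits (p * k) x = p ^ k * a + d"
    unfolding pk digits_add a_def d_def ..
  have "int (digits (p * k) x mod q ^ (p * k)) = int (digits (p * k) x) mod int q ^ (p * k)"
    by (simp add: zmod_int)
  moreover have "[int p ^ k * int (a mod q ^ ((p - 1) * k)) = int p ^ k * int a] (mod int q ^ (p * k))"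
  proof -
    have "[int (a mod q ^ ((p - 1) * k)) = int a] (mod int q ^ ((p - 1) * k))"
      by (simp add: zmod_int cong_def)
    then have "int q ^ ((p - 1) * k) dvd int a - int (a mod q ^ ((p - 1) * k))"
      by (metis cong_iff_dvd_diff cong_sym)
    then have "int q ^ k * int q ^ ((p - 1) * k) dvd int p ^ k * (int a - int (a mod q ^ ((p - 1) * k)))"
      using q by (intro mult_dvd_mono dvd_power_same) auto
    then have "int q ^ (p * k) dvd int p ^ k * int a - int p ^ k * int (a mod q ^ ((p - 1) * k))"
      unfolding pk power_add by (simp only: right_diff_distrib)
    then show ?thesis by (metis cong_iff_dvd_diff cong_sym)
  qed
  ultimately have "[int (digits (p * k) x mod q ^ (p * k)) - int p ^ k * int (a mod q ^ ((p - 1) * k))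
      = int (digits (p * k) x) - int p ^ k * int a] (mod int q ^ (p * k))"
    by (intro cong_diff) (simp_all add: cong_def)
  moreover have "int (digits (p * k) x) - int p ^ k * int a = int d"
    by (simp add: D)
  moreover have "int d < int q ^ (p * k)"
  proof -
    have "p \<le> 2 ^ p" using less_exp[of p] by simp
    also have "\<dots> \<le> q ^ p" using q by (intro power_mono) auto
    finally have "p ^ k \<le> (q ^ p) ^ k" by (intro power_mono) auto
    then have "d < q ^ (p * k)" using digits_less[of k] by (simp add: d_def power_mult) (metis order_less_le_trans)
    then show ?thesis by (metis of_nat_less_iff of_nat_power)
  qed
  ultimately show ?thesis unfolding a_def [symmetric] d_def [symmetric] by (simp add: cong_def)
qed

text \<open>Choose \<open>k\<close> with \<open>H k\<close> at most \<open>k * (h + \<eta>)\<close>.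
  By subadditivity the residue of a block of length \<open>c' * k\<close> has entropy at most
  \<open>c' * k * \<eta>\<close>. Recovering \<open>k\<close> digits from the residues for
  \<open>c' = p\<close> and \<open>c' = p - 1\<close> gives
  \<open>H k \<le> (2 * p - 1) * k * \<eta> < k * h\<close>, which dictates
  \<open>\<eta> = h / (2 * p)\<close>.\<close>

lemma not_all_digits_determined:
  assumes q: "q \<ge> 2" "q dvd p" and c: "c > 0" "\<And>n. H n \<ge> c * real n"
    and det: "\<And>k. \<exists>Y. simple_function M Y \<and> (AE x in M. digits k x mod q ^ k = Y (shift k x))"
  shows False
proof -
  define h where "h = (INF n\<in>{1..}. H n / real n)"
  have bdd: "bdd_below ((\<lambda>n. H n / real n) ` {1..})"
    by (rule bdd_belowI2[where m = 0]) (simp add: H_nonneg)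
  have rate: "H n \<ge> real n * h" if "n > 0" for n
  proof -
    have "h \<le> H n / real n" unfolding h_def by (rule cINF_lower[OF bdd]) (use that in auto)
    then show ?thesis using that by (simp add: field_simps)
  qed
  have "h \<ge> c"
    unfolding h_def
  proof (rule cINF_greatest)
    fix n :: nat assume "n \<in> {1..}"
    then show "c \<le> H n / real n" using c(2)[of n] by (simp add: field_simps)
  qed simp
  then have h: "h > 0" using c by simp
  define \<eta> where "\<eta> = h / (2 * real p)"
  have \<eta>: "\<eta> > 0" using h p_gt_1 by (simp add: \<eta>_def)
  then have "\<exists>n\<in>{1..}. H n / real n < h + \<eta>"
    using cINF_less_iff[of "{1..}" "\<lambda>n. H n / real n" "h + \<eta>"] bdd by (auto simp: h_def)
  then obtain k where "k \<in> {1..}" "H k / real k < h + \<eta>" by blast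
  then have k: "k > 0" "H k \<le> real k * (h + \<eta>)" by (auto simp: field_simps)
  define R where "R j x = digits j x mod q ^ j" for j x
  have R: "rv_entropy M (R (c' * k)) \<le> real c' * real k * \<eta>" for c'
  proof -
    obtain Y where Y: "simple_function M Y" "AE x in M. digits (c' * k) x mod q ^ (c' * k) = Y (shift (c' * k) x)"
      using det by blast
    have "rv_entropy M (R (c' * k)) \<le> H (c' * k) - real (c' * k) * h"
      unfolding R_def [abs_def]
      by (rule determined_entropy_le[OF rate Y(1), where R = "\<lambda>d. d mod q ^ (c' * k)"]) (use Y(2) in auto)
    also have "H (c' * k) \<le> real c' * H k" by (rule H_mult)
    also have "real c' * H k \<le> real c' * (real k * (h + \<eta>))" by (intro mult_left_mono k) auto
    finally show ?thesis by (simp add: algebra_simps)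
  qed
  have sR: "simple_function M (R j)" for j
    unfolding R_def [abs_def] by (rule simple_function_compose1) simp
  have "H k = rv_entropy M (\<lambda>x. digits k (shift ((p - 1) * k) x))"
    by (rule rv_entropy_shift [symmetric]) simp
  also have "\<dots> = rv_entropy M (\<lambda>x. (\<lambda>(a, b). nat ((int a - int p ^ k * int b) mod int q ^ (p * k)))
       (R (p * k) x, R ((p - 1) * k) x))"
    using digits_from_residues[OF q, of k] by (simp add: R_def) (metis nat_int)
  also have "\<dots> \<le> rv_entropy M (\<lambda>x. (R (p * k) x, R ((p - 1) * k) x))"
    by (rule rv_entropy_compose_le) (simp add: sR)
  also have "\<dots> \<le> rv_entropy M (R (p * k)) + rv_entropy M (R ((p - 1) * k))"
    by (intro rv_entropy_subadditive sR)
  also have "\<dots> \<le> real p * real k * \<eta> + real (p - 1) * real k * \<eta>"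
    by (intro add_mono R)
  also have "\<dots> = real k * (real p + real (p - 1)) * \<eta>" by (simp add: algebra_simps)
  also have "\<dots> < real k * (2 * real p) * \<eta>"
    using k \<eta> p_gt_1 by (intro mult_strict_right_mono mult_strict_left_mono) auto
  also have "\<dots> = real k * h" using p_gt_1 by (simp add: \<eta>_def)
  also have "\<dots> \<le> H k" using rate k by simp
  finally show False by simp
qed

subsection \<open>Conditional laws of the past\<close>

lemma shift_vimage_sets: "A \<in> sets borel \<Longrightarrow> shift g -` A \<in> sets M"
  using measurable_sets[OF shift_measurable, of A g] by (simp add: sets_M)

lemma expand_digits:
  assumes "frac x = x"
  shows "x = (real (digits g x) + shift g x) / real (p ^ g)"
proof -
  have "0 \<le> x" using assms frac_ge_0[of x] by simp
  then have "real (digits g x) = of_int \<lfloor>real p ^ g * x\<rfloor>"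
    by (simp add: digits_def assms)
  then show ?thesis using p_gt_1 by (simp add: shift_def frac_def)
qed

text \<open>\<open>P a\<close> is the Radon-Nikodym density of the law of the future on the event
  that the past block is \<open>a\<close>. These laws add up to \<open>M\<close> by invariance, so
  they are absolutely continuous and the densities add up to 1 almost everywhere.\<close>

lemma branch_kernel_exists:
  obtains P where "branch_kernel M (p ^ g) P"
    "\<And>a A. a < p ^ g \<Longrightarrow> A \<in> sets borel \<Longrightarrow>
      (\<integral>\<^sup>+z\<in>A. ennreal (P a z) \<partial>M) = emeasure M {x. digits g x = a \<and> shift g x \<in> A}"
proof -
  define b where "b = p ^ g"
  have b: "b > 0" using p_gt_1 by (simp add: b_def)
  define w where "w a x = (indicator {x. digits g x = a} x :: real)" for a x
  have w [measurable]: "w a \<in> borel_measurable borel" for a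
    unfolding w_def by measurable
  define \<nu> where "\<nu> a = distr (density M (\<lambda>x. ennreal (w a x))) borel (shift g)" for a
  have \<nu>: "emeasure (\<nu> a) A = emeasure M {x. digits g x = a \<and> shift g x \<in> A}" if [measurable]: "A \<in> sets borel" for a A
  proof -
    have "emeasure (\<nu> a) A = emeasure (density M (\<lambda>x. ennreal (w a x))) (shift g -` A)"
      unfolding \<nu>_def by (subst emeasure_distr) auto
    also have "\<dots> = (\<integral>\<^sup>+x. ennreal (w a x) * indicator (shift g -` A) x \<partial>M)"
      by (rule emeasure_density) (use shift_vimage_sets[OF that] in auto)
    also have "\<dots> = (\<integral>\<^sup>+x. indicator {x. digits g x = a \<and> shift g x \<in> A} x \<partial>M)"
      by (intro nn_integral_cong) (auto simp: w_def indicator_def)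
    also have "\<dots> = emeasure M {x. digits g x = a \<and> shift g x \<in> A}"
      by (rule nn_integral_indicator) (simp add: sets_M)
    finally show ?thesis .
  qed
  have ac: "absolutely_continuous M (\<nu> a)" for a
    unfolding absolutely_continuous_def
  proof
    fix A assume A: "A \<in> null_sets M"
    then have Ab [measurable]: "A \<in> sets borel" by (auto simp: sets_M [symmetric])
    have "emeasure (\<nu> a) A \<le> emeasure M (shift g -` A \<inter> space M)"
      unfolding \<nu>[OF Ab] by (intro emeasure_mono) (auto simp: shift_vimage_sets[OF Ab])
    also have "\<dots> = emeasure (distr M borel (shift g)) A" by (subst emeasure_distr) auto
    also have "\<dots> = 0" using A by (simp add: distr_shift null_sets_def)
    finally show "A \<in> null_sets (\<nu> a)" by (simp add: null_sets_def \<nu>_def)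
  qed
  define Q where "Q a = RN_deriv M (\<nu> a)" for a
  have Q [measurable]: "Q a \<in> borel_measurable borel" for a
    using borel_measurable_RN_deriv[of M "\<nu> a"] by (simp add: Q_def measurable_cong_sets[OF sets_M refl])
  have dQ: "density M (Q a) = \<nu> a" for a
    unfolding Q_def by (rule density_RN_deriv[OF ac]) (simp add: \<nu>_def sets_M)
  have sumQ: "AE z in M. (\<Sum>a<b. Q a z) = 1"
  proof (rule density_unique)
    show "density M (\<lambda>z. \<Sum>a<b. Q a z) = density M (\<lambda>_. 1)"
    proof (rule measure_eqI)
      fix A assume "A \<in> sets (density M (\<lambda>z. \<Sum>a<b. Q a z))"
      then have A [measurable]: "A \<in> sets borel" by (simp add: sets_M)
      have "emeasure (density M (\<lambda>z. \<Sum>a<b. Q a z)) A = (\<integral>\<^sup>+z. (\<Sum>a<b. Q a z) * indicator A z \<partial>M)"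
        by (rule emeasure_density) (auto simp: sets_M)
      also have "\<dots> = (\<Sum>a<b. \<integral>\<^sup>+z. Q a z * indicator A z \<partial>M)"
        unfolding sum_distrib_right by (rule nn_integral_sum) measurable
      also have "\<dots> = (\<Sum>a<b. emeasure (density M (Q a)) A)"
        by (intro sum.cong refl emeasure_density [symmetric]) (auto simp: sets_M)
      also have "\<dots> = (\<Sum>a<b. emeasure M {x. digits g x = a \<and> shift g x \<in> A})"
        by (simp add: dQ \<nu>)
      also have "\<dots> = emeasure M (\<Union>a<b. {x. digits g x = a \<and> shift g x \<in> A})"
        by (intro sum_emeasure) (auto simp: sets_M disjoint_family_on_def)
      also have "(\<Union>a<b. {x. digits g x = a \<and> shift g x \<in> A}) = shift g -` A \<inter> space M"
        using digits_less by (auto simp: b_def)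
      also have "emeasure M \<dots> = emeasure (distr M borel (shift g)) A" by (subst emeasure_distr) auto
      also have "\<dots> = emeasure (density M (\<lambda>_. 1)) A" by (simp add: distr_shift density_1)
      finally show "emeasure (density M (\<lambda>z. \<Sum>a<b. Q a z)) A = emeasure (density M (\<lambda>_. 1)) A" .
    qed simp
  qed measurable
  \<comment> \<open>On the null set where the densities do not sum to 1, branch 0 gets all the
    weight, so that the sum is 1 everywhere.\<close>
  define P where "P a z = (if (\<Sum>a<b. Q a z) = 1 then enn2real (Q a z) else if a = 0 then 1 else 0)" for a z
  have P [measurable]: "P a \<in> borel_measurable borel" for a
    unfolding P_def by measurable
  have fin: "Q a z < \<top>" if "(\<Sum>a<b. Q a z) = 1" "a < b" for a z
  proof -
    have "Q a z \<le> (\<Sum>a<b. Q a z)" using that by (intro member_le_sum) auto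
    then have "Q a z \<le> 1" using that by simp
    then show ?thesis using ennreal_one_less_top by (rule le_less_trans)
  qed
  have PQ: "AE z in M. ennreal (P a z) = Q a z" if "a < b" for a
    using sumQ by eventually_elim (use fin that in \<open>auto simp: P_def\<close>)
  have dP: "density M (\<lambda>z. ennreal (P a z)) = \<nu> a" if "a < b" for a
    unfolding dQ [symmetric] by (rule density_cong) (use PQ[OF that] in auto)
  have P_sum: "(\<Sum>a<b. P a z) = 1" for z
  proof (cases "(\<Sum>a<b. Q a z) = 1")
    case True
    have "ennreal (\<Sum>a<b. enn2real (Q a z)) = (\<Sum>a<b. ennreal (enn2real (Q a z)))"
      by (subst sum_ennreal) auto
    also have "\<dots> = (\<Sum>a<b. Q a z)" using fin[OF True] by (intro sum.cong) auto
    finally show ?thesis using True by (simp add: P_def sum_nonneg)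
  next
    case False
    then show ?thesis using b by (simp add: P_def)
  qed
  have "branch_kernel M b P"
  proof (unfold_locales)
    show "b > 0" "sets M = sets borel" by (fact b sets_M)+
    show "P a \<in> borel_measurable borel" for a by (fact P)
    show "P a z \<ge> 0" for a z by (simp add: P_def)
    show "(\<Sum>a<b. P a z) = 1" for z by (fact P_sum)
    fix f :: "real \<Rightarrow> complex" assume f [measurable]: "f \<in> borel_measurable borel" and bd: "\<And>x. norm (f x) \<le> 1"
    have intb: "integrable M h" if "h \<in> borel_measurable borel" "\<And>x. norm (h x) \<le> 1" for h :: "real \<Rightarrow> complex"
      by (rule integrable_const_bound[where B = 1]) (use that in \<open>auto simp: measurable_cong_sets[OF sets_M refl]\<close>)
    have P1: "P a z \<le> 1" if "a < b" for a z
      using member_le_sum[of a "{..<b}" "\<lambda>a. P a z"] that P_sum by (auto simp: P_def)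
    have each: "(\<integral>x. w a x *\<^sub>R f x \<partial>M) = (\<integral>z. of_real (P a z) * f ((real a + z) / real b) \<partial>M)" if a: "a < b" for a
    proof -
      have "(\<integral>x. w a x *\<^sub>R f x \<partial>M) = (\<integral>x. w a x *\<^sub>R f ((real a + shift g x) / real b) \<partial>M)"
      proof (rule integral_cong_AE)
        show "AE x in M. w a x *\<^sub>R f x = w a x *\<^sub>R f ((real a + shift g x) / real b)"
          using AE_frac
        proof eventually_elim
          case (elim x)
          show ?case using expand_digits[OF elim, of g] by (auto simp: w_def indicator_def b_def)
        qed
      qed measurable
      also have "\<dots> = (\<integral>x. f ((real a + shift g x) / real b) \<partial>density M (\<lambda>x. ennreal (w a x)))"
        by (rule integral_density [symmetric]) (auto simp: w_def)
      also have "\<dots> = (\<integral>z. f ((real a + z) / real b) \<partial>\<nu> a)"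
        unfolding \<nu>_def by (rule integral_distr [symmetric]) measurable
      also have "\<dots> = (\<integral>z. f ((real a + z) / real b) \<partial>density M (\<lambda>z. ennreal (P a z)))"
        by (simp add: dP[OF a])
      also have "\<dots> = (\<integral>z. P a z *\<^sub>R f ((real a + z) / real b) \<partial>M)"
        by (rule integral_density) (auto simp: P_def)
      finally show ?thesis by (simp add: scaleR_conv_of_real)
    qed
    have "f x = (\<Sum>a<b. w a x *\<^sub>R f x)" for x
    proof -
      have "(\<Sum>a<b. w a x *\<^sub>R f x) = (\<Sum>a<b. w a x) *\<^sub>R f x" by (simp add: scaleR_sum_left)
      also have "(\<Sum>a<b. w a x) = 1"
        using digits_less[of g x] by (simp add: w_def indicator_def b_def of_bool_def sum.delta)
      finally show ?thesis by simp
    qed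
    then have "(\<integral>x. f x \<partial>M) = (\<integral>x. (\<Sum>a<b. w a x *\<^sub>R f x) \<partial>M)" by simp
    also have "\<dots> = (\<Sum>a<b. \<integral>x. w a x *\<^sub>R f x \<partial>M)"
      by (intro Bochner_Integration.integral_sum intb) (auto simp: w_def indicator_def bd)
    also have "\<dots> = (\<Sum>a<b. \<integral>z. of_real (P a z) * f ((real a + z) / real b) \<partial>M)"
      using each by simp
    also have "\<dots> = (\<integral>z. (\<Sum>a<b. of_real (P a z) * f ((real a + z) / real b)) \<partial>M)"
    proof (intro Bochner_Integration.integral_sum [symmetric] intb)
      fix a x assume "a \<in> {..<b}"
      then have "norm (of_real (P a x) * f ((real a + x) / real b)) \<le> 1 * 1"
        unfolding norm_mult using P1 bd by (intro mult_mono) (auto simp: P_def)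
      then show "norm (of_real (P a x) * f ((real a + x) / real b)) \<le> 1" by simp
    qed measurable
    finally show "(\<integral>x. f x \<partial>M) = (\<integral>z. (\<Sum>a<b. of_real (P a z) * f ((real a + z) / real b)) \<partial>M)" .
  qed
  moreover have "(\<integral>\<^sup>+z\<in>A. ennreal (P a z) \<partial>M) = emeasure M {x. digits g x = a \<and> shift g x \<in> A}"
    if "a < b" and A: "A \<in> sets borel" for a A
  proof -
    have "(\<integral>\<^sup>+z\<in>A. ennreal (P a z) \<partial>M) = emeasure (density M (\<lambda>z. ennreal (P a z))) A"
      using A by (intro emeasure_density [symmetric]) (auto simp: sets_M)
    then show ?thesis using dP[OF that(1)] \<nu>[OF A] by simp
  qed
  ultimately show ?thesis using that[of P] by (simp add: b_def)
qed

end

section \<open>Residues modulo powers of the prime divisors of \<open>p\<close>\<close>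

lemma prime_power_cancel:
  fixes p q :: nat
  assumes q: "prime q" and p: "p > 0"
  obtains e where "\<And>k d d'. [p * d = p * d'] (mod q ^ (k + e)) \<Longrightarrow> [d = d'] (mod q ^ k)"
proof -
  \<comment> \<open>Cancelling \<open>p\<close> loses exactly its \<open>q\<close>-part
    \<open>q ^ e\<close>; the cofactor is invertible modulo powers of \<open>q\<close>.\<close>
  define e where "e = multiplicity q p"
  obtain r where r: "p = q ^ e * r" "\<not> q dvd r"
    using multiplicity_decompose'[of p q] p prime_gt_1_nat[OF q]
    by (metis e_def mult.commute nat_neq_iff not_prime_unit q)
  have cop: "coprime r (q ^ k)" for k
    using r(2) q by (simp add: prime_imp_coprime coprime_commute)
  show ?thesis
  proof (rule that)
    fix k d d' assume "[p * d = p * d'] (mod q ^ (k + e))"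
    then have "[q ^ e * (r * d) = q ^ e * (r * d')] (mod q ^ e * q ^ k)"
      by (simp add: r(1) power_add mult_ac)
    then have "[r * d = r * d'] (mod q ^ k)"
      using prime_gt_0_nat[OF q] by (simp add: cong_def mod_mult_mult1)
    then show "[d = d'] (mod q ^ k)" using cop cong_mult_lcancel_nat by blast
  qed
qed

text \<open>Let \<open>e \<ge> 1\<close> be the multiplicity of \<open>q\<close> in
  \<open>p\<close>. Two elements of \<open>K\<close> distinct modulo \<open>q ^ k\<close> have a
  difference of \<open>q\<close>-multiplicity below \<open>k\<close>, so an annihilating
  \<open>\<tau>\<close> has multiplicity at least \<open>g * e - k\<close>, which is at least
  \<open>(g - k) * e\<close> up to the loss \<open>k \<le> k * e\<close>. Over all \<open>q\<close>
  this makes \<open>p ^ (g - k)\<close> divide \<open>\<tau>\<close>, with only \<open>p ^ k\<close>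
  multiples below \<open>p ^ g\<close>.\<close>

lemma card_annihilator_le:
  fixes p :: nat
  assumes p: "p > 1" and g: "k \<le> g"
    and sep: "\<And>q. prime q \<Longrightarrow> q dvd p \<Longrightarrow> \<exists>a\<in>K. \<exists>a'\<in>K. a mod q ^ k \<noteq> a' mod q ^ k"
  shows "card (annihilator (p ^ g) K) \<le> p ^ k"
proof -
  have div: "p ^ (g - k) dvd \<tau>" if \<tau>: "\<tau> \<in> annihilator (p ^ g) K" for \<tau>
  proof (cases "\<tau> = 0")
    case False
    show ?thesis
    proof (rule multiplicity_le_imp_dvd)
      fix q :: nat assume q: "prime q"
      show "multiplicity q (p ^ (g - k)) \<le> multiplicity q \<tau>"
      proof (cases "q dvd p")
        case True
        define e where "e = multiplicity q p"
        have e: "e \<ge> 1" using True p q unfolding e_def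
          by (metis One_nat_def Suc_leI multiplicity_gt_zero_iff not_prime_unit less_imp_neq less_one less_trans)
        obtain a a' where a: "a \<in> K" "a' \<in> K" "a mod q ^ k \<noteq> a' mod q ^ k" using sep[OF q True] by blast
        define D where "D = nat \<bar>int a - int a'\<bar>"
        have nd: "\<not> q ^ k dvd D"
        proof
          assume "q ^ k dvd D"
          then have "int (q ^ k) dvd int a - int a'" by (simp add: D_def)
          then have "[int a = int a'] (mod int (q ^ k))" by (simp add: cong_iff_dvd_diff)
          then show False using a(3) by (simp only: cong_int_iff) (simp add: cong_def)
        qed
        have D0: "D \<noteq> 0" using nd dvd_0_right by metis
        have mD: "multiplicity q D < k"
          using nd D0 q by (metis multiplicity_dvd' not_less)
        have "int (p ^ g) dvd (int a - int a') * int \<tau>" using \<tau> a by (simp add: annihilator_def)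
        then have "int (p ^ g) dvd \<bar>(int a - int a') * int \<tau>\<bar>" by simp
        then have "int (p ^ g) dvd int (D * \<tau>)" by (simp add: D_def abs_mult)
        then have "p ^ g dvd D * \<tau>" by (simp only: int_dvd_int_iff)
        then have "multiplicity q (p ^ g) \<le> multiplicity q (D * \<tau>)"
          using D0 False by (intro dvd_imp_multiplicity_le) auto
        then have "g * e \<le> multiplicity q D + multiplicity q \<tau>"
          using q D0 False p by (simp add: prime_elem_multiplicity_mult_distrib prime_elem_multiplicity_power_distrib e_def)
        moreover have "multiplicity q (p ^ (g - k)) = (g - k) * e"
          using q p by (simp add: prime_elem_multiplicity_power_distrib e_def)
        moreover have "(g - k) * e + k \<le> g * e"
        proof -
          have "(g - k) * e + k \<le> (g - k) * e + k * e" using e by simp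
          also have "\<dots> = g * e" using g by (simp add: add_mult_distrib [symmetric])
          finally show ?thesis .
        qed
        ultimately show ?thesis using mD by linarith
      next
        case False
        then have "\<not> q dvd p ^ (g - k)" using q prime_dvd_power by blast
        then show ?thesis by (simp add: not_dvd_imp_multiplicity_0)
      qed
    qed (use p in auto)
  qed simp
  have "annihilator (p ^ g) K \<subseteq> (\<lambda>i. p ^ (g - k) * i) ` {..<p ^ k}"
  proof
    fix \<tau> assume \<tau>: "\<tau> \<in> annihilator (p ^ g) K"
    then obtain i where i: "\<tau> = p ^ (g - k) * i" using div by blast
    have "\<tau> < p ^ g" using \<tau> by (simp add: annihilator_def)
    also have "p ^ g = p ^ (g - k) * p ^ k" using g by (simp add: power_add [symmetric])
    finally have "i < p ^ k" using i p by simp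
    then show "\<tau> \<in> (\<lambda>i. p ^ (g - k) * i) ` {..<p ^ k}" using i by blast
  qed
  then show ?thesis by (metis surj_card_le card_lessThan finite_lessThan)
qed

section \<open>Futures that determine a residue of the past\<close>

context times_invariant
begin

definition kernel_of :: "nat \<Rightarrow> (nat \<Rightarrow> real \<Rightarrow> real) \<Rightarrow> bool" where
  "kernel_of g P \<longleftrightarrow> branch_kernel M (p ^ g) P \<and>
    (\<forall>a A. a < p ^ g \<longrightarrow> A \<in> sets borel \<longrightarrow>
      (\<integral>\<^sup>+z\<in>A. ennreal (P a z) \<partial>M) = emeasure M {x. digits g x = a \<and> shift g x \<in> A})"

definition residue_prob :: "nat \<Rightarrow> (nat \<Rightarrow> real \<Rightarrow> real) \<Rightarrow> nat \<Rightarrow> nat \<Rightarrow> real \<Rightarrow> real" where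
  "residue_prob g P n y z = (\<Sum>a\<in>{a. a < p ^ g \<and> a mod n = y}. P a z)"

lemma kernelD:
  assumes "kernel_of g P"
  shows "P a \<in> borel_measurable borel" "P a z \<ge> 0" "(\<Sum>a<p ^ g. P a z) = 1"
  using assms branch_kernel.P_measurable branch_kernel.P_nonneg branch_kernel.P_sum
  unfolding kernel_of_def by blast+

lemma residue_prob_measurable:
  "kernel_of g P \<Longrightarrow> residue_prob g P n y \<in> borel_measurable borel"
  unfolding residue_prob_def using kernelD(1) by (intro borel_measurable_sum) auto

text \<open>As \<open>q ^ k\<close> divides \<open>p ^ k\<close>, only the last \<open>k\<close> of
  \<open>g\<close> digits matter modulo \<open>q ^ k\<close>, and invariance lets the digits before
  them be skipped. Hence kernels of every block length \<open>g \<ge> k\<close> detect the same sets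
  \<open>C\<close>.\<close>

lemma determined_iff_shift:
  assumes C [measurable]: "C \<in> sets borel" and q: "q dvd p" and g: "k \<le> g"
  shows "determined q k y C \<longleftrightarrow> (AE x in M. shift g x \<in> C \<longrightarrow> digits g x mod q ^ k = y)"
proof -
  have dig: "digits g x mod q ^ k = digits k (shift (g - k) x) mod q ^ k" for x
  proof -
    have "q ^ k dvd p ^ k" using q by (rule dvd_power_same)
    moreover have "digits g x = p ^ k * digits (g - k) x + digits k (shift (g - k) x)"
      using digits_add[of k "g - k" x] g by simp
    ultimately show ?thesis by (auto simp: elim!: dvdE) (simp add: mult.assoc)
  qed
  have sh: "shift g x = shift k (shift (g - k) x)" for x
    using g by (simp add: shift_shift)
  have "determined q k y C \<longleftrightarrow> (AE x in M. shift k (shift (g - k) x) \<in> C \<longrightarrow> digits k (shift (g - k) x) mod q ^ k = y)"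
    unfolding determined_def by (rule AE_shift_iff [symmetric]) measurable
  then show ?thesis by (simp add: dig sh)
qed

text \<open>Both sides say that almost everywhere on \<open>C\<close> each block outside the class
  of \<open>y\<close> has conditional probability 0.\<close>

lemma determined_iff_kernel:
  assumes C [measurable]: "C \<in> sets borel" and q: "q dvd p" and g: "k \<le> g" and P: "kernel_of g P"
  shows "determined q k y C \<longleftrightarrow> (AE z in M. z \<in> C \<longrightarrow> residue_prob g P (q ^ k) y z \<ge> 1)"
proof -
  note [measurable] = kernelD(1)[OF P]
  let ?B = "{a. a < p ^ g \<and> a mod q ^ k \<noteq> y}"
  have fin: "finite ?B" by simp
  have single: "(AE x in M. \<not> (digits g x = a \<and> shift g x \<in> C)) \<longleftrightarrow> (AE z in M. z \<in> C \<longrightarrow> P a z = 0)"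
    if a: "a < p ^ g" for a
  proof -
    have "(AE x in M. \<not> (digits g x = a \<and> shift g x \<in> C)) \<longleftrightarrow> emeasure M {x. digits g x = a \<and> shift g x \<in> C} = 0"
      by (subst AE_iff_measurable[OF _ refl]) (auto simp: sets_M)
    also have "\<dots> \<longleftrightarrow> (\<integral>\<^sup>+z\<in>C. ennreal (P a z) \<partial>M) = 0"
      using P a C by (simp add: kernel_of_def)
    also have "\<dots> \<longleftrightarrow> (AE z in M. ennreal (P a z) * indicator C z = 0)"
      by (rule nn_integral_0_iff_AE) measurable
    also have "\<dots> \<longleftrightarrow> (AE z in M. z \<in> C \<longrightarrow> P a z = 0)"
      using kernelD(2)[OF P, of a] by (intro AE_cong) (auto simp: indicator_def order_antisym)
    finally show ?thesis .
  qed
  have "determined q k y C \<longleftrightarrow> (AE x in M. \<forall>a\<in>?B. \<not> (digits g x = a \<and> shift g x \<in> C))"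
    unfolding determined_iff_shift[OF C q g] using digits_less by (intro AE_cong) blast
  also have "\<dots> \<longleftrightarrow> (\<forall>a\<in>?B. AE x in M. \<not> (digits g x = a \<and> shift g x \<in> C))"
    by (rule AE_finite_all[OF fin])
  also have "\<dots> \<longleftrightarrow> (\<forall>a\<in>?B. AE z in M. z \<in> C \<longrightarrow> P a z = 0)"
    using single by auto
  also have "\<dots> \<longleftrightarrow> (AE z in M. \<forall>a\<in>?B. z \<in> C \<longrightarrow> P a z = 0)"
    by (rule AE_finite_all[OF fin, symmetric])
  also have "\<dots> \<longleftrightarrow> (AE z in M. z \<in> C \<longrightarrow> residue_prob g P (q ^ k) y z \<ge> 1)"
  proof (rule AE_cong)
    fix z
    have "1 = residue_prob g P (q ^ k) y z + (\<Sum>a\<in>?B. P a z)"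
    proof -
      have "(\<Sum>a<p ^ g. P a z) = residue_prob g P (q ^ k) y z + (\<Sum>a\<in>?B. P a z)"
        unfolding residue_prob_def by (subst sum.union_disjoint [symmetric]) (auto intro!: sum.cong)
      then show ?thesis using kernelD(3)[OF P] by simp
    qed
    moreover have "(\<Sum>a\<in>?B. P a z) \<le> 0 \<longleftrightarrow> (\<forall>a\<in>?B. P a z = 0)"
      using sum_nonneg_eq_0_iff[OF fin, of "\<lambda>a. P a z"] kernelD(2)[OF P] sum_nonneg[of ?B "\<lambda>a. P a z"]
      by (auto simp: order_antisym_conv)
    ultimately show "(\<forall>a\<in>?B. z \<in> C \<longrightarrow> P a z = 0) \<longleftrightarrow> (z \<in> C \<longrightarrow> residue_prob g P (q ^ k) y z \<ge> 1)"
      by auto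
  qed
  finally show ?thesis .
qed

definition kern :: "nat \<Rightarrow> nat \<Rightarrow> real \<Rightarrow> real" where
  "kern k = (SOME P. kernel_of k P)"

lemma kern: "kernel_of k (kern k)"
proof -
  obtain P where "kernel_of k P"
    by (rule branch_kernel_exists[of k]) (auto simp: kernel_of_def)
  then show ?thesis unfolding kern_def by (rule someI[of "kernel_of k"])
qed

text \<open>For \<open>y < q ^ k\<close> and \<open>q dvd p\<close>, up to null sets the largest set
  of futures that determine the residue to be \<open>y\<close>; see
  \<open>determined_certain\<close> and \<open>AE_certain\<close>.\<close>

definition certain :: "nat \<Rightarrow> nat \<Rightarrow> nat \<Rightarrow> real set" where
  "certain q k y = {z. y < q ^ k \<and> residue_prob k (kern k) (q ^ k) y z \<ge> 1}"

lemma certain_sets [measurable]: "certain q k y \<in> sets borel"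
proof -
  note [measurable] = residue_prob_measurable[OF kern]
  show ?thesis unfolding certain_def by measurable
qed

lemma determined_certain:
  assumes "q dvd p"
  shows "determined q k y (certain q k y)"
  unfolding determined_iff_kernel[OF certain_sets assms order_refl kern] by (simp add: certain_def)

lemma AE_certain:
  assumes "C \<in> sets borel" "q dvd p" "determined q k y C" "y < q ^ k"
  shows "AE z in M. z \<in> C \<longrightarrow> z \<in> certain q k y"
proof -
  have "AE z in M. z \<in> C \<longrightarrow> residue_prob k (kern k) (q ^ k) y z \<ge> 1"
    using determined_iff_kernel[OF assms(1,2) order_refl kern] assms(3) by blast
  then show ?thesis by eventually_elim (use assms(4) in \<open>auto simp: certain_def\<close>)
qed

definition certain_at :: "nat \<Rightarrow> nat \<Rightarrow> real set" where
  "certain_at q k = (\<Union>y. certain q k y)"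

lemma certain_at_sets [measurable]: "certain_at q k \<in> sets borel" "certain_at q k \<in> sets M"
proof -
  show "certain_at q k \<in> sets borel"
    unfolding certain_at_def by (rule sets.countable_UN) (use certain_sets in blast)
  then show "certain_at q k \<in> sets M" by (simp add: sets_M)
qed

text \<open>A residue modulo \<open>q ^ Suc k\<close> fixes the one modulo \<open>q ^ k\<close>, for
  which the additional earliest digit is irrelevant.\<close>

lemma certain_at_Suc:
  assumes q: "q dvd p" "q > 0"
  shows "AE z in M. z \<in> certain_at q (Suc k) \<longrightarrow> z \<in> certain_at q k"
proof -
  have "AE z in M. z \<in> certain q (Suc k) y \<longrightarrow> z \<in> certain q k (y mod q ^ k)" for y
  proof (rule AE_certain)
    have "AE x in M. shift (Suc k) x \<in> certain q (Suc k) y \<longrightarrow> digits (Suc k) x mod q ^ Suc k = y"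
      using determined_certain[OF q(1), of "Suc k" y] by (simp only: determined_def)
    then have "AE x in M. shift (Suc k) x \<in> certain q (Suc k) y \<longrightarrow> digits (Suc k) x mod q ^ k = y mod q ^ k"
    proof eventually_elim
      case (elim x)
      then show ?case by (metis le_imp_power_dvd lessI less_imp_le mod_mod_cancel)
    qed
    then show "determined q k (y mod q ^ k) (certain q (Suc k) y)"
      using q by (subst determined_iff_shift[where g = "Suc k"]) auto
  qed (use q in auto)
  then have "AE z in M. \<forall>y. z \<in> certain q (Suc k) y \<longrightarrow> z \<in> certain q k (y mod q ^ k)"
    unfolding AE_all_countable by blast
  then show ?thesis by eventually_elim (auto simp: certain_at_def)
qed

definition always_certain :: "nat \<Rightarrow> real set" where
  "always_certain q = (\<Inter>k. certain_at q k)"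

lemma always_certain_sets [measurable]: "always_certain q \<in> sets borel" "always_certain q \<in> sets M"
proof -
  show "always_certain q \<in> sets borel"
    unfolding always_certain_def by (rule sets.countable_INT) (use certain_at_sets in blast)+
  then show "always_certain q \<in> sets M" by (simp add: sets_M)
qed

text \<open>Seen from \<open>shift 1 x\<close> the past is \<open>p * d + a\<close>, with
  \<open>d\<close> a past block of \<open>x\<close> and \<open>a\<close> the first digit of
  \<open>x\<close>, which \<open>x\<close> knows. Certainty about \<open>p * d + a\<close> to a high
  enough power of \<open>q\<close> therefore gives certainty about \<open>d\<close> modulo
  \<open>q ^ k\<close>; cancelling \<open>p\<close> costs \<open>e\<close> powers.\<close>

lemma always_certain_backward:
  assumes q: "prime q" "q dvd p"
  shows "AE x in M. shift 1 x \<in> always_certain q \<longrightarrow> x \<in> always_certain q"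
proof -
  have "p > 0" using p_gt_1 by simp
  obtain e where e: "\<And>k d d'. [p * d = p * d'] (mod q ^ (k + e)) \<Longrightarrow> [d = d'] (mod q ^ k)"
    by (rule prime_power_cancel[OF q(1) \<open>p > 0\<close>]) (rule that)
  have step: "AE x in M. digits 1 x = a \<and> shift 1 x \<in> certain q (Suc (k + e)) y \<longrightarrow> x \<in> certain_at q k" for k a y
  proof -
    define K where "K = k + e"
    define E where "E = {x. digits 1 x = a \<and> shift 1 x \<in> certain q (Suc K) y}"
    have E [measurable]: "E \<in> sets borel" unfolding E_def by measurable
    have "AE u in M. shift (Suc K) u \<in> certain q (Suc K) y \<longrightarrow> digits (Suc K) u mod q ^ Suc K = y"
      using determined_certain[OF q(2), of "Suc K" y] by (simp only: determined_def)
    then have ae: "AE u in M. shift K u \<in> E \<longrightarrow> (p * digits K u + a) mod q ^ Suc K = y"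
    proof eventually_elim
      case (elim u)
      show ?case
      proof
        assume "shift K u \<in> E"
        then have "digits 1 (shift K u) = a" "shift (Suc K) u \<in> certain q (Suc K) y"
          by (auto simp: E_def shift_shift)
        then show "(p * digits K u + a) mod q ^ Suc K = y"
          using elim digits_add[of 1 K u] by simp
      qed
    qed
    show ?thesis
    proof (cases "\<exists>d. (p * d + a) mod q ^ Suc K = y")
      case True
      then obtain d where d: "(p * d + a) mod q ^ Suc K = y" by blast
      have "AE u in M. shift K u \<in> E \<longrightarrow> digits K u mod q ^ k = d mod q ^ k"
        using ae
      proof eventually_elim
        case (elim u)
        show ?case
        proof
          assume "shift K u \<in> E"
          then have "[p * digits K u + a = p * d + a] (mod q ^ Suc K)"
            using elim d by (simp add: cong_def)
          then have "[p * digits K u = p * d] (mod q ^ Suc K)" by (simp add: cong_add_rcancel_nat)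
          then have "[p * digits K u = p * d] (mod q ^ (k + e))"
            by (rule cong_dvd_mono_modulus) (auto simp: K_def)
          then have "[digits K u = d] (mod q ^ k)" by (rule e)
          then show "digits K u mod q ^ k = d mod q ^ k" by (simp add: cong_def)
        qed
      qed
      then have "determined q k (d mod q ^ k) E"
        using q by (subst determined_iff_shift[where g = K]) (auto simp: K_def)
      then have "AE z in M. z \<in> E \<longrightarrow> z \<in> certain q k (d mod q ^ k)"
        using prime_gt_0_nat[OF q(1)] q by (intro AE_certain) auto
      then show ?thesis
        by eventually_elim (auto simp: certain_at_def E_def K_def)
    next
      \<comment> \<open>No past block is compatible with the digit \<open>a\<close> and the residue
        \<open>y\<close>, so \<open>E\<close> is a null set.\<close>
      case False
      then have "AE u in M. shift K u \<notin> E" using ae by auto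
      then have "AE z in M. z \<notin> E" by (subst (asm) AE_shift_iff) auto
      then show ?thesis by eventually_elim (auto simp: E_def K_def)
    qed
  qed
  have "AE x in M. \<forall>k a y. digits 1 x = a \<and> shift 1 x \<in> certain q (Suc (k + e)) y \<longrightarrow> x \<in> certain_at q k"
    unfolding AE_all_countable using step by blast
  then show ?thesis
    by eventually_elim (auto simp: always_certain_def certain_at_def)
qed

end

section \<open>Zero-one law and non-degenerate kernels\<close>

locale ergodic_positive_entropy = times_invariant +
  fixes c :: real
  assumes erg: "\<And>A. A \<in> sets borel \<Longrightarrow> (\<And>x. shift 1 x \<in> A \<longleftrightarrow> x \<in> A) \<Longrightarrow> prob A = 0 \<or> prob A = 1"
    and c: "c > 0" "\<And>n. H n \<ge> c * real n"
begin

text \<open>The preimages of the set lie in it up to null sets and have equal measure, so they agree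
  with it almost everywhere. The hypothesis \<open>erg\<close> concerns strictly invariant sets and
  is therefore applied to \<open>A\<close>, the points whose orbit meets the set infinitely
  often.\<close>

lemma always_certain_zero_one:
  assumes q: "prime q" "q dvd p"
  shows "prob (always_certain q) = 0 \<or> prob (always_certain q) = 1"
proof -
  let ?Z = "always_certain q"
  have bwd: "AE x in M. shift n x \<in> ?Z \<longrightarrow> x \<in> ?Z" for n
  proof (induction n)
    case 0
    show ?case using AE_frac by eventually_elim (simp add: shift_def)
  next
    case (Suc n)
    from AE_shift[OF always_certain_backward[OF q], of n] Suc show ?case
      by eventually_elim (simp add: shift_shift)
  qed
  have vim: "shift n -` ?Z \<in> sets M" for n by (rule shift_vimage_sets) simp
  have fwd: "AE x in M. x \<in> ?Z \<longrightarrow> shift n x \<in> ?Z" for n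
  proof -
    have "prob (shift n -` ?Z) = measure (distr M borel (shift n)) ?Z"
      by (subst measure_distr) auto
    also have "\<dots> = prob ?Z" by (simp only: distr_shift)
    finally have eq: "prob (shift n -` ?Z) = prob ?Z" .
    have "prob (?Z \<inter> shift n -` ?Z) = prob (shift n -` ?Z)"
      by (rule finite_measure_eq_AE) (use bwd[of n] vim in auto)
    then have "prob (?Z - shift n -` ?Z) = 0"
      using finite_measure_Diff'[OF always_certain_sets(2)[of q] vim[of n]] eq by simp
    then have "?Z - shift n -` ?Z \<in> null_sets M"
      using vim by (auto simp: null_sets_def emeasure_eq_measure)
    then have "AE x in M. x \<notin> ?Z - shift n -` ?Z" by (rule AE_not_in)
    then show ?thesis by eventually_elim auto
  qed
  define A where "A = {x. \<forall>n0. \<exists>n\<ge>n0. shift n x \<in> ?Z}"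
  have A: "A \<in> sets borel"
  proof -
    have "A = (\<Inter>n0. \<Union>n\<in>{n0..}. shift n -` ?Z)"
      by (simp add: A_def set_eq_iff Bex_def)
    moreover have "(\<Inter>n0. \<Union>n\<in>{n0..}. shift n -` ?Z) \<in> sets M"
      by (intro sets.countable_INT'' sets.countable_UN'') (use vim in auto)
    ultimately show ?thesis by (simp add: sets_M)
  qed
  have inv: "shift 1 x \<in> A \<longleftrightarrow> x \<in> A" for x
  proof
    assume x: "shift 1 x \<in> A"
    show "x \<in> A"
      unfolding A_def
    proof (intro CollectI allI)
      fix n0
      obtain n where "n \<ge> n0" "shift n (shift 1 x) \<in> ?Z" using x by (auto simp: A_def)
      then show "\<exists>n\<ge>n0. shift n x \<in> ?Z" by (intro exI[of _ "n + 1"]) (simp add: shift_shift)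
    qed
  next
    assume x: "x \<in> A"
    show "shift 1 x \<in> A"
      unfolding A_def
    proof (intro CollectI allI)
      fix n0
      obtain n where n: "n \<ge> n0 + 1" "shift n x \<in> ?Z" using x by (auto simp: A_def)
      then show "\<exists>n\<ge>n0. shift n (shift 1 x) \<in> ?Z" by (intro exI[of _ "n - 1"]) (simp add: shift_shift)
    qed
  qed
  have "prob A = prob ?Z"
  proof (rule finite_measure_eq_AE)
    have "AE x in M. \<forall>n. (shift n x \<in> ?Z \<longrightarrow> x \<in> ?Z) \<and> (x \<in> ?Z \<longrightarrow> shift n x \<in> ?Z)"
      unfolding AE_all_countable using bwd fwd by (auto simp: AE_conj_iff)
    then show "AE x in M. x \<in> A \<longleftrightarrow> x \<in> ?Z"
      by eventually_elim (auto simp: A_def)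
  qed (use A in \<open>auto simp: sets_M\<close>)
  moreover have "prob A = 0 \<or> prob A = 1" by (rule erg[OF A inv])
  ultimately show ?thesis by simp
qed

text \<open>Probability 1 would make the residue of the past a function of the future for every
  \<open>k\<close>, against \<open>not_all_digits_determined\<close>.\<close>

lemma prob_always_certain:
  assumes q: "prime q" "q dvd p"
  shows "prob (always_certain q) = 0"
proof (rule ccontr)
  assume "prob (always_certain q) \<noteq> 0"
  then have "prob (always_certain q) = 1" using always_certain_zero_one[OF q] by blast
  then have "AE x in M. x \<in> always_certain q" by (simp add: prob_eq_1)
  show False
  proof (rule not_all_digits_determined[OF prime_ge_2_nat[OF q(1)] q(2) c])
    fix k
    \<comment> \<open>The default \<open>q ^ k\<close> is no residue; it makes \<open>Y\<close>
      total with finite range.\<close>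
    define Y where "Y z = (LEAST y. z \<in> certain q k y \<or> y = q ^ k)" for z
    have Yle: "Y z \<le> q ^ k" for z unfolding Y_def by (rule Least_le) simp
    have [measurable]: "Y \<in> measurable borel (count_space UNIV)"
      unfolding Y_def by measurable
    have "range Y \<subseteq> {..q ^ k}" using Yle by auto
    then have "finite (range Y)" by (rule finite_subset) simp
    moreover have "Y \<in> measurable M (count_space UNIV)"
      by (simp add: measurable_cong_sets[OF sets_M refl])
    ultimately have Y: "simple_function M Y" by (simp add: simple_function_eq_measurable)
    have det: "AE x in M. \<forall>y. shift k x \<in> certain q k y \<longrightarrow> digits k x mod q ^ k = y"
      unfolding AE_all_countable using determined_certain[OF q(2)] by (simp add: determined_def)
    have "AE x in M. shift k x \<in> always_certain q"
      by (rule AE_shift) fact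
    with det have "AE x in M. digits k x mod q ^ k = Y (shift k x)"
    proof eventually_elim
      case (elim x)
      then obtain y where y: "shift k x \<in> certain q k y"
        by (auto simp: always_certain_def certain_at_def)
      then have "y < q ^ k" by (simp add: certain_def)
      moreover have "Y (shift k x) \<le> y" unfolding Y_def by (rule Least_le) (use y in simp)
      ultimately have "Y (shift k x) \<noteq> q ^ k" by simp
      moreover have "shift k x \<in> certain q k (Y (shift k x)) \<or> Y (shift k x) = q ^ k"
        unfolding Y_def by (rule LeastI[of _ y]) (use y in simp)
      ultimately show ?case using elim by blast
    qed
    with Y show "\<exists>Y. simple_function M Y \<and> (AE x in M. digits k x mod q ^ k = Y (shift k x))" by blast
  qed
qed

text \<open>The sets decrease only almost everywhere; the finite intersections \<open>S k\<close>
  decrease exactly and have the same measures.\<close>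

lemma prob_certain_at_tendsto:
  assumes q: "prime q" "q dvd p"
  shows "(\<lambda>k. prob (certain_at q k)) \<longlonglongrightarrow> 0"
proof -
  define S where "S k = (\<Inter>j\<in>{..k}. certain_at q j)" for k
  have S: "S k \<in> sets M" for k unfolding S_def by (intro sets.finite_INT) auto
  have "(\<lambda>k. prob (S k)) \<longlonglongrightarrow> prob (\<Inter>k. S k)"
    by (rule finite_Lim_measure_decseq) (use S in \<open>auto simp: S_def decseq_def\<close>)
  moreover have "(\<Inter>k. S k) = always_certain q" by (auto simp: S_def always_certain_def)
  moreover have "prob (S k) = prob (certain_at q k)" for k
  proof (rule finite_measure_eq_AE)
    have "AE z in M. \<forall>j. z \<in> certain_at q (Suc j) \<longrightarrow> z \<in> certain_at q j"
      unfolding AE_all_countable using certain_at_Suc[OF q(2) prime_gt_0_nat[OF q(1)]] by blast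
    then show "AE z in M. z \<in> S k \<longleftrightarrow> z \<in> certain_at q k"
    proof eventually_elim
      case (elim z)
      have "z \<in> certain_at q j" if "z \<in> certain_at q k" "j \<le> k" for j
        using that(2,1) by (induction rule: inc_induct) (use elim in auto)
      then show ?case by (auto simp: S_def)
    qed
  qed (use S in auto)
  ultimately show ?thesis using prob_always_certain[OF q] by simp
qed

text \<open>The point is that \<open>k\<close> does not depend on \<open>g\<close>: it is read off
  from the sets \<open>certain_at q k\<close>, and \<open>determined_iff_kernel\<close> carries them
  over to the kernel of any block length \<open>g \<ge> k\<close>. For fixed \<open>g\<close>,
  near-certainty within \<open>1 / (i + 1)\<close> decreases to certainty as \<open>i\<close> grows,
  which yields a quantitative threshold.\<close>

lemma good_kernel:
  assumes \<tau>: "\<tau> > 0"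
  obtains k where "\<And>g. g \<ge> k \<Longrightarrow> \<exists>P \<kappa> N. branch_kernel M (p ^ g) P \<and> \<kappa> > 0 \<and> N \<in> sets borel \<and> prob N \<le> \<tau> \<and>
    (\<forall>z. z \<notin> N \<longrightarrow> card (annihilator (p ^ g) {a. a < p ^ g \<and> \<kappa> \<le> P a z}) \<le> p ^ k)"
proof -
  define Q where "Q = {q. prime q \<and> q dvd p}"
  have Q: "finite Q" unfolding Q_def using finite_divisors_nat[of p] p_gt_1 by (auto intro: finite_subset)
  define \<tau>' where "\<tau>' = \<tau> / (real (card Q) + 1)"
  have \<tau>': "\<tau>' > 0" using \<tau> by (simp add: \<tau>'_def add_nonneg_pos)
  have "\<forall>\<^sub>F k in sequentially. \<forall>q\<in>Q. prob (certain_at q k) < \<tau>'"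
    using Q by (intro eventually_ball_finite ballI order_tendstoD(2)[OF prob_certain_at_tendsto])
      (use \<tau>' in \<open>auto simp: Q_def\<close>)
  from eventually_happens'[OF sequentially_bot this]
  obtain k where k: "\<And>q. q \<in> Q \<Longrightarrow> prob (certain_at q k) < \<tau>'" by blast
  show ?thesis
  proof (rule that[of k])
    fix g assume g: "g \<ge> k"
    define b where "b = p ^ g"
    have b: "b > 0" using p_gt_1 by (simp add: b_def)
    define P where "P = kern g"
    have P: "kernel_of g P" unfolding P_def by (rule kern)
    define \<rho> where "\<rho> q y z = residue_prob g P (q ^ k) y z" for q y z
    have [measurable]: "\<rho> q y \<in> borel_measurable borel" for q y
      unfolding \<rho>_def by (rule residue_prob_measurable[OF P])
    define N where "N q i = {z. \<exists>y<q ^ k. \<rho> q y z \<ge> 1 - 1 / real (Suc i)}" for q i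
    have N: "N q i \<in> sets borel" for q i unfolding N_def by measurable
    have lim: "(\<lambda>i. prob (N q i)) \<longlonglongrightarrow> prob (\<Inter>i. N q i)" for q
    proof (rule finite_Lim_measure_decseq)
      show "decseq (N q)"
        unfolding decseq_def
      proof (intro allI impI subsetI)
        fix i j z assume ij: "i \<le> j" and "z \<in> N q j"
        then obtain y where "y < q ^ k" "\<rho> q y z \<ge> 1 - 1 / real (Suc j)" by (auto simp: N_def)
        moreover have "1 / real (Suc j) \<le> 1 / real (Suc i)" using ij by (intro divide_left_mono) auto
        ultimately show "z \<in> N q i" unfolding N_def by (intro CollectI exI[of _ y]) linarith
      qed
    qed (use N sets_M in auto)
    have "prob (\<Inter>i. N q i) < \<tau>'" if q: "q \<in> Q" for q
    proof -
      have "prob (\<Inter>i. N q i) \<le> prob (certain_at q k)"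
      proof (rule finite_measure_mono_AE)
        define C where "C y = {z. y < q ^ k \<and> \<rho> q y z \<ge> 1}" for y
        have C: "C y \<in> sets borel" for y unfolding C_def by measurable
        have "determined q k y (C y)" for y
          by (subst determined_iff_kernel[OF C _ g P]) (use q in \<open>auto simp: C_def \<rho>_def Q_def\<close>)
        then have "AE z in M. z \<in> C y \<longrightarrow> z \<in> certain q k y" for y
        proof (cases "y < q ^ k")
          case True
          then show ?thesis using C q \<open>determined q k y (C y)\<close> by (intro AE_certain) (auto simp: Q_def)
        qed (simp add: C_def)
        then have "AE z in M. \<forall>y. z \<in> C y \<longrightarrow> z \<in> certain q k y" unfolding AE_all_countable by blast
        then show "AE z in M. z \<in> (\<Inter>i. N q i) \<longrightarrow> z \<in> certain_at q k"
        proof eventually_elim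
          case (elim z)
          show ?case
          proof
            assume z: "z \<in> (\<Inter>i. N q i)"
            have "\<exists>y<q ^ k. \<rho> q y z \<ge> 1"
            proof (rule ccontr)
              assume "\<not> (\<exists>y<q ^ k. \<rho> q y z \<ge> 1)"
              then have "\<forall>\<^sub>F i in sequentially. \<forall>y\<in>{..<q ^ k}. 1 - 1 / real (Suc i) > \<rho> q y z"
              proof (intro eventually_ball_finite ballI)
                fix y assume "y \<in> {..<q ^ k}"
                then have "\<rho> q y z < 1" using \<open>\<not> _\<close> by auto
                moreover have "(\<lambda>i. 1 - 1 / real (Suc i)) \<longlonglongrightarrow> 1 - 0"
                  by (intro tendsto_diff tendsto_const LIMSEQ_Suc lim_1_over_n)
                ultimately show "\<forall>\<^sub>F i in sequentially. 1 - 1 / real (Suc i) > \<rho> q y z"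
                  by (intro order_tendstoD(1)) auto
              qed simp
              from eventually_happens'[OF sequentially_bot this]
              obtain i where "\<forall>y\<in>{..<q ^ k}. 1 - 1 / real (Suc i) > \<rho> q y z" by blast
              then have "z \<notin> N q i" by (force simp: N_def)
              with z show False by auto
            qed
            then obtain y where "z \<in> C y" by (auto simp: C_def)
            then show "z \<in> certain_at q k" using elim by (auto simp: certain_at_def)
          qed
        qed
      qed simp
      then show ?thesis using k[OF q] by simp
    qed
    then have "\<forall>\<^sub>F i in sequentially. \<forall>q\<in>Q. prob (N q i) < \<tau>'"
      using Q by (intro eventually_ball_finite ballI order_tendstoD(2)[OF lim]) auto
    from eventually_happens'[OF sequentially_bot this]
    obtain i where i: "\<And>q. q \<in> Q \<Longrightarrow> prob (N q i) < \<tau>'" by blast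
    \<comment> \<open>If all atoms of mass at least \<open>\<kappa>\<close> share one class modulo
      \<open>q ^ k\<close>, the other classes carry at most
      \<open>b * \<kappa> = 1 / (i + 1)\<close>, which puts \<open>z\<close> into
      \<open>N q i\<close>.\<close>
    define \<kappa> where "\<kappa> = 1 / (real (Suc i) * real b)"
    define Bad where "Bad = (\<Union>q\<in>Q. N q i)"
    show "\<exists>P \<kappa> N. branch_kernel M (p ^ g) P \<and> \<kappa> > 0 \<and> N \<in> sets borel \<and> prob N \<le> \<tau> \<and>
      (\<forall>z. z \<notin> N \<longrightarrow> card (annihilator (p ^ g) {a. a < p ^ g \<and> \<kappa> \<le> P a z}) \<le> p ^ k)"
    proof (intro exI conjI allI impI)
      show "branch_kernel M (p ^ g) P" using P by (simp add: kernel_of_def)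
      show "\<kappa> > 0" using b by (simp add: \<kappa>_def)
      show "Bad \<in> sets borel" unfolding Bad_def using Q N by (intro sets.finite_UN) auto
      have "prob Bad \<le> (\<Sum>q\<in>Q. prob (N q i))"
        unfolding Bad_def using Q N sets_M by (intro measure_UNION_le) auto
      also have "\<dots> \<le> real (card Q) * \<tau>'" using i by (intro sum_bounded_above less_imp_le)
      also have "\<dots> \<le> \<tau>" using \<tau> by (simp add: \<tau>'_def field_simps)
      finally show "prob Bad \<le> \<tau>" .
      fix z assume z: "z \<notin> Bad"
      let ?K = "{a. a < p ^ g \<and> \<kappa> \<le> P a z}"
      show "card (annihilator (p ^ g) ?K) \<le> p ^ k"
      proof (rule card_annihilator_le[OF p_gt_1 g], rule ccontr)
        fix q assume q: "prime q" "q dvd p" and eq: "\<not> (\<exists>a\<in>?K. \<exists>a'\<in>?K. a mod q ^ k \<noteq> a' mod q ^ k)"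
        obtain y where y: "y < q ^ k" "\<And>a. a \<in> ?K \<Longrightarrow> a mod q ^ k = y"
        proof (cases "?K = {}")
          case True
          then show ?thesis using that[of 0] prime_gt_0_nat[OF q(1)] by auto
        next
          case False
          then have "\<exists>a0. a0 \<in> ?K" by (simp only: ex_in_conv not_False_eq_True)
          then obtain a0 where "a0 \<in> ?K" by (elim exE)
          moreover have "a0 mod q ^ k < q ^ k" using prime_gt_0_nat[OF q(1)] by simp
          ultimately show ?thesis using that[of "a0 mod q ^ k"] eq by blast
        qed
        have "1 = \<rho> q y z + (\<Sum>a\<in>{a. a < p ^ g \<and> a mod q ^ k \<noteq> y}. P a z)"
        proof -
          have "(\<Sum>a<p ^ g. P a z) = \<rho> q y z + (\<Sum>a\<in>{a. a < p ^ g \<and> a mod q ^ k \<noteq> y}. P a z)"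
            unfolding residue_prob_def \<rho>_def by (subst sum.union_disjoint [symmetric]) (auto intro!: sum.cong)
          then show ?thesis using kernelD(3)[OF P] by simp
        qed
        also have "(\<Sum>a\<in>{a. a < p ^ g \<and> a mod q ^ k \<noteq> y}. P a z) \<le> real (card {a. a < p ^ g \<and> a mod q ^ k \<noteq> y}) * \<kappa>"
          using y(2) by (intro sum_bounded_above) force
        also have "\<dots> \<le> real b * \<kappa>"
        proof (intro mult_right_mono)
          have "card {a. a < p ^ g \<and> a mod q ^ k \<noteq> y} \<le> card {..<b}"
            by (intro card_mono) (auto simp: b_def)
          then show "real (card {a. a < p ^ g \<and> a mod q ^ k \<noteq> y}) \<le> real b" by simp
        qed (simp add: \<kappa>_def)
        also have "\<dots> = 1 / real (Suc i)" using b by (simp add: \<kappa>_def)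
        finally have "z \<in> N q i" using y(1) by (auto simp: N_def)
        then show False using z q by (auto simp: Bad_def Q_def)
      qed
    qed
  qed
qed

end

subsection \<open>From the circle to the unit interval\<close>

text \<open>\<open>rep_circle\<close> picks an arbitrary representative; its fractional part is
  canonical, hence measurable.\<close>

definition circle_coord :: "circle \<Rightarrow> real" where
  "circle_coord c = frac (rep_circle c)"

lemma circle_coord_to_circle [simp]: "circle_coord (to_circle x) = frac x"
proof -
  have "rep_circle (to_circle x) - x \<in> \<int>"
    using Quotient3_rep_abs[OF Quotient3_circle, of x] by simp
  then obtain k where "rep_circle (to_circle x) = x + of_int k"
    by (metis Ints_cases add.commute diff_add_cancel)
  then show ?thesis by (simp add: circle_coord_def)
qed

lemma to_circle_eq_iff: "to_circle x = to_circle y \<longleftrightarrow> x - y \<in> \<int>"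
  using Quotient3_rel[OF Quotient3_circle, of x y] by simp

lemma to_circle_frac [simp]: "to_circle (frac x) = to_circle x"
  by (simp add: to_circle_eq_iff frac_def)

lemma to_circle_coord [simp]: "to_circle (circle_coord c) = c"
  unfolding circle_coord_def to_circle_frac by (rule Quotient3_abs_rep[OF Quotient3_circle])

lemma times_map_to_circle: "times_map c (to_circle x) = to_circle (of_int c * x)"
  by (rule times_map.abs_eq)

lemma circle_coord_times_map: "circle_coord (times_map c z) = frac (of_int c * circle_coord z)"
proof -
  have "circle_coord (times_map c z) = circle_coord (times_map c (to_circle (circle_coord z)))" by simp
  also have "\<dots> = frac (of_int c * circle_coord z)"
    unfolding times_map_to_circle by simp
  finally show ?thesis .
qed

lemma circle_coord_bounds: "0 \<le> circle_coord c" "circle_coord c < 1"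
  by (simp_all add: circle_coord_def frac_lt_1)

lemma open_circle_coord_between:
  assumes "t \<le> 1"
  shows "open {c. 0 < circle_coord c \<and> circle_coord c < t}"
proof -
  have "to_circle -` {c. 0 < circle_coord c \<and> circle_coord c < t} = (\<Union>n::int. {of_int n<..<of_int n + t})"
  proof (intro equalityI subsetI)
    fix x assume "x \<in> to_circle -` {c. 0 < circle_coord c \<and> circle_coord c < t}"
    then have "0 < frac x" "frac x < t" by (auto simp del: frac_gt_0_iff)
    then have "x \<in> {of_int \<lfloor>x\<rfloor><..<of_int \<lfloor>x\<rfloor> + t}" by (auto simp: frac_def)
    then show "x \<in> (\<Union>n::int. {of_int n<..<of_int n + t})" by blast
  next
    fix x assume "x \<in> (\<Union>n::int. {of_int n<..<of_int n + t})"
    then obtain n :: int where n: "of_int n < x" "x < of_int n + t" by auto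
    then have "frac x = x - of_int n" using assms by (subst frac_unique_iff) auto
    then show "x \<in> to_circle -` {c. 0 < circle_coord c \<and> circle_coord c < t}" using n by (simp del: frac_gt_0_iff)
  qed
  then show ?thesis by (simp add: open_circle_def open_UN)
qed

text \<open>The coordinate jumps at the class of 0. Arcs strictly between 0 and \<open>t\<close> are
  open, and that one point is treated separately.\<close>

lemma circle_coord_measurable [measurable]: "circle_coord \<in> borel_measurable borel"
  unfolding borel_measurable_iff_less
proof
  fix t :: real
  have open_between: "{c. 0 < circle_coord c \<and> circle_coord c < s} \<in> sets borel" if "s \<le> 1" for s
    by (rule borel_open[OF open_circle_coord_between[OF that]])
  have "{c. circle_coord c = 0} = - {c. 0 < circle_coord c \<and> circle_coord c < 1}"
  proof -
    have "circle_coord c = 0 \<longleftrightarrow> \<not> (0 < circle_coord c \<and> circle_coord c < 1)" for c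
      using circle_coord_bounds[of c] by linarith
    then show ?thesis by auto
  qed
  then have zero: "{c. circle_coord c = 0} \<in> sets borel"
    using open_between[of 1] by (simp add: borel_comp)
  consider "t \<le> 0" | "0 < t" "t \<le> 1" | "t > 1" by linarith
  then show "{w \<in> space borel. circle_coord w < t} \<in> sets borel"
  proof cases
    case 1
    have "\<not> circle_coord w < t" for w using circle_coord_bounds(1)[of w] 1 by linarith
    then show ?thesis by simp
  next
    case 2
    have "circle_coord w < t \<longleftrightarrow> circle_coord w = 0 \<or> 0 < circle_coord w \<and> circle_coord w < t" for w
      using circle_coord_bounds(1)[of w] 2 by linarith
    then have "{w \<in> space borel. circle_coord w < t} = {c. circle_coord c = 0} \<union> {c. 0 < circle_coord c \<and> circle_coord c < t}"
      by auto
    then show ?thesis using zero open_between[OF 2(2)] by simp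
  next
    case 3
    have "circle_coord w < t" for w using circle_coord_bounds(2)[of w] 3 by linarith
    then show ?thesis by simp
  qed
qed

locale circle_system = prob_space \<mu> for \<mu> :: "circle measure" +
  fixes p :: nat
  assumes p_gt_1: "p > 1"
    and sets_\<mu> [measurable_cong]: "sets \<mu> = sets borel"
    and inv_\<mu>: "invariant_measure \<mu> (times_map (int p))"
begin

definition lifted :: "real measure" where
  "lifted = distr \<mu> borel circle_coord"

lemma space_\<mu> [simp]: "space \<mu> = UNIV"
  using sets_eq_imp_space_eq[OF sets_\<mu>] by simp

lemma lifted_times_invariant: "times_invariant lifted p"
proof -
  interpret L: prob_space lifted
    unfolding lifted_def by (rule prob_space_distr) measurable
  show ?thesis
  proof
    show "p > 1" by (rule p_gt_1)
    show "sets lifted = sets borel" by (simp add: lifted_def)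
    have T: "times_map (int p) \<in> measurable \<mu> \<mu>" "distr \<mu> \<mu> (times_map (int p)) = \<mu>"
      using inv_\<mu> by (auto simp: invariant_measure_def)
    have "distr lifted borel (\<lambda>x. frac (real p * x)) = distr \<mu> borel (\<lambda>c. circle_coord (times_map (int p) c))"
      unfolding lifted_def by (subst distr_distr) (auto simp: comp_def circle_coord_times_map frac_def)
    also have "\<dots> = distr (distr \<mu> \<mu> (times_map (int p))) borel circle_coord"
      by (subst distr_distr) (use T(1) in \<open>auto simp: comp_def\<close>)
    also have "\<dots> = lifted" by (simp add: T(2) lifted_def)
    finally show "distr lifted borel (\<lambda>x. frac (real p * x)) = lifted" .
  qed
qed

sublocale L: times_invariant lifted p
  by (rule lifted_times_invariant)

lemma lifted_ergodic:
  assumes erg: "ergodic \<mu> (times_map (int p))" and A: "A \<in> sets borel"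
    and inv: "\<And>x. L.shift 1 x \<in> A \<longleftrightarrow> x \<in> A"
  shows "measure lifted A = 0 \<or> measure lifted A = 1"
proof -
  have B: "circle_coord -` A \<in> sets \<mu>"
    using measurable_sets[OF circle_coord_measurable A] by (simp add: sets_\<mu>)
  have "times_map (int p) -` (circle_coord -` A) = circle_coord -` A"
  proof (intro set_eqI)
    fix c
    have "L.shift 1 (circle_coord c) = circle_coord (times_map (int p) c)"
      by (simp add: L.shift_def circle_coord_times_map)
    then show "c \<in> times_map (int p) -` (circle_coord -` A) \<longleftrightarrow> c \<in> circle_coord -` A"
      using inv[of "circle_coord c"] by simp
  qed
  then have "prob (circle_coord -` A) = 0 \<or> prob (circle_coord -` A) = 1"
    using erg B by (simp add: ergodic_def)
  moreover have "measure lifted A = prob (circle_coord -` A)"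
    unfolding lifted_def by (subst measure_distr) (use A in auto)
  ultimately show ?thesis by simp
qed

lemma times_map_iterate: "(times_map (int p) ^^ i) (to_circle x) = to_circle (L.shift i x)"
proof (induction i)
  case 0
  show ?case by (simp add: L.shift_def)
next
  case (Suc i)
  have "(times_map (int p) ^^ Suc i) (to_circle x) = to_circle (real p * L.shift i x)"
    using Suc by (simp add: times_map_to_circle)
  also have "\<dots> = to_circle (L.shift 1 (L.shift i x))" by (simp add: L.shift_def)
  finally show ?case by (simp add: L.shift_shift)
qed

text \<open>Replaces a partition by the function naming the cell of a point, so that the calculus of
  random variables applies.\<close>

lemma cells_of_partition:
  assumes P: "finite_measurable_partition \<mu> P"
  obtains cell where "\<And>x. cell x \<in> P" "\<And>x A. A \<in> P \<Longrightarrow> cell x = A \<longleftrightarrow> x \<in> A"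
    "simple_function lifted (\<lambda>x. cell (to_circle x))" "simple_function \<mu> cell"
proof -
  have part: "partition_on UNIV P" "finite P" "P \<subseteq> sets \<mu>"
    using P by (auto simp: finite_measurable_partition_def)
  have "\<exists>A\<in>P. x \<in> A" for x using partition_onD1[OF part(1)] by blast
  then obtain cell where cell: "\<And>x. cell x \<in> P" "\<And>x. x \<in> cell x" by metis
  have iff: "cell x = A \<longleftrightarrow> x \<in> A" if "A \<in> P" for x A
    using partition_onD2[OF part(1)] cell[of x] that by (auto simp: disjoint_def)
  have fin: "range cell \<subseteq> P" using cell(1) by auto
  have vim: "cell -` {A} = A" if "A \<in> P" for A using iff[OF that] by auto
  have s\<mu>: "simple_function \<mu> cell"
    unfolding simple_function_def using fin vim part cell(1) by (auto intro: finite_subset)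
  have "simple_function lifted (\<lambda>x. cell (to_circle x))"
    unfolding simple_function_def
  proof (intro conjI ballI)
    show "finite ((\<lambda>x. cell (to_circle x)) ` space lifted)"
      by (rule finite_subset[OF _ part(2)]) (use cell(1) in auto)
    fix A assume "A \<in> (\<lambda>x. cell (to_circle x)) ` space lifted"
    then have A: "A \<in> P" using cell(1) by auto
    then have "A \<in> sets borel" using part(3) sets_\<mu> by auto
    then have "to_circle -` A \<inter> space borel \<in> sets borel" by (rule measurable_sets[OF measurable_to_circle])
    moreover have "(\<lambda>x. cell (to_circle x)) -` {A} \<inter> space lifted = to_circle -` A"
      using vim[OF A] by auto
    ultimately show "(\<lambda>x. cell (to_circle x)) -` {A} \<inter> space lifted \<in> sets lifted"
      by (simp add: L.sets_M)
  qed
  from that[OF cell(1) iff this s\<mu>] show ?thesis .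
qed

end

section \<open>Digit entropy and Kolmogorov-Sinai entropy\<close>

context times_invariant
begin

lemma digits_shift_mod: "digits m (shift n x) = digits (m + n) x mod p ^ m"
  using digits_less[of m "shift n x"] by (simp add: digits_add)

definition itinerary :: "(real \<Rightarrow> 'b) \<Rightarrow> nat \<Rightarrow> real \<Rightarrow> 'b list" where
  "itinerary f n x = map (\<lambda>i. f (shift i x)) [0..<n]"

lemma simple_itinerary:
  assumes f: "simple_function M f"
  shows "simple_function M (itinerary f n)"
proof (induction n)
  case 0
  show ?case by (simp add: itinerary_def [abs_def])
next
  case (Suc n)
  have "itinerary f (Suc n) = (\<lambda>x. (\<lambda>(v, w). v @ [w]) (itinerary f n x, f (shift n x)))"
    by (auto simp: itinerary_def)
  moreover have "simple_function M (\<lambda>x. (itinerary f n x, f (shift n x)))"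
    using Suc simple_shift[OF f] by simp
  ultimately show ?case
    using simple_function_compose1[of M "\<lambda>x. (itinerary f n x, f (shift n x))" "\<lambda>(v, w). v @ [w]"] by simp
qed

text \<open>By invariance the letter \<open>f (shift n x)\<close> costs at most
  \<open>\<tau>\<close> given the \<open>m\<close> digits that follow the first \<open>n\<close>.
  These are among the first \<open>N\<close> digits, and submodularity adds up the costs.\<close>

lemma itinerary_entropy_aux:
  assumes f: "simple_function M f" and small: "rv_entropy M (\<lambda>x. (f x, digits m x)) \<le> H m + \<tau>"
    and "n + m \<le> N"
  shows "rv_entropy M (\<lambda>x. (itinerary f n x, digits N x)) \<le> H N + real n * \<tau>"
  using assms(3)
proof (induction n)
  case 0
  have "rv_entropy M (\<lambda>x. ([], digits N x)) \<le> H N"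
    by (rule rv_entropy_compose_le[where F = "\<lambda>d. ([], d)"]) simp
  then show ?case by (simp add: itinerary_def)
next
  case (Suc n)
  let ?X = "itinerary f n" and ?Y = "\<lambda>x. f (shift n x)" and ?W = "digits N"
  have s: "simple_function M ?X" "simple_function M ?Y" using simple_itinerary simple_shift f by auto
  have "rv_entropy M (\<lambda>x. (itinerary f (Suc n) x, ?W x)) \<le> rv_entropy M (\<lambda>x. (?X x, ?Y x, ?W x))"
  proof -
    have "simple_function M (\<lambda>x. (?X x, ?Y x, ?W x))" using s by simp
    from rv_entropy_compose_le[OF this, of "\<lambda>(v, w, d). (v @ [w], d)"] show ?thesis
      by (simp add: itinerary_def)
  qed
  moreover have "rv_entropy M (\<lambda>x. (?X x, ?Y x, ?W x)) + H N
      \<le> rv_entropy M (\<lambda>x. (?X x, ?W x)) + rv_entropy M (\<lambda>x. (?Y x, ?W x))"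
    by (rule rv_entropy_submodular) (use s in auto)
  moreover have "rv_entropy M (\<lambda>x. (?X x, ?W x)) \<le> H N + real n * \<tau>" using Suc by simp
  moreover have "rv_entropy M (\<lambda>x. (?Y x, ?W x)) \<le> H N + \<tau>"
  proof -
    define l where "l = N - (m + n)"
    have N: "N = l + (m + n)" using Suc.prems by (simp add: l_def)
    have eq: "digits m (shift n x) = digits N x div p ^ l mod p ^ m" for x
      unfolding digits_shift_mod N digits_div[symmetric] ..
    have "rv_entropy M (\<lambda>x. (?Y x, ?W x)) + rv_entropy M (\<lambda>x. digits m (shift n x))
        \<le> rv_entropy M (\<lambda>x. (?Y x, digits m (shift n x))) + H N"
      unfolding eq by (rule rv_entropy_cond_mono) (use s in auto)
    moreover have "rv_entropy M (\<lambda>x. digits m (shift n x)) = H m"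
      by (rule rv_entropy_shift) simp
    moreover have "rv_entropy M (\<lambda>x. (?Y x, digits m (shift n x))) = rv_entropy M (\<lambda>x. (f x, digits m x))"
      by (rule rv_entropy_shift[of "\<lambda>x. (f x, digits m x)"]) (use f in simp)
    ultimately show ?thesis using small by linarith
  qed
  ultimately show ?case by (simp add: algebra_simps)
qed

lemma itinerary_entropy:
  assumes f: "simple_function M f" and small: "rv_entropy M (\<lambda>x. (f x, digits m x)) \<le> H m + \<tau>"
  shows "rv_entropy M (itinerary f n) \<le> H (n + m) + real n * \<tau>"
proof -
  have "rv_entropy M (\<lambda>x. fst (itinerary f n x, digits (n + m) x))
      \<le> rv_entropy M (\<lambda>x. (itinerary f n x, digits (n + m) x))"
    by (rule rv_entropy_compose_le) (use simple_itinerary[OF f] in simp)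
  then show ?thesis using itinerary_entropy_aux[OF f small, of n "n + m"] by simp
qed

text \<open>Division of \<open>n\<close> by \<open>n0\<close> with remainder, and
  subadditivity.\<close>

lemma H_linear_bound:
  assumes n0: "n0 > 0" "H n0 \<le> \<tau> * real n0" and \<tau>: "\<tau> \<ge> 0"
  shows "H n \<le> \<tau> * real n + real n0 * H 1"
proof -
  have "H n = H ((n div n0) * n0 + n mod n0)" by simp
  also have "\<dots> \<le> H ((n div n0) * n0) + H (n mod n0)" by (rule H_add)
  also have "H ((n div n0) * n0) \<le> real (n div n0) * H n0" by (rule H_mult)
  also have "\<dots> \<le> real (n div n0) * (\<tau> * real n0)" by (intro mult_left_mono n0) auto
  also have "\<dots> = \<tau> * real (n div n0 * n0)" by simp
  also have "\<dots> \<le> \<tau> * real n" using \<tau> by (intro mult_left_mono of_nat_mono) (auto simp: div_times_less_eq_dividend)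
  also have "H (n mod n0) \<le> real (n mod n0) * H 1" using H_mult[of "n mod n0" 1] by simp
  also have "\<dots> \<le> real n0 * H 1" using n0 H_nonneg by (intro mult_right_mono) (auto simp: less_imp_le)
  finally show ?thesis by simp
qed

end

context circle_system
begin

text \<open>The nonempty members of the join are exactly the fibres of the itinerary, and an empty
  member contributes \<open>0 * ln 0 = 0\<close>.\<close>

lemma partition_entropy_join:
  assumes P: "finite_measurable_partition \<mu> P"
    and cell: "\<And>x. cell x \<in> P" "\<And>x A. A \<in> P \<Longrightarrow> cell x = A \<longleftrightarrow> x \<in> A"
    and s: "simple_function lifted (\<lambda>x. cell (to_circle x))"
  shows "partition_entropy \<mu> (iterated_join \<mu> (times_map (int p)) P n)
    = rv_entropy lifted (L.itinerary (\<lambda>x. cell (to_circle x)) n)"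
proof -
  define T where "T = times_map (int p)"
  define nm where "nm c = map (\<lambda>i. cell ((T ^^ i) c)) [0..<n]" for c
  define J where "J = iterated_join \<mu> T P n"
  have finP: "finite P" using P by (simp add: finite_measurable_partition_def)
  have finJ: "finite J" unfolding J_def iterated_join_def using finP by (simp add: finite_PiE)
  have nm: "L.itinerary (\<lambda>x. cell (to_circle x)) n (circle_coord c) = nm c" for c
  proof -
    have "to_circle (L.shift i (circle_coord c)) = (T ^^ i) c" for i
      using times_map_iterate[of i "circle_coord c"] by (simp add: T_def)
    then show ?thesis by (simp add: L.itinerary_def nm_def)
  qed
  have fibre: "nm -` {nm c} = (\<Inter>i<n. (T ^^ i) -` cell ((T ^^ i) c))" for c
    using cell by (auto simp: nm_def list_eq_iff_nth_eq)
  have "(\<lambda>v. nm -` {v}) ` range nm = J - {{}}"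
  proof (intro equalityI subsetI)
    fix E assume "E \<in> (\<lambda>v. nm -` {v}) ` range nm"
    then obtain c where E: "E = nm -` {nm c}" by auto
    define A where "A = restrict (\<lambda>i. cell ((T ^^ i) c)) {..<n}"
    have "A \<in> {..<n} \<rightarrow>\<^sub>E P" using cell(1) by (auto simp: A_def)
    moreover have "E = space \<mu> \<inter> (\<Inter>i<n. (T ^^ i) -` A i)"
      unfolding E fibre by (simp add: A_def)
    moreover have "c \<in> E" by (simp add: E)
    ultimately show "E \<in> J - {{}}" unfolding J_def iterated_join_def by blast
  next
    fix E assume "E \<in> J - {{}}"
    then obtain A c where A: "A \<in> {..<n} \<rightarrow>\<^sub>E P" "E = (\<Inter>i<n. (T ^^ i) -` A i)" and c: "c \<in> E"
      unfolding J_def iterated_join_def by auto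
    have "cell ((T ^^ i) c) = A i" if "i < n" for i
      using A c that cell(2)[of "A i"] by (auto simp: PiE_iff)
    then have "E = nm -` {nm c}" unfolding fibre A(2) by auto
    then show "E \<in> (\<lambda>v. nm -` {v}) ` range nm" by blast
  qed
  moreover have "inj_on (\<lambda>v. nm -` {v}) (range nm)" by (rule inj_onI) auto
  ultimately have bij: "bij_betw (\<lambda>v. nm -` {v}) (range nm) (J - {{}})" by (simp add: bij_betw_def)
  have "partition_entropy \<mu> J = - (\<Sum>E\<in>J - {{}}. prob E * ln (prob E))"
    unfolding partition_entropy_def using finJ by (subst sum.mono_neutral_right[of J "J - {{}}"]) auto
  also have "\<dots> = - (\<Sum>v\<in>range nm. prob (nm -` {v}) * ln (prob (nm -` {v})))"
    by (subst sum.reindex_bij_betw[OF bij, symmetric]) simp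
  also have "\<dots> = rv_entropy \<mu> nm" by (simp add: rv_entropy_def)
  also have "\<dots> = rv_entropy lifted (L.itinerary (\<lambda>x. cell (to_circle x)) n)"
  proof -
    have "simple_function borel (L.itinerary (\<lambda>x. cell (to_circle x)) n)"
      using L.simple_itinerary[OF s, of n] L.sets_M by (simp add: simple_function_def)
    then show ?thesis unfolding lifted_def by (subst rv_entropy_distr) (auto simp: nm)
  qed
  finally show ?thesis by (simp add: J_def T_def)
qed

text \<open>The digits generate: a partition is nearly a function of finitely many of them, so up to
  \<open>\<tau>\<close> its entropy rate is at most theirs. If \<open>H n0 < \<tau> * n0\<close> for
  one \<open>n0\<close>, subadditivity bounds the digit rate by \<open>\<tau>\<close>, and the
  partition rate is at most \<open>2 * \<tau> = e / 2\<close>, contrary to the choice of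
  \<open>e\<close>.\<close>

lemma positive_entropy_rate:
  assumes ks: "ks_entropy \<mu> (times_map (int p)) > 0"
  obtains c where "c > 0" "\<And>n. L.H n \<ge> c * real n"
proof (rule ccontr)
  assume neg: "\<not> thesis"
  obtain P where P: "finite_measurable_partition \<mu> P" and "entropy_of_partition \<mu> (times_map (int p)) P > 0"
    using ks unfolding ks_entropy_def less_SUP_iff by auto
  then obtain e where e: "e > 0" "ereal e < entropy_of_partition \<mu> (times_map (int p)) P"
    by (metis ereal_dense2 ereal_less(2))
  define \<tau> where "\<tau> = e / 4"
  have \<tau>: "\<tau> > 0" using e by (simp add: \<tau>_def)
  have "\<exists>n0. L.H n0 < \<tau> * real n0"
  proof (rule ccontr)
    assume "\<not> ?thesis"
    then have "L.H n \<ge> \<tau> * real n" for n by (auto simp: not_less)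
    with \<tau> have thesis by (rule that)
    with neg show False by simp
  qed
  then obtain n0 where n0: "L.H n0 < \<tau> * real n0" by blast
  have "n0 > 0" using n0 L.H_nonneg[of n0] by (cases n0) auto
  obtain cell where cell: "\<And>x. cell x \<in> P" "\<And>x A. A \<in> P \<Longrightarrow> cell x = A \<longleftrightarrow> x \<in> A"
    "simple_function lifted (\<lambda>x. cell (to_circle x))" "simple_function \<mu> cell"
    by (rule cells_of_partition[OF P]) (rule that)
  obtain m where m: "\<And>m'. m' \<ge> m \<Longrightarrow> rv_entropy lifted (\<lambda>x. (cell (to_circle x), L.digits m' x)) \<le> L.H m' + \<tau>"
    by (rule L.cond_entropy_digits_small[OF cell(3) \<tau>]) (rule that)
  define K where "K = real n0 * L.H 1 + L.H m"
  have bound: "partition_entropy \<mu> (iterated_join \<mu> (times_map (int p)) P n) \<le> 2 * \<tau> * real n + K" for n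
  proof -
    have "partition_entropy \<mu> (iterated_join \<mu> (times_map (int p)) P n) \<le> L.H (n + m) + real n * \<tau>"
    proof -
      have "partition_entropy \<mu> (iterated_join \<mu> (times_map (int p)) P n)
          = rv_entropy lifted (L.itinerary (\<lambda>x. cell (to_circle x)) n)"
        by (rule partition_entropy_join[OF P]) (fact cell)+
      also have "\<dots> \<le> L.H (n + m) + real n * \<tau>"
        by (rule L.itinerary_entropy[OF cell(3) m[OF order_refl]])
      finally show ?thesis .
    qed
    also have "L.H (n + m) \<le> L.H n + L.H m" by (rule L.H_add)
    also have "L.H n \<le> \<tau> * real n + real n0 * L.H 1"
      by (rule L.H_linear_bound) (use n0 \<open>n0 > 0\<close> \<tau> in auto)
    finally show ?thesis by (simp add: K_def algebra_simps)
  qed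
  have "(\<lambda>n. 2 * \<tau> + K / real n) \<longlonglongrightarrow> 2 * \<tau> + 0"
    by (intro tendsto_add tendsto_const lim_const_over_n)
  then have "\<forall>\<^sub>F n in sequentially. 2 * \<tau> + K / real n < e"
    by (rule order_tendstoD(2)) (use e in \<open>simp add: \<tau>_def\<close>)
  then have "\<forall>\<^sub>F n in sequentially.
      ereal (partition_entropy \<mu> (iterated_join \<mu> (times_map (int p)) P n) / real n) \<le> ereal e"
    using eventually_gt_at_top[of 0]
  proof eventually_elim
    case (elim n)
    have "partition_entropy \<mu> (iterated_join \<mu> (times_map (int p)) P n) / real n \<le> (2 * \<tau> * real n + K) / real n"
      by (intro divide_right_mono bound) simp
    also have "\<dots> = 2 * \<tau> + K / real n" using elim by (simp add: field_simps)
    finally show ?case using elim by simp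
  qed
  then have "entropy_of_partition \<mu> (times_map (int p)) P \<le> ereal e"
    unfolding entropy_of_partition_def by (rule Limsup_bounded)
  with e(2) show False by simp
qed

lemma lifted_character:
  "(\<integral>x. cis (2 * pi * (of_int m * x)) \<partial>lifted) = (\<integral>c. cis (2 * pi * (of_int m * circle_coord c)) \<partial>\<mu>)"
proof -
  have "continuous_on UNIV (\<lambda>x. cis (2 * pi * (of_int m * x)))" by (intro continuous_intros)
  then have "(\<lambda>x. cis (2 * pi * (of_int m * x))) \<in> borel_measurable borel"
    by (rule borel_measurable_continuous_onI)
  then show ?thesis unfolding lifted_def by (intro integral_distr) auto
qed

end

subsection \<open>Sparsity of the large spectrum along the sequence\<close>

text \<open>Remainder and quotient of \<open>a * r\<close> by \<open>n\<close> determine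
  \<open>r\<close>, and the quotient lies between \<open>- \<bar>a\<bar>\<close> and
  \<open>\<bar>a\<bar>\<close>. This passes from residues of \<open>a * c i\<close> to residues of
  \<open>c i\<close> although \<open>a\<close> need not be invertible modulo
  \<open>n\<close>.\<close>

lemma card_residues_le:
  fixes a :: int and n :: nat
  assumes a: "a \<noteq> 0" and n: "n > 0" and S: "finite S" and R: "finite R"
    and into: "\<And>r. r \<in> S \<Longrightarrow> r < n \<and> nat ((a * int r) mod int n) \<in> R"
  shows "card S \<le> (2 * nat \<bar>a\<bar> + 1) * card R"
proof -
  let ?f = "\<lambda>r. (nat ((a * int r) mod int n), (a * int r) div int n)"
  have "inj_on ?f S"
  proof
    fix r r' assume "?f r = ?f r'"
    then have eq: "(a * int r) mod int n = (a * int r') mod int n" "(a * int r) div int n = (a * int r') div int n"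
      using n by (auto simp: eq_nat_nat_iff)
    then have "a * int r = a * int r'" by (metis mult_div_mod_eq)
    then show "r = r'" using a by simp
  qed
  moreover have "?f ` S \<subseteq> R \<times> {- \<bar>a\<bar>..\<bar>a\<bar>}"
  proof clarify
    fix r assume r: "r \<in> S"
    then have rn: "int r < int n" using into by auto
    have le: "\<bar>a * int r\<bar> \<le> \<bar>a\<bar> * int n"
      unfolding abs_mult using rn by (intro mult_left_mono) auto
    have "(a * int r) div int n \<le> (\<bar>a\<bar> * int n) div int n"
      using le n by (intro zdiv_mono1) auto
    moreover have "((- \<bar>a\<bar>) * int n) div int n \<le> (a * int r) div int n"
      using le n by (intro zdiv_mono1) auto
    moreover have "((- \<bar>a\<bar>) * int n) div int n = - \<bar>a\<bar>"
      using n by (intro nonzero_mult_div_cancel_right) simp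
    ultimately show "nat (a * int r mod int n) \<in> R \<and> a * int r div int n \<in> {- \<bar>a\<bar>..\<bar>a\<bar>}"
      using into[OF r] n by simp
  qed
  moreover have "finite (R \<times> {- \<bar>a\<bar>..\<bar>a\<bar>})" using R by simp
  ultimately have "card S \<le> card (R \<times> {- \<bar>a\<bar>..\<bar>a\<bar>})" by (rule card_inj_on_le)
  also have "\<dots> = (2 * nat \<bar>a\<bar> + 1) * card R"
    by (simp add: card_cartesian_product nat_add_distrib mult.commute) (simp add: nat_eq_iff)
  finally show ?thesis .
qed

text \<open>Cauchy-Schwarz over the residue classes; two indices of \<open>B\<close> in one class
  form a collision.\<close>

lemma card_square_le_collisions:
  fixes c :: "nat \<Rightarrow> int"
  assumes B: "B \<subseteq> {..<p ^ n}" and S: "finite S" and p: "p > 0"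
    and into: "\<And>i. i \<in> B \<Longrightarrow> nat (c i mod int (p ^ n)) \<in> S"
  shows "(real (card B))\<^sup>2 \<le> real (card (collisions p c n)) * real (card S)"
proof -
  have finB: "finite B" using B by (rule finite_subset) simp
  define G where "G r = {i\<in>B. nat (c i mod int (p ^ n)) = r}" for r
  have finG: "finite (G r)" for r using finB by (simp add: G_def)
  have "B = (\<Union>r\<in>S. G r)" using into by (auto simp: G_def)
  then have "card B = card (\<Union>r\<in>S. G r)" by simp
  also have "\<dots> = (\<Sum>r\<in>S. card (G r))"
    using S finG by (intro card_UN_disjoint) (auto simp: G_def)
  finally have "(real (card B))\<^sup>2 = (\<Sum>r\<in>S. real (card (G r)))\<^sup>2" by simp
  also have "\<dots> \<le> (\<Sum>r\<in>S. (real (card (G r)))\<^sup>2) * real (card S)"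
    by (rule sum_squared_le_sum_of_squares)
  also have "(\<Sum>r\<in>S. (real (card (G r)))\<^sup>2) = real (\<Sum>r\<in>S. card (G r \<times> G r))"
    by (simp add: card_cartesian_product power2_eq_square)
  also have "(\<Sum>r\<in>S. card (G r \<times> G r)) = card (\<Union>r\<in>S. G r \<times> G r)"
    using S finG by (intro card_UN_disjoint [symmetric]) (auto simp: G_def)
  also have "\<dots> \<le> card (collisions p c n)"
  proof (rule card_mono)
    show "finite (collisions p c n)"
      by (rule finite_subset[of _ "{..<p ^ n} \<times> {..<p ^ n}"]) (auto simp: collisions_def)
    show "(\<Union>r\<in>S. G r \<times> G r) \<subseteq> collisions p c n"
    proof clarify
      fix r k l assume kl: "k \<in> G r" "l \<in> G r"
      then have "nat (c k mod int (p ^ n)) = nat (c l mod int (p ^ n))" by (auto simp: G_def)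
      then have "c k mod int (p ^ n) = c l mod int (p ^ n)"
        using p by (subst (asm) eq_nat_nat_iff) auto
      moreover have "k < p ^ n" "l < p ^ n" using kl B by (auto simp: G_def)
      ultimately show "(k, l) \<in> collisions p c n" by (simp add: collisions_def cong_def)
    qed
  qed
  then have "real (card (\<Union>r\<in>S. G r \<times> G r)) * real (card S) \<le> real (card (collisions p c n)) * real (card S)"
    by (intro mult_right_mono) auto
  finally show ?thesis by simp
qed

context circle_system
begin

definition fourier :: "int \<Rightarrow> complex" where
  "fourier m = (\<integral>c. cis (2 * pi * (of_int m * circle_coord c)) \<partial>\<mu>)"

lemma norm_fourier_le: "norm (fourier m) \<le> 1"
proof -
  have "norm (fourier m) \<le> (\<integral>c. norm (cis (2 * pi * (of_int m * circle_coord c))) \<partial>\<mu>)"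
    unfolding fourier_def by (rule integral_norm_bound)
  then show ?thesis using prob_space by simp
qed

text \<open>Half of \<open>\<delta>\<close> pays for the factor \<open>2 * p ^ k\<close> per block,
  the other half for a budget \<open>j\<close> of about \<open>\<delta>' * n\<close> bad visits,
  each costing \<open>p ^ g\<close>. The exceptional set has measure at most
  \<open>\<epsilon> * \<delta>' / 2\<close>, so the expected number of visits in \<open>n\<close>
  steps stays within \<open>\<epsilon> / 2 * (j + 1)\<close>.\<close>

lemma large_spectrum_sparse:
  assumes erg: "ergodic \<mu> (times_map (int p))" and ks: "ks_entropy \<mu> (times_map (int p)) > 0"
    and \<epsilon>: "\<epsilon> > 0" and \<delta>: "\<delta> > 0"
  obtains g C where "g > 0" "C > 0"
    "\<And>n. real (card {r. r < p ^ (g * n) \<and> (\<exists>m. [m = int r] (mod int (p ^ (g * n))) \<and> norm (fourier m) > \<epsilon>)})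
      \<le> C * real p powr (\<delta> * real (g * n))"
proof -
  obtain c where c: "c > 0" "\<And>n. L.H n \<ge> c * real n"
    by (rule positive_entropy_rate[OF ks]) (rule that)
  define \<delta>' where "\<delta>' = \<delta> / 2"
  have \<delta>': "\<delta>' > 0" using \<delta> by (simp add: \<delta>'_def)
  have \<tau>: "\<epsilon> * \<delta>' / 2 > 0" using \<epsilon> \<delta>' by simp
  interpret E: ergodic_positive_entropy lifted p c
    by unfold_locales (use lifted_ergodic[OF erg] c in auto)
  obtain k where k: "\<And>g. g \<ge> k \<Longrightarrow> \<exists>P \<kappa> N. branch_kernel lifted (p ^ g) P \<and> \<kappa> > 0 \<and> N \<in> sets borel \<and>
      measure lifted N \<le> \<epsilon> * \<delta>' / 2 \<and>
      (\<forall>z. z \<notin> N \<longrightarrow> card (annihilator (p ^ g) {a. a < p ^ g \<and> \<kappa> \<le> P a z}) \<le> p ^ k)"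
    by (rule E.good_kernel[OF \<tau>]) (rule that)
  \<comment> \<open>Large enough for
    \<open>2 * p ^ k \<le> p ^ (k + 1) \<le> p powr (\<delta>' * g)\<close>; possible because
    \<open>k\<close> is already fixed.\<close>
  define g where "g = max (Suc k) (nat \<lceil>real (k + 1) / \<delta>'\<rceil>)"
  have g: "g \<ge> k" "g > 0" by (auto simp: g_def)
  have gk: "real (k + 1) \<le> \<delta>' * real g"
  proof -
    have "real (k + 1) / \<delta>' \<le> real (nat \<lceil>real (k + 1) / \<delta>'\<rceil>)" by (rule real_nat_ceiling_ge)
    also have "\<dots> \<le> real g" by (simp add: g_def)
    finally show ?thesis using \<delta>' by (simp add: field_simps)
  qed
  obtain P \<kappa> N where P: "branch_kernel lifted (p ^ g) P" and \<kappa>: "\<kappa> > 0" and N: "N \<in> sets borel"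
    and small: "measure lifted N \<le> \<epsilon> * \<delta>' / 2"
    and ann: "\<And>z. z \<notin> N \<Longrightarrow> card (annihilator (p ^ g) {a. a < p ^ g \<and> \<kappa> \<le> P a z}) \<le> p ^ k"
    using k[OF g(1)] by blast
  interpret K: branch_kernel lifted "p ^ g" P by (rule P)
  obtain s where s: "s > 0" and
    flat: "\<And>P. (\<And>a. a < p ^ g \<Longrightarrow> P a \<ge> 0) \<Longrightarrow> (\<Sum>a<p ^ g. P a) = 1 \<Longrightarrow>
      flattens (p ^ g) s (2 * real (card (annihilator (p ^ g) {a. a < p ^ g \<and> \<kappa> \<le> P a}))) P"
    using flattening[OF K.b_pos \<kappa>] by metis
  define Lc where "Lc = 2 * real p ^ k"
  have "(1 :: real) \<le> real p ^ k" using p_gt_1 by (intro one_le_power) simp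
  then have Lc: "Lc \<ge> 1" by (simp add: Lc_def)
  show ?thesis
  proof (rule that[of g "(2 / \<epsilon>) ^ (2 * s)"])
    show "g > 0" by (rule g)
    show "(2 / \<epsilon>) ^ (2 * s) > 0" using \<epsilon> by simp
    fix n
    define j where "j = nat \<lfloor>\<delta>' * real n\<rfloor>"
    have j: "\<delta>' * real n \<le> real j + 1" "real j \<le> \<delta>' * real n"
    proof -
      have "0 \<le> \<delta>' * real n" using \<delta>' by simp
      then show "\<delta>' * real n \<le> real j + 1" "real j \<le> \<delta>' * real n" unfolding j_def by linarith+
    qed
    let ?A = "{r. r < p ^ (g * n) \<and> (\<exists>m. [m = int r] (mod int (p ^ (g * n))) \<and> norm (fourier m) > \<epsilon>)}"
    have "real (card {r. r < (p ^ g) ^ n \<and> (\<exists>m. [m = int r] (mod int ((p ^ g) ^ n)) \<and>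
        norm (\<integral>x. cis (2 * pi * (of_int m * x)) \<partial>lifted) > \<epsilon>)}) * (\<epsilon> / 2) ^ (2 * s) \<le> Lc ^ n * real (p ^ g) ^ j"
    proof (rule K.card_large_spectrum_le[OF N _ s Lc \<epsilon>])
      show "real n * measure lifted N \<le> \<epsilon> / 2 * (real j + 1)"
      proof -
        have "real n * measure lifted N \<le> real n * (\<epsilon> * \<delta>' / 2)" using small by (intro mult_left_mono) auto
        also have "\<dots> = \<epsilon> / 2 * (\<delta>' * real n)" by simp
        also have "\<dots> \<le> \<epsilon> / 2 * (real j + 1)" using j \<epsilon> by (intro mult_left_mono) auto
        finally show ?thesis .
      qed
      fix z assume z: "z \<notin> N"
      have "real (card (annihilator (p ^ g) {a. a < p ^ g \<and> \<kappa> \<le> P a z})) \<le> real (p ^ k)"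
        using ann[OF z] by (rule of_nat_mono)
      then show "flattens (p ^ g) s Lc (\<lambda>a. P a z)"
        by (intro flattens_mono[OF flat] K.P_nonneg K.P_sum) (simp add: Lc_def)
    qed
    then have le: "real (card ?A) * (\<epsilon> / 2) ^ (2 * s) \<le> Lc ^ n * real (p ^ g) ^ j"
      by (simp only: lifted_character fourier_def [symmetric] power_mult)
    have "Lc \<le> real p powr (\<delta>' * real g)"
    proof -
      have "Lc \<le> real p ^ (k + 1)" using p_gt_1 by (simp add: Lc_def mult_right_mono)
      also have "\<dots> = real p powr real (k + 1)" using p_gt_1 by (intro powr_realpow [symmetric]) simp
      also have "\<dots> \<le> real p powr (\<delta>' * real g)" using gk p_gt_1 by (intro powr_mono) auto
      finally show ?thesis .
    qed
    then have "Lc ^ n \<le> (real p powr (\<delta>' * real g)) ^ n" using Lc by (intro power_mono) auto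
    also have "\<dots> = real p powr (\<delta>' * real g * real n)" using p_gt_1 by (simp add: powr_power mult.commute)
    finally have 1: "Lc ^ n \<le> real p powr (\<delta>' * real g * real n)" .
    have "real (p ^ g) ^ j = real p powr (real g * real j)"
      using p_gt_1 by (simp add: powr_realpow power_mult [symmetric] flip: of_nat_mult)
    also have "\<dots> \<le> real p powr (real g * (\<delta>' * real n))"
      using j p_gt_1 by (intro powr_mono mult_left_mono) auto
    finally have "Lc ^ n * real (p ^ g) ^ j
        \<le> real p powr (\<delta>' * real g * real n) * real p powr (real g * (\<delta>' * real n))"
      using 1 Lc by (intro mult_mono) auto
    also have "\<dots> = real p powr (\<delta> * real (g * n))"
      by (simp add: powr_add [symmetric] \<delta>'_def algebra_simps)
    finally have "real (card ?A) * (\<epsilon> / 2) ^ (2 * s) \<le> real p powr (\<delta> * real (g * n))" using le by simp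
    then show "real (card ?A) \<le> (2 / \<epsilon>) ^ (2 * s) * real p powr (\<delta> * real (g * n))"
      using \<epsilon> by (simp add: power_divide field_simps)
  qed
qed

lemma collision_bound:
  assumes "collision_exponent p c < 2"
  obtains \<theta> n0 where "\<theta> < 2" "\<And>n. n \<ge> n0 \<Longrightarrow> real (card (collisions p c n)) \<le> real p powr (\<theta> * real n)"
proof -
  obtain \<theta> where \<theta>: "collision_exponent p c < ereal \<theta>" "ereal \<theta> < 2"
    using assms ereal_dense2 by blast
  have "\<forall>\<^sub>F n in sequentially. ereal (ln (real (card (collisions p c n))) / (real n * ln (real p))) < ereal \<theta>"
    using \<theta>(1) unfolding collision_exponent_def by (rule Limsup_lessD)
  then have "\<forall>\<^sub>F n in sequentially. real (card (collisions p c n)) \<le> real p powr (\<theta> * real n)"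
    using eventually_gt_at_top[of 0]
  proof eventually_elim
    case (elim n)
    have "ln (real (card (collisions p c n))) / (real n * ln (real p)) < \<theta>" using elim by simp
    moreover have "real n * ln (real p) > 0" using elim p_gt_1 by simp
    ultimately have le: "ln (real (card (collisions p c n))) \<le> \<theta> * (real n * ln (real p))"
      by (simp add: divide_less_eq)
    show ?case
    proof (cases "card (collisions p c n) = 0")
      case False
      then have "real (card (collisions p c n)) = exp (ln (real (card (collisions p c n))))" by simp
      also have "\<dots> \<le> exp (\<theta> * (real n * ln (real p)))" using le by simp
      also have "\<dots> = real p powr (\<theta> * real n)" using p_gt_1 by (simp add: powr_def mult_ac)
      finally show ?thesis .
    qed simp
  qed
  then obtain n0 where n0: "\<And>n. n \<ge> n0 \<Longrightarrow> real (card (collisions p c n)) \<le> real p powr (\<theta> * real n)"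
    by (auto simp: eventually_sequentially)
  have "\<theta> < 2" using \<theta>(2) by (simp add: numeral_eq_ereal)
  from that[OF this n0] show ?thesis .
qed

text \<open>At the scales \<open>p ^ (g * n)\<close> Cauchy-Schwarz combines the collision bound
  with the sparse spectrum and saves a power. Any other \<open>N\<close> is compared with the next
  scale.\<close>

lemma bad_indices_sparse:
  assumes erg: "ergodic \<mu> (times_map (int p))" and ks: "ks_entropy \<mu> (times_map (int p)) > 0"
    and col: "collision_exponent p c < 2" and \<epsilon>: "\<epsilon> > 0" and a: "a \<noteq> 0" and \<rho>: "\<rho> > 0"
  shows "\<forall>\<^sub>F N in sequentially. real (card {i. i < N \<and> norm (fourier (a * c i)) > \<epsilon>}) \<le> \<rho> * real N"
proof -
  obtain \<theta> n0 where \<theta>: "\<theta> < 2"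
    and col_le: "\<And>n. n \<ge> n0 \<Longrightarrow> real (card (collisions p c n)) \<le> real p powr (\<theta> * real n)"
    by (rule collision_bound[OF col]) (rule that)
  \<comment> \<open>Half of the gap below 2, so that
    \<open>\<theta> + \<delta> = 2 - \<delta>\<close>.\<close>
  define \<delta> where "\<delta> = (2 - \<theta>) / 2"
  have \<delta>: "\<delta> > 0" using \<theta> by (simp add: \<delta>_def)
  obtain g C where g: "g > 0" and C: "C > 0" and sparse:
    "\<And>n. real (card {r. r < p ^ (g * n) \<and> (\<exists>m. [m = int r] (mod int (p ^ (g * n))) \<and> norm (fourier m) > \<epsilon>)})
      \<le> C * real p powr (\<delta> * real (g * n))"
    by (rule large_spectrum_sparse[OF erg ks \<epsilon> \<delta>]) (rule that)
  define B where "B N = {i. i < N \<and> norm (fourier (a * c i)) > \<epsilon>}" for N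
  define C' where "C' = (2 * real_of_int \<bar>a\<bar> + 1) * C"
  have C': "C' > 0" using C by (simp add: C'_def add_nonneg_pos)
  have sq: "(real (card (B (p ^ (g * n)))))\<^sup>2 \<le> C' * real p powr (- \<delta> * real (g * n)) * (real (p ^ (g * n)))\<^sup>2"
    if n: "g * n \<ge> n0" for n
  proof -
    define J where "J = g * n"
    define q where "q = p ^ J"
    have q: "q > 0" using p_gt_1 by (simp add: q_def)
    define R where "R = {r. r < q \<and> (\<exists>m. [m = int r] (mod int q) \<and> norm (fourier m) > \<epsilon>)}"
    define S where "S = (\<lambda>i. nat (c i mod int q)) ` B q"
    have finS: "finite S" by (simp add: S_def B_def)
    have finR: "finite R" by (rule finite_subset[of _ "{..<q}"]) (auto simp: R_def)
    have "card S \<le> (2 * nat \<bar>a\<bar> + 1) * card R"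
    proof (rule card_residues_le[OF a q finS finR])
      fix r assume "r \<in> S"
      then obtain i where i: "i < q" "norm (fourier (a * c i)) > \<epsilon>" "r = nat (c i mod int q)"
        by (auto simp: S_def B_def)
      have r: "int r = c i mod int q" using i q by simp
      then have "r < q" using q by (metis of_nat_less_iff pos_mod_bound of_nat_0_less_iff)
      moreover have "nat ((a * int r) mod int q) \<in> R"
      proof -
        have "(a * int r) mod int q = (a * c i) mod int q" by (simp add: r mod_mult_right_eq)
        then have "[a * c i = int (nat ((a * int r) mod int q))] (mod int q)"
          using q by (simp add: cong_def)
        moreover have "nat ((a * int r) mod int q) < q" using q by (simp add: nat_less_iff)
        ultimately show ?thesis using i(2) by (auto simp: R_def)
      qed
      ultimately show "r < q \<and> nat ((a * int r) mod int q) \<in> R" by simp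
    qed
    then have "real (card S) \<le> real ((2 * nat \<bar>a\<bar> + 1) * card R)" by (rule of_nat_mono)
    also have "\<dots> = (2 * real_of_int \<bar>a\<bar> + 1) * real (card R)" by (simp add: algebra_simps)
    also have "\<dots> \<le> (2 * real_of_int \<bar>a\<bar> + 1) * (C * real p powr (\<delta> * real J))"
      using sparse[of n] by (intro mult_left_mono) (auto simp: R_def q_def J_def)
    finally have cS: "real (card S) \<le> C' * real p powr (\<delta> * real J)" by (simp add: C'_def mult.assoc)
    have "(real (card (B q)))\<^sup>2 \<le> real (card (collisions p c J)) * real (card S)"
      unfolding q_def
      by (rule card_square_le_collisions[OF _ finS]) (use p_gt_1 in \<open>auto simp: S_def q_def B_def\<close>)
    also have "\<dots> \<le> real p powr (\<theta> * real J) * (C' * real p powr (\<delta> * real J))"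
      using col_le[of J] n cS by (intro mult_mono) (auto simp: J_def)
    also have "\<dots> = C' * (real p powr (\<theta> * real J) * real p powr (\<delta> * real J))" by simp
    also have "real p powr (\<theta> * real J) * real p powr (\<delta> * real J) = real p powr (- \<delta> * real J) * real p powr (2 * real J)"
    proof -
      have "\<theta> * real J + \<delta> * real J = - \<delta> * real J + 2 * real J" by (simp add: \<delta>_def field_simps)
      then show ?thesis by (simp only: powr_add [symmetric])
    qed
    also have "real p powr (2 * real J) = (real (p ^ J))\<^sup>2"
    proof -
      have "real p powr (2 * real J) = real p powr real (2 * J)" by simp
      also have "\<dots> = real p ^ (2 * J)" using p_gt_1 by (intro powr_realpow) simp
      finally show ?thesis by (simp add: power_even_eq)
    qed
    finally show ?thesis by (simp add: q_def J_def mult.assoc)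
  qed
  \<comment> \<open>Passing from \<open>N\<close> to the next power of \<open>p ^ g\<close> enlarges
    the range by at most the factor \<open>p ^ g\<close>.\<close>
  define \<rho>' where "\<rho>' = \<rho> / real (p ^ g)"
  have \<rho>': "\<rho>' > 0" using \<rho> p_gt_1 by (simp add: \<rho>'_def)
  define x where "x = real p powr (- \<delta> * real g)"
  have x: "0 < x" "x < 1" using p_gt_1 \<delta> g by (auto simp: x_def powr_less_one)
  have "(\<lambda>n. C' * x ^ n) \<longlonglongrightarrow> C' * 0"
    using x by (intro tendsto_mult tendsto_const LIMSEQ_realpow_zero) auto
  then have "\<forall>\<^sub>F n in sequentially. C' * x ^ n < \<rho>'\<^sup>2"
    using \<rho>' by (intro order_tendstoD(2)) auto
  then obtain n1 where n1: "\<And>n. n \<ge> n1 \<Longrightarrow> C' * x ^ n < \<rho>'\<^sup>2" by (auto simp: eventually_sequentially)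
  have block: "real (card (B (p ^ (g * n)))) \<le> \<rho>' * real (p ^ (g * n))" if "n \<ge> max n0 n1" for n
  proof -
    have "n \<le> g * n" using g by simp
    then have "g * n \<ge> n0" using that by linarith
    then have "(real (card (B (p ^ (g * n)))))\<^sup>2 \<le> C' * real p powr (- \<delta> * real (g * n)) * (real (p ^ (g * n)))\<^sup>2"
      by (rule sq)
    also have "real p powr (- \<delta> * real (g * n)) = x ^ n"
      using p_gt_1 by (simp add: x_def powr_power mult_ac)
    also have "C' * x ^ n * (real (p ^ (g * n)))\<^sup>2 \<le> \<rho>'\<^sup>2 * (real (p ^ (g * n)))\<^sup>2"
      using n1[of n] that by (intro mult_right_mono) auto
    also have "\<dots> = (\<rho>' * real (p ^ (g * n)))\<^sup>2" by (simp add: power_mult_distrib)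
    finally show ?thesis by (rule power2_le_imp_le) (use \<rho>' in simp)
  qed
  have base: "p ^ g \<ge> 2"
  proof -
    have "p ^ 1 \<le> p ^ g" using g p_gt_1 by (intro power_increasing) auto
    then show ?thesis using p_gt_1 by simp
  qed
  show ?thesis
    unfolding eventually_sequentially
  proof (intro exI allI impI)
    fix N assume N: "(p ^ g) ^ (max n0 n1) \<le> N"
    have "1 \<le> (p ^ g) ^ (max n0 n1)" by (rule one_le_power) (use base in linarith)
    then have "N \<ge> 1" using N by linarith
    then obtain n where n: "(p ^ g) ^ n \<le> N" "N < (p ^ g) ^ (n + 1)"
      using ex_power_ivl1[OF base] by blast
    have "(p ^ g) ^ (max n0 n1) < (p ^ g) ^ (n + 1)" using N n(2) by linarith
    then have "max n0 n1 < n + 1" by (rule power_less_imp_less_exp[rotated]) (use base in linarith)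
    then have big: "n + 1 \<ge> max n0 n1" by simp
    have "card (B N) \<le> card (B (p ^ (g * (n + 1))))"
    proof (rule card_mono)
      show "finite (B (p ^ (g * (n + 1))))" by (simp add: B_def)
      show "B N \<subseteq> B (p ^ (g * (n + 1)))" using n(2) unfolding B_def power_mult by (auto intro: less_trans)
    qed
    then have "real (card (B N)) \<le> real (card (B (p ^ (g * (n + 1)))))" by simp
    also have "\<dots> \<le> \<rho>' * real (p ^ (g * (n + 1)))" by (rule block[OF big])
    also have "\<dots> = \<rho> * real ((p ^ g) ^ n)"
    proof -
      have "p ^ (g * (n + 1)) = p ^ g * (p ^ g) ^ n" by (simp only: power_mult Suc_eq_plus1 [symmetric] power_Suc)
      then have "real (p ^ (g * (n + 1))) = real (p ^ g) * real ((p ^ g) ^ n)" by (simp only: of_nat_mult)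
      moreover have "real (p ^ g) \<noteq> 0" using p_gt_1 by simp
      moreover have "\<rho> / Y * (Y * X) = \<rho> * X" if "Y \<noteq> 0" for X Y :: real using that by simp
      ultimately show ?thesis unfolding \<rho>'_def by metis
    qed
    also have "\<dots> \<le> \<rho> * real N" using n(1) \<rho> by (intro mult_left_mono of_nat_mono) auto
    finally show "real (card {i. i < N \<and> norm (fourier (a * c i)) > \<epsilon>}) \<le> \<rho> * real N" by (simp add: B_def)
  qed
qed

text \<open>Coefficients above \<open>e / 3\<close> are bounded by 1 and few, the others are small;
  both groups contribute at most \<open>e / 3\<close> to the average.\<close>

lemma fourier_averages_tendsto_0:
  assumes erg: "ergodic \<mu> (times_map (int p))" and ks: "ks_entropy \<mu> (times_map (int p)) > 0"
    and col: "collision_exponent p c < 2" and a: "a \<noteq> 0"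
  shows "(\<lambda>N. (\<Sum>n<N. fourier (a * c n)) / of_nat N) \<longlonglongrightarrow> 0"
proof (rule tendstoI)
  fix e :: real assume e: "e > 0"
  have "\<forall>\<^sub>F N in sequentially. real (card {i. i < N \<and> norm (fourier (a * c i)) > e / 3}) \<le> e / 3 * real N"
    by (rule bad_indices_sparse[OF erg ks col _ a]) (use e in auto)
  then show "\<forall>\<^sub>F N in sequentially. dist ((\<Sum>n<N. fourier (a * c n)) / of_nat N) 0 < e"
    using eventually_gt_at_top[of 0]
  proof eventually_elim
    case (elim N)
    have "norm (\<Sum>n<N. fourier (a * c n)) \<le> (\<Sum>n<N. e / 3 + of_bool (norm (fourier (a * c n)) > e / 3))"
    proof (rule sum_norm_le)
      fix n
      show "norm (fourier (a * c n)) \<le> e / 3 + of_bool (norm (fourier (a * c n)) > e / 3)"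
        using norm_fourier_le[of "a * c n"] e by auto
    qed
    also have "\<dots> = real N * (e / 3) + real (card {i. i < N \<and> norm (fourier (a * c i)) > e / 3})"
    proof -
      have "(\<Sum>n<N. of_bool (norm (fourier (a * c n)) > e / 3)) = real (card {i. i < N \<and> norm (fourier (a * c i)) > e / 3})"
        by (simp add: of_bool_def sum.If_cases Int_def lessThan_def)
      then show ?thesis by (simp only: sum.distrib) simp
    qed
    also have "\<dots> \<le> real N * (2 * e / 3)" using elim by simp
    also have "\<dots> < real N * e" using elim e by simp
    finally have "norm (\<Sum>n<N. fourier (a * c n)) < real N * e" .
    then show ?case using elim by (simp add: norm_divide divide_less_eq mult.commute)
  qed
qed

end

subsection \<open>Weyl's criterion\<close>

definition circle_char :: "int \<Rightarrow> circle \<Rightarrow> complex" where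
  "circle_char m c = cis (2 * pi * (of_int m * circle_coord c))"

lemma cis_frac: "cis (2 * pi * (of_int m * frac x)) = cis (2 * pi * (of_int m * x))"
proof -
  have "2 * pi * (of_int m * x) = 2 * pi * (of_int m * frac x) + 2 * pi * of_int (m * \<lfloor>x\<rfloor>)"
    by (simp add: frac_def algebra_simps)
  then show ?thesis by (simp only: cis_mult [symmetric] cis_multiple_2pi Ints_of_int mult_1_right)
qed

lemma circle_char_to_circle: "circle_char m (to_circle x) = cis (2 * pi * (of_int m * x))"
  by (simp add: circle_char_def cis_frac)

lemma circle_char_times_map: "circle_char m (times_map k c) = circle_char (m * k) c"
  unfolding circle_char_def circle_coord_times_map cis_frac by (simp only: of_int_mult mult.assoc)

lemma circle_char_mult: "circle_char m c * circle_char k c = circle_char (m + k) c"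
  by (simp add: circle_char_def cis_mult algebra_simps)

lemma circle_char_0 [simp]: "circle_char 0 c = 1"
  by (simp add: circle_char_def)

lemma continuous_circle_char: "continuous_on UNIV (circle_char m)"
proof -
  have "open (circle_char m -` U)" if "open U" for U
  proof -
    have "to_circle -` (circle_char m -` U) = (\<lambda>x. cis (2 * pi * (of_int m * x))) -` U"
      by (auto simp: circle_char_to_circle)
    moreover have "open ((\<lambda>x. cis (2 * pi * (of_int m * x))) -` U)"
      using that by (intro open_vimage continuous_intros)
    ultimately show ?thesis by (simp add: open_circle_def)
  qed
  then show ?thesis by (simp add: continuous_on_open_vimage)
qed

lemma inj_circle_char_1: "inj (circle_char 1)"
proof
  fix x y assume "circle_char 1 x = circle_char 1 y"
  then have "cis (2 * pi * circle_coord x) / cis (2 * pi * circle_coord y) = 1"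
    by (simp add: circle_char_def)
  then have "cis (2 * pi * (circle_coord x - circle_coord y)) = 1"
    by (simp add: cis_divide algebra_simps)
  then have "cos (2 * pi * (circle_coord x - circle_coord y)) = 1"
    by (simp add: complex_eq_iff)
  then obtain k :: int where "2 * pi * (circle_coord x - circle_coord y) = of_int k * 2 * pi"
    unfolding cos_one_2pi_int by blast
  then have "circle_coord x - circle_coord y = of_int k" by simp
  then have "to_circle (circle_coord x) = to_circle (circle_coord y)"
    by (simp only: to_circle_eq_iff Ints_of_int)
  then show "x = y" by simp
qed

text \<open>Stone-Weierstrass requires a Hausdorff space; separation is pulled back along the
  injective continuous character of frequency 1.\<close>

instance circle :: t2_space
proof
  fix x y :: circle assume "x \<noteq> y"
  then have "circle_char 1 x \<noteq> circle_char 1 y" using inj_circle_char_1 by (auto dest: injD)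
  from hausdorff[OF this]
  obtain U V where UV: "open U" "open V" "circle_char 1 x \<in> U" "circle_char 1 y \<in> V" "U \<inter> V = {}"
    by blast
  show "\<exists>U V. open U \<and> open V \<and> x \<in> U \<and> y \<in> V \<and> U \<inter> V = {}"
  proof (intro exI conjI)
    show "open (circle_char 1 -` U)" "open (circle_char 1 -` V)"
      using UV continuous_circle_char by (simp_all add: continuous_on_open_vimage)
  qed (use UV in auto)
qed

lemma compact_circle: "compact (UNIV :: circle set)"
proof -
  have "compact (to_circle ` {0..1})"
    using continuous_on_to_circle by (intro compact_continuous_image) (auto intro: continuous_on_subset)
  moreover have "to_circle ` {0..1} = UNIV"
  proof (intro equalityI subsetI UNIV_I)
    fix c :: circle
    have "c = to_circle (circle_coord c)" by simp
    then show "c \<in> to_circle ` {0..1}"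
      using circle_coord_bounds[of c] by (intro image_eqI[of _ _ "circle_coord c"]) auto
  qed
  ultimately show ?thesis by simp
qed

text \<open>Generation by rules lets limits be proved for characters and carried along linearly;
  complex coefficients make the real and imaginary parts of a character members.\<close>

inductive_set trig_polys :: "(circle \<Rightarrow> complex) set" where
  char: "circle_char m \<in> trig_polys"
| add: "f \<in> trig_polys \<Longrightarrow> g \<in> trig_polys \<Longrightarrow> (\<lambda>c. f c + g c) \<in> trig_polys"
| scale: "f \<in> trig_polys \<Longrightarrow> (\<lambda>c. z * f c) \<in> trig_polys"

lemma trig_polys_mult: "f \<in> trig_polys \<Longrightarrow> g \<in> trig_polys \<Longrightarrow> (\<lambda>c. f c * g c) \<in> trig_polys"
proof (induction f rule: trig_polys.induct)
  case (char m)
  from char show ?case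
  proof (induction g rule: trig_polys.induct)
    case (char k)
    show ?case unfolding circle_char_mult by (rule trig_polys.char)
  next
    case (add f g)
    then show ?case by (simp add: distrib_left trig_polys.add)
  next
    case (scale f z)
    then show ?case using trig_polys.scale[of "\<lambda>c. circle_char m c * f c" z] by (simp add: mult.left_commute)
  qed
next
  case (add f g')
  then show ?case by (simp add: distrib_right trig_polys.add)
next
  case (scale f z)
  then show ?case using trig_polys.scale[of "\<lambda>c. f c * g c" z] by (simp add: mult.assoc)
qed

lemma trig_polys_const: "(\<lambda>c. z) \<in> trig_polys"
  using trig_polys.scale[OF trig_polys.char[of 0], of z] by simp

lemma trig_polys_continuous: "f \<in> trig_polys \<Longrightarrow> continuous_on UNIV f"
  by (induction rule: trig_polys.induct) (auto intro: continuous_circle_char continuous_intros)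

text \<open>The real-valued trigonometric polynomials form a ring, and the cosine and sine of
  frequency 1, combinations of the characters 1 and -1, separate points.\<close>

lemma trig_polys_dense:
  fixes f :: "circle \<Rightarrow> real"
  assumes f: "continuous_on UNIV f" and e: "e > 0"
  obtains g where "(\<lambda>c. complex_of_real (g c)) \<in> trig_polys" "\<And>c. \<bar>f c - g c\<bar> < e"
proof -
  define R where "R = {g :: circle \<Rightarrow> real. (\<lambda>c. complex_of_real (g c)) \<in> trig_polys}"
  interpret function_ring_on R UNIV
  proof
    show "compact (UNIV :: circle set)" by (rule compact_circle)
    fix f assume f: "f \<in> R"
    then have "continuous_on UNIV (\<lambda>c. Re (complex_of_real (f c)))"
      unfolding R_def by (intro continuous_on_Re trig_polys_continuous) simp
    then show "continuous_on UNIV f" by simp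
    fix g assume g: "g \<in> R"
    show "(\<lambda>x. f x + g x) \<in> R"
      using f g trig_polys.add[of "\<lambda>c. of_real (f c)" "\<lambda>c. of_real (g c)"] by (simp add: R_def)
    show "(\<lambda>x. f x * g x) \<in> R"
      using f g trig_polys_mult[of "\<lambda>c. of_real (f c)" "\<lambda>c. of_real (g c)"] by (simp add: R_def)
  next
    show "(\<lambda>_. c) \<in> R" for c by (simp add: R_def trig_polys_const)
    fix x y :: circle assume "x \<noteq> y"
    then have "circle_char 1 x \<noteq> circle_char 1 y" using inj_circle_char_1 by (auto dest: injD)
    then consider "Re (circle_char 1 x) \<noteq> Re (circle_char 1 y)" | "Im (circle_char 1 x) \<noteq> Im (circle_char 1 y)"
      by (auto simp: complex_eq_iff)
    then show "\<exists>f\<in>R. f x \<noteq> f y"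
    proof cases
      case 1
      have "(\<lambda>c. 1 / 2 * (circle_char 1 c + circle_char (- 1) c)) \<in> trig_polys"
        by (intro trig_polys.scale trig_polys.add trig_polys.char)
      also have "(\<lambda>c. 1 / 2 * (circle_char 1 c + circle_char (- 1) c)) = (\<lambda>c. of_real (Re (circle_char 1 c)))"
        by (auto simp: circle_char_def complex_eq_iff)
      finally show ?thesis using 1 by (auto simp: R_def)
    next
      case 2
      have "(\<lambda>c. - \<i> / 2 * (circle_char 1 c + (- 1) * circle_char (- 1) c)) \<in> trig_polys"
        by (intro trig_polys.scale trig_polys.add trig_polys.char)
      also have "(\<lambda>c. - \<i> / 2 * (circle_char 1 c + (- 1) * circle_char (- 1) c)) = (\<lambda>c. of_real (Im (circle_char 1 c)))"
        by (auto simp: circle_char_def complex_eq_iff)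
      finally show ?thesis using 2 by (auto simp: R_def)
    qed
  qed
  from Stone_Weierstrass_basic[OF f e] obtain g where "g \<in> R" "\<And>x. \<bar>f x - g x\<bar> < e" by auto
  then show ?thesis using that[of g] by (simp add: R_def)
qed

text \<open>For \<open>m \<noteq> 0\<close> the antiderivative \<open>F\<close> takes the same value
  at 0 and 1.\<close>

lemma integral_circle_char_lebesgue:
  "(\<integral>c. circle_char m c \<partial>circle_lebesgue) = (if m = 0 then 1 else 0)"
proof (cases "m = 0")
  case True
  interpret prob_space circle_lebesgue by (rule prob_space_circle_lebesgue)
  show ?thesis using True prob_space by simp
next
  case False
  define F where "F x = cis (2 * pi * (of_int m * x)) / (\<i> * of_real (2 * pi * of_int m))" for x :: real
  have meas: "(\<lambda>x. cis (2 * pi * (of_int m * x))) \<in> borel_measurable borel"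
    by (intro borel_measurable_continuous_onI continuous_intros)
  have "(\<integral>c. circle_char m c \<partial>circle_lebesgue)
      = (\<integral>x. circle_char m (to_circle x) \<partial>restrict_space lborel {0..<1})"
    unfolding circle_lebesgue_def
    by (intro integral_distr measurable_restrict_space1)
      (auto intro: borel_measurable_continuous_onI continuous_circle_char)
  also have "\<dots> = (\<integral>x. indicator {0..<1} x *\<^sub>R cis (2 * pi * (of_int m * x)) \<partial>lborel)"
    by (subst integral_restrict_space) (auto simp: circle_char_to_circle)
  also have "\<dots> = (\<integral>x. indicator {0..1} x *\<^sub>R cis (2 * pi * (of_int m * x)) \<partial>lborel)"
  proof (rule integral_cong_AE)
    show "AE x in lborel. indicator {0..<1} x *\<^sub>R cis (2 * pi * (of_int m * x))
        = indicator {0..1} x *\<^sub>R cis (2 * pi * (of_int m * x))"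
      using AE_lborel_singleton[of "1::real"] by eventually_elim (auto simp: indicator_def)
  qed (use meas in measurable)
  also have "\<dots> = F 1 - F 0"
  proof (rule integral_FTC_atLeastAtMost)
    fix x :: real
    have "((\<lambda>x. cis (2 * pi * (of_int m * x))) has_vector_derivative
        (2 * pi * of_int m) *\<^sub>R (\<i> * cis (2 * pi * (of_int m * x)))) (at x within {0..1})"
    proof -
      have "(cis has_vector_derivative \<i> * cis y) (at y within S)" for y S
        unfolding cis_conv_exp [abs_def]
        by (auto intro!: derivative_eq_intros simp: has_vector_derivative_real_field algebra_simps)
      moreover have "((\<lambda>x. 2 * pi * (of_int m * x)) has_vector_derivative 2 * pi * of_int m) (at x within {0..1})"
        by (auto intro!: derivative_eq_intros)
      ultimately show ?thesis
        using vector_diff_chain_within[of "\<lambda>x. 2 * pi * (of_int m * x)" "2 * pi * of_int m" x "{0..1}" cis]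
        by (simp add: o_def)
    qed
    then have "(F has_vector_derivative (2 * pi * of_int m) *\<^sub>R (\<i> * cis (2 * pi * (of_int m * x))) / (\<i> * of_real (2 * pi * of_int m)))
        (at x within {0..1})"
      unfolding F_def [abs_def] by (rule has_vector_derivative_divide)
    also have "(2 * pi * of_int m) *\<^sub>R (\<i> * cis (2 * pi * (of_int m * x))) / (\<i> * of_real (2 * pi * of_int m))
        = cis (2 * pi * (of_int m * x))"
      using False by (simp add: scaleR_conv_of_real)
    finally show "(F has_vector_derivative cis (2 * pi * (of_int m * x))) (at x within {0..1})" .
  qed (auto intro!: continuous_intros)
  also have "\<dots> = 0"
  proof -
    have "cis (2 * pi * of_int m) = 1" by (rule cis_multiple_2pi) simp
    then show ?thesis by (simp add: F_def)
  qed
  finally show ?thesis using False by simp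
qed

context circle_system
begin

text \<open>The average is the mixture of the image measures over a uniform index below
  \<open>N\<close>, so the integral formula for \<open>bind\<close> applies to the bounded
  integrand.\<close>

lemma integral_averaged_measure:
  fixes f :: "circle \<Rightarrow> real"
  assumes f: "continuous_on UNIV f" and N: "N > 0"
  shows "integral\<^sup>L (averaged_measure c \<mu> N) f = (\<Sum>n<N. \<integral>x. f (times_map (c n) x) \<partial>\<mu>) / real N"
proof -
  have fm [measurable]: "f \<in> borel_measurable borel" by (rule borel_measurable_continuous_onI[OF f])
  have "bounded (range f)" using compact_continuous_image[OF f compact_circle] by (rule compact_imp_bounded)
  then obtain B where B: "\<And>x. \<bar>f x\<bar> \<le> B" by (auto simp: bounded_iff)
  define \<nu> where "\<nu> n = distr \<mu> borel (times_map (c n))" for n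
  have tm: "times_map k \<in> measurable \<mu> borel" for k
    using measurable_times_map by (simp add: measurable_cong_sets[OF sets_\<mu> refl])
  have prob: "prob_space (\<nu> n)" for n unfolding \<nu>_def by (rule prob_space_distr[OF tm])
  define pm where "pm = pmf_of_set {..<N}"
  have ne: "{..<N} \<noteq> {}" using N by auto
  have kern: "\<nu> \<in> measurable (measure_pmf pm) (subprob_algebra borel)"
    using prob by (auto simp: space_subprob_algebra \<nu>_def intro!: prob_space_imp_subprob_space)
  have "averaged_measure c \<mu> N = measure_pmf pm \<bind> \<nu>"
  proof (rule measure_eqI)
    show "sets (averaged_measure c \<mu> N) = sets (measure_pmf pm \<bind> \<nu>)"
      by (subst sets_bind[of _ _ borel]) (auto simp: \<nu>_def)
    fix A assume "A \<in> sets (averaged_measure c \<mu> N)"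
    then have A: "A \<in> sets borel" by simp
    have "emeasure (measure_pmf pm \<bind> \<nu>) A = (\<integral>\<^sup>+n. emeasure (\<nu> n) A \<partial>measure_pmf pm)"
      by (rule emeasure_bind[OF _ kern A]) simp
    also have "\<dots> = (\<Sum>n<N. emeasure (\<nu> n) A) / of_nat N"
      unfolding pm_def using ne by (subst nn_integral_pmf_of_set) auto
    finally show "emeasure (averaged_measure c \<mu> N) A = emeasure (measure_pmf pm \<bind> \<nu>) A"
      by (simp add: emeasure_averaged_measure[OF A] \<nu>_def)
  qed
  then have "integral\<^sup>L (averaged_measure c \<mu> N) f = (\<integral>n. integral\<^sup>L (\<nu> n) f \<partial>measure_pmf pm)"
  proof (simp only:, intro integral_bind[OF fm _ kern, where B' = 1])
    show "\<bar>f x\<bar> \<le> B" for x by (rule B)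
    show "finite_measure (measure_pmf pm)" by unfold_locales
    show "AE n in measure_pmf pm. emeasure (\<nu> n) (space (\<nu> n)) \<le> ennreal 1"
      using prob_space.emeasure_space_1[OF prob] by simp
  qed
  also have "\<dots> = (\<Sum>n<N. integral\<^sup>L (\<nu> n) f) / real N"
    unfolding pm_def using ne by (subst integral_pmf_of_set) auto
  also have "(\<Sum>n<N. integral\<^sup>L (\<nu> n) f) = (\<Sum>n<N. \<integral>x. f (times_map (c n) x) \<partial>\<mu>)"
    unfolding \<nu>_def by (intro sum.cong refl integral_distr tm fm)
  finally show ?thesis .
qed

text \<open>Linearity extends the limit from characters to trigonometric polynomials, and uniform
  approximation extends it to continuous functions. For \<open>N > 0\<close> the measures involved
  have mass 1, so the approximation error is the same for all of them.\<close>

lemma weyl_criterion: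
  assumes chars: "\<And>m. m \<noteq> 0 \<Longrightarrow>
    (\<lambda>N. (\<Sum>n<N. \<integral>x. circle_char (m * c n) x \<partial>\<mu>) / of_nat N) \<longlonglongrightarrow> 0"
  shows "generic c \<mu>"
proof -
  interpret leb: prob_space circle_lebesgue by (rule prob_space_circle_lebesgue)
  have sets_leb: "sets circle_lebesgue = sets borel" by (simp add: circle_lebesgue_def)
  have bounded: "\<exists>B. \<forall>x. norm (g x) \<le> B" if "continuous_on UNIV g" for g :: "circle \<Rightarrow> 'b :: {banach, second_countable_topology}"
    using compact_imp_bounded[OF compact_continuous_image[OF that compact_circle]] by (auto simp: bounded_iff)
  have cont_times: "continuous_on UNIV (\<lambda>x. g (times_map k x))" if "continuous_on UNIV g" for g :: "circle \<Rightarrow> 'b :: {banach, second_countable_topology}" and k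
    using that continuous_on_times_map[of k] by (rule continuous_on_compose2) auto
  have int\<mu>: "integrable \<mu> g" if g: "continuous_on UNIV g" for g :: "circle \<Rightarrow> 'b :: {banach, second_countable_topology}"
  proof -
    obtain B where "\<forall>x. norm (g x) \<le> B" using bounded[OF g] by blast
    then show ?thesis using borel_measurable_continuous_onI[OF g]
      by (intro integrable_const_bound[where B = B]) (auto simp: measurable_cong_sets[OF sets_\<mu> refl])
  qed
  have intl: "integrable circle_lebesgue g" if g: "continuous_on UNIV g" for g :: "circle \<Rightarrow> 'b :: {banach, second_countable_topology}"
  proof -
    obtain B where "\<forall>x. norm (g x) \<le> B" using bounded[OF g] by blast
    then show ?thesis using borel_measurable_continuous_onI[OF g]
      by (intro leb.integrable_const_bound[where B = B]) (auto simp: measurable_cong_sets[OF sets_leb refl])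
  qed
  define Av where "Av g N = (\<Sum>n<N. \<integral>x. g (times_map (c n) x) \<partial>\<mu>) / of_nat N" for g :: "circle \<Rightarrow> complex" and N
  have trig: "(Av g \<longlonglongrightarrow> (\<integral>x. g x \<partial>circle_lebesgue))" if "g \<in> trig_polys" for g
    using that
  proof (induction g rule: trig_polys.induct)
    case (char m)
    show ?case
    proof (cases "m = 0")
      case True
      have "\<forall>\<^sub>F N in sequentially. Av (circle_char 0) N = 1"
        using eventually_gt_at_top[of 0] by eventually_elim (use prob_space in \<open>simp add: Av_def\<close>)
      from tendsto_eventually[OF this] show ?thesis
        unfolding integral_circle_char_lebesgue True by (simp del: circle_char_0)
    next
      case False
      then show ?thesis using chars[OF False]
        by (simp add: integral_circle_char_lebesgue Av_def [abs_def] circle_char_times_map)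
    qed
  next
    case (add f g)
    have cf: "continuous_on UNIV f" "continuous_on UNIV g" using add trig_polys_continuous by auto
    have "Av (\<lambda>c. f c + g c) = (\<lambda>N. Av f N + Av g N)"
      unfolding Av_def using int\<mu>[OF cont_times[OF cf(1)]] int\<mu>[OF cont_times[OF cf(2)]]
      by (simp add: sum.distrib add_divide_distrib)
    moreover have "(\<integral>x. f x + g x \<partial>circle_lebesgue) = (\<integral>x. f x \<partial>circle_lebesgue) + (\<integral>x. g x \<partial>circle_lebesgue)"
      by (rule Bochner_Integration.integral_add[OF intl[OF cf(1)] intl[OF cf(2)]])
    ultimately show ?case using add by (simp add: tendsto_add)
  next
    case (scale f z)
    have "Av (\<lambda>c. z * f c) = (\<lambda>N. z * Av f N)"
      unfolding Av_def by (simp add: sum_distrib_left)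
    then show ?case using scale by (simp add: tendsto_mult_left)
  qed
  show ?thesis
    unfolding generic_def weak_star_conv_def
  proof (intro allI impI)
    fix f :: "circle \<Rightarrow> real" assume f: "continuous_on UNIV f"
    show "(\<lambda>N. integral\<^sup>L (averaged_measure c \<mu> N) f) \<longlonglongrightarrow> integral\<^sup>L circle_lebesgue f"
    proof (rule tendstoI)
      fix e :: real assume e: "e > 0"
      obtain g where g: "(\<lambda>c. complex_of_real (g c)) \<in> trig_polys" "\<And>c. \<bar>f c - g c\<bar> < e / 3"
      proof (rule trig_polys_dense[OF f])
        show "e / 3 > 0" using e by simp
      qed (rule that)
      have "continuous_on UNIV (\<lambda>c. Re (complex_of_real (g c)))"
        by (intro continuous_on_Re trig_polys_continuous g)
      then have gc: "continuous_on UNIV g" by simp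
      define Ar where "Ar h N = (\<Sum>n<N. \<integral>x. h (times_map (c n) x) \<partial>\<mu>) / real N" for h :: "circle \<Rightarrow> real" and N
      have "Av (\<lambda>c. complex_of_real (g c)) = (\<lambda>N. complex_of_real (Ar g N))"
        by (simp add: Av_def Ar_def fun_eq_iff)
      moreover have "(\<integral>x. complex_of_real (g x) \<partial>circle_lebesgue) = complex_of_real (integral\<^sup>L circle_lebesgue g)"
        by simp
      ultimately have "(\<lambda>N. complex_of_real (Ar g N)) \<longlonglongrightarrow> complex_of_real (integral\<^sup>L circle_lebesgue g)"
        using trig[OF g(1)] by simp
      then have "Ar g \<longlonglongrightarrow> integral\<^sup>L circle_lebesgue g"
        by (simp only: tendsto_of_real_iff)
      then have "\<forall>\<^sub>F N in sequentially. dist (Ar g N) (integral\<^sup>L circle_lebesgue g) < e / 3"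
        using e by (intro tendstoD) auto
      then show "\<forall>\<^sub>F N in sequentially. dist (integral\<^sup>L (averaged_measure c \<mu> N) f) (integral\<^sup>L circle_lebesgue f) < e"
        using eventually_gt_at_top[of 0]
      proof eventually_elim
        case (elim N)
        have each: "\<bar>(\<integral>x. f (times_map k x) \<partial>\<mu>) - (\<integral>x. g (times_map k x) \<partial>\<mu>)\<bar> \<le> e / 3" for k
        proof -
          have "\<bar>(\<integral>x. f (times_map k x) - g (times_map k x) \<partial>\<mu>)\<bar> \<le> (\<integral>x. \<bar>f (times_map k x) - g (times_map k x)\<bar> \<partial>\<mu>)"
            by (rule integral_abs_bound)
          also have "\<dots> \<le> (\<integral>x. e / 3 \<partial>\<mu>)"
            using g(2) by (intro integral_mono int\<mu> continuous_intros cont_times f gc) (auto intro: less_imp_le)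
          finally show ?thesis
            using int\<mu>[OF cont_times[OF f]] int\<mu>[OF cont_times[OF gc]] prob_space by simp
        qed
        have "\<bar>Ar f N - Ar g N\<bar> = \<bar>\<Sum>n<N. (\<integral>x. f (times_map (c n) x) \<partial>\<mu>) - (\<integral>x. g (times_map (c n) x) \<partial>\<mu>)\<bar> / real N"
          using elim by (simp add: Ar_def sum_subtractf diff_divide_distrib [symmetric])
        also have "\<dots> \<le> (\<Sum>n<N. e / 3) / real N"
          by (intro divide_right_mono order_trans[OF sum_abs] sum_mono each) auto
        also have "\<dots> = e / 3" using elim by simp
        finally have 1: "\<bar>Ar f N - Ar g N\<bar> \<le> e / 3" .
        have "\<bar>(\<integral>x. f x - g x \<partial>circle_lebesgue)\<bar> \<le> (\<integral>x. \<bar>f x - g x\<bar> \<partial>circle_lebesgue)"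
          by (rule integral_abs_bound)
        also have "\<dots> \<le> (\<integral>x. e / 3 \<partial>circle_lebesgue)"
          using g(2) by (intro integral_mono intl continuous_intros f gc) (auto intro: less_imp_le)
        finally have 2: "\<bar>integral\<^sup>L circle_lebesgue f - integral\<^sup>L circle_lebesgue g\<bar> \<le> e / 3"
          using intl[OF f] intl[OF gc] leb.prob_space by simp
        have "integral\<^sup>L (averaged_measure c \<mu> N) f = Ar f N"
          unfolding Ar_def using elim by (intro integral_averaged_measure f) auto
        with 1 2 elim show ?case unfolding dist_real_def by linarith
      qed
    qed
  qed
qed

end

theorem theorem1p4:
  fixes p :: nat and c :: "nat \<Rightarrow> int" and \<mu> :: "circle measure"
  assumes "p > 1"
    and "collision_exponent p c < 2"
    and "prob_space \<mu>"
    and "sets \<mu> = sets borel"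
    and "invariant_measure \<mu> (times_map (int p))"
    and "ergodic \<mu> (times_map (int p))"
    and "ks_entropy \<mu> (times_map (int p)) > 0"
  shows "generic c \<mu>"
proof -
  interpret circle_system \<mu> p
    using assms by (intro circle_system.intro circle_system_axioms.intro) auto
  show ?thesis
  proof (rule weyl_criterion)
    fix m :: int assume "m \<noteq> 0"
    then have "(\<lambda>N. (\<Sum>n<N. fourier (m * c n)) / of_nat N) \<longlonglongrightarrow> 0"
      using assms by (intro fourier_averages_tendsto_0) auto
    then show "(\<lambda>N. (\<Sum>n<N. \<integral>x. circle_char (m * c n) x \<partial>\<mu>) / of_nat N) \<longlonglongrightarrow> 0"
      by (simp add: fourier_def circle_char_def)
  qed
qed

end
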